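(* Fix an integer $n\ge2$. If $\mathcal T_1,\mathcal T_2\in\mathsf{ATam}_{\mathsf{Tors}}$, then the triangulations of $\mathcal T_1$ and $\mathcal T_2$ are related by a flip move if and only if $\mathcal T_1$ and $\mathcal T_2$ are related by a cover relation in $\mathsf{ATam}_{\mathsf{Tors}}$ (i.e., one of them covers the other).
   Context: Fix an integer $n\ge 2$. Let $\mathcal Q$ be the oriented cycle quiver with vertices $\mathbb Z/n\mathbb Z$ and arrows $i\to i+1$. The affine Tamari algebra $A_{\mathcal Q}$ is the quotient of the path algebra $\mathbb C[\mathcal Q]$ by the ideal generated by all paths of length $n-1$. Representations are finite-dimensional modules, i.e. finite-dimensional spaces $M^i$ and maps $L^i\colon M^i\to M^{i+1}$ such that compositions of $n-1$ consecutive maps vanish. For integers $a<b<a+n$ (up to simultaneous translation by multiples of $n$), $M_{a,b}$ is the representation with $\mathbb C$ at (residues of) $a\le i\le b-1$, $0$ elsewhere, identity maps $L^i$ for $a\le i\le b-2$, other maps $0$; these are all the indecomposables up to isomorphism. A torsion class is a collection of representations closed under isomorphisms, quotients, and extensions; $\mathsf{ATam}_{\mathsf{Tors}}$ is the poset of torsion classes of $A_{\mathcal Q}$ under inclusion. Let $\mathbf P^\bullet$ be a regular $n$-gon with its center $\bullet$ removed. Label its edges $1,\ldots,n$ clockwise (in $\mathbb Z/n\mathbb Z$). Tagged arcs: for $a<b\le a+n-2$, $\mathfrak a_{a,b}$ is the arc that starts at the vertex immediately counterclockwise of edge $a$ and moves clockwise around $\bullet$ to the vertex immediately clockwise of edge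 $b$; $\mathfrak a_{a,a+n-1}$ is the plain radial arc joining $\bullet$ to the vertex between edges $a-1$ and $a$; $\mathfrak r_a$ is the notched radial arc joining $\bullet$ to the vertex immediately clockwise of edge $a$. The s$\tau$-tilting module of a torsion class $\mathcal T$ is the direct sum, each with multiplicity one, of all indecomposable $M\in\mathcal T$ with $\mathrm{Ext}^1_{A_{\mathcal Q}}(M,N)=0$ for every $N\in\mathcal T$. (Every $N\in\mathcal T$ is then a quotient of a direct sum of copies of it.) The triangulation of $\mathcal T$ is the set of tagged arcs consisting of all $\mathfrak a_{a,b}$ such that $M_{a,b}$ is a summand of the s$\tau$-tilting module of $\mathcal T$ and all $\mathfrak r_a$ such that the simple module $M_{a,a+1}$ is not a subquotient of any element of $\mathcal T$; it is a set of $n$ tagged arcs. Two triangulations are related by a flip move if they differ by exactly one arc, i.e. their intersection has size $n-1$. *)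

theory Defs
  imports "Jordan_Normal_Form.Matrix_Kernel"
begin

section \<open>Representations of the cyclic quiver\<close>

text \<open>
  Families indexed by \<open>\<int>/n\<int>\<close> are encoded as \<open>n\<close>-periodic functions on \<^typ>\<open>int\<close>.
  The space at vertex \<open>i\<close> is the coordinate space of complex column vectors of length
  \<open>vdim M i\<close>; every finite-dimensional representation is isomorphic to one of this form, so
  isomorphism-closed classes of representations correspond to isomorphism-closed
  sets of such coordinate representations.
\<close>

record rep =
  vdim :: "int \<Rightarrow> nat"
  arr :: "int \<Rightarrow> complex mat"

text \<open>The composition of the \<open>k\<close> consecutive maps starting at vertex \<open>i\<close>.\<close>

fun path_map :: "rep \<Rightarrow> int \<Rightarrow> nat \<Rightarrow> complex mat" where
  "path_map M i 0 = 1\<^sub>m (vdim M i)"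
| "path_map M i (Suc k) = arr M (i + int k) * path_map M i k"

definition reps :: "nat \<Rightarrow> rep set" where
  "reps n = {M. \<forall>i.
     vdim M (i + int n) = vdim M i \<and> arr M (i + int n) = arr M i \<and>
     arr M i \<in> carrier_mat (vdim M (i + 1)) (vdim M i) \<and>
     path_map M i (n - 1) = 0\<^sub>m (vdim M (i + int (n - 1))) (vdim M i)}"

text \<open>\<open>string_rep n a b\<close> is the representation $M_{a,b}$, meant for \<open>a < b < a + n\<close>.\<close>

definition string_rep :: "nat \<Rightarrow> int \<Rightarrow> int \<Rightarrow> rep" where
  "string_rep n a b =
     (let d = (\<lambda>i. if \<exists>k. k mod int n = i mod int n \<and> a \<le> k \<and> k \<le> b - 1 then 1 else 0) in
      \<lparr>vdim = d,
       arr = (\<lambda>i. if \<exists>k. k mod int n = i mod int n \<and> a \<le> k \<and> k \<le> b - 2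
                  then 1\<^sub>m 1 else 0\<^sub>m (d (i + 1)) (d i))\<rparr>)"

subsection \<open>Morphisms\<close>

definition is_hom :: "nat \<Rightarrow> rep \<Rightarrow> rep \<Rightarrow> (int \<Rightarrow> complex mat) \<Rightarrow> bool" where
  "is_hom n M N f \<longleftrightarrow> (\<forall>i.
     f (i + int n) = f i \<and> f i \<in> carrier_mat (vdim N i) (vdim M i) \<and>
     f (i + 1) * arr M i = arr N i * f i)"

definition is_mono :: "nat \<Rightarrow> rep \<Rightarrow> rep \<Rightarrow> (int \<Rightarrow> complex mat) \<Rightarrow> bool" where
  "is_mono n M N f \<longleftrightarrow> is_hom n M N f \<and>
     (\<forall>i. inj_on (\<lambda>v. f i *\<^sub>v v) (carrier_vec (vdim M i)))"

definition is_epi :: "nat \<Rightarrow> rep \<Rightarrow> rep \<Rightarrow> (int \<Rightarrow> complex mat) \<Rightarrow> bool" where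
  "is_epi n M N f \<longleftrightarrow> is_hom n M N f \<and>
     (\<forall>i. (\<lambda>v. f i *\<^sub>v v) ` carrier_vec (vdim M i) = carrier_vec (vdim N i))"

definition is_iso :: "nat \<Rightarrow> rep \<Rightarrow> rep \<Rightarrow> (int \<Rightarrow> complex mat) \<Rightarrow> bool" where
  "is_iso n M N f \<longleftrightarrow> is_hom n M N f \<and>
     (\<exists>g. is_hom n N M g \<and> (\<forall>i. g i * f i = 1\<^sub>m (vdim M i) \<and> f i * g i = 1\<^sub>m (vdim N i)))"

definition isomorphic :: "nat \<Rightarrow> rep \<Rightarrow> rep \<Rightarrow> bool" where
  "isomorphic n M N \<longleftrightarrow> (\<exists>f. is_iso n M N f)"

text \<open>\<open>is_quotient n M N\<close>: \<open>N\<close> is a quotient of \<open>M\<close>;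
  \<open>is_subquotient n M N\<close>: \<open>N\<close> is a subquotient of \<open>M\<close>.\<close>

definition is_quotient :: "nat \<Rightarrow> rep \<Rightarrow> rep \<Rightarrow> bool" where
  "is_quotient n M N \<longleftrightarrow> (\<exists>f. is_epi n M N f)"

definition is_subquotient :: "nat \<Rightarrow> rep \<Rightarrow> rep \<Rightarrow> bool" where
  "is_subquotient n M N \<longleftrightarrow> (\<exists>U\<in>reps n. (\<exists>f. is_mono n U M f) \<and> is_quotient n U N)"

text \<open>\<open>short_exact n N f E g M\<close>: the sequence $0 \to N \to E \to M \to 0$ with maps \<open>f\<close>, \<open>g\<close>
  is exact.\<close>

definition short_exact ::
    "nat \<Rightarrow> rep \<Rightarrow> (int \<Rightarrow> complex mat) \<Rightarrow> rep \<Rightarrow> (int \<Rightarrow> complex mat) \<Rightarrow> rep \<Rightarrow> bool" where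
  "short_exact n N f E g M \<longleftrightarrow> is_mono n N E f \<and> is_epi n E M g \<and>
     (\<forall>i. (\<lambda>v. f i *\<^sub>v v) ` carrier_vec (vdim N i) = mat_kernel (g i))"

subsection \<open>Direct sums\<close>

definition zero_rep :: rep where
  "zero_rep = \<lparr>vdim = (\<lambda>i. 0), arr = (\<lambda>i. 0\<^sub>m 0 0)\<rparr>"

definition direct_sum :: "rep \<Rightarrow> rep \<Rightarrow> rep" where
  "direct_sum M N =
     \<lparr>vdim = (\<lambda>i. vdim M i + vdim N i),
      arr = (\<lambda>i. four_block_mat
        (arr M i) (0\<^sub>m (vdim M (i + 1)) (vdim N i))
        (0\<^sub>m (vdim N (i + 1)) (vdim M i)) (arr N i))\<rparr>"

definition sum_inj :: "rep \<Rightarrow> rep \<Rightarrow> int \<Rightarrow> complex mat" where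
  "sum_inj M N i = mat (vdim M i + vdim N i) (vdim M i) (\<lambda>(r, c). of_bool (r = c))"

definition sum_proj :: "rep \<Rightarrow> rep \<Rightarrow> int \<Rightarrow> complex mat" where
  "sum_proj M N i = mat (vdim N i) (vdim M i + vdim N i) (\<lambda>(r, c). of_bool (c = vdim M i + r))"

definition direct_sum_list :: "rep list \<Rightarrow> rep" where
  "direct_sum_list Ms = foldr direct_sum Ms zero_rep"

definition is_summand :: "nat \<Rightarrow> rep \<Rightarrow> rep \<Rightarrow> bool" where
  "is_summand n M S \<longleftrightarrow> (\<exists>N\<in>reps n. isomorphic n S (direct_sum M N))"

definition is_zero :: "rep \<Rightarrow> bool" where
  "is_zero M \<longleftrightarrow> (\<forall>i. vdim M i = 0)"

definition indecomposable :: "nat \<Rightarrow> rep \<Rightarrow> bool" where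
  "indecomposable n M \<longleftrightarrow> M \<in> reps n \<and> \<not> is_zero M \<and>
     (\<forall>X\<in>reps n. \<forall>Y\<in>reps n. isomorphic n M (direct_sum X Y) \<longrightarrow> is_zero X \<or> is_zero Y)"

subsection \<open>Extensions\<close>

text \<open>$\mathrm{Ext}^1(M,N)$ is taken in Yoneda's form: equivalence classes of short exact
  sequences $0 \to N \to E \to M \to 0$, the neutral element being the class of the split
  sequence.\<close>

type_synonym extension = "rep \<times> (int \<Rightarrow> complex mat) \<times> (int \<Rightarrow> complex mat)"

definition extensions :: "nat \<Rightarrow> rep \<Rightarrow> rep \<Rightarrow> extension set" where
  "extensions n M N = {(E, f, g). E \<in> reps n \<and> short_exact n N f E g M}"

definition ext_equiv :: "nat \<Rightarrow> rep \<Rightarrow> rep \<Rightarrow> (extension \<times> extension) set" where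
  "ext_equiv n M N = {((E, f, g), (E', f', g')).
     (E, f, g) \<in> extensions n M N \<and> (E', f', g') \<in> extensions n M N \<and>
     (\<exists>h. is_iso n E E' h \<and> (\<forall>i. h i * f i = f' i \<and> g' i * h i = g i))}"

definition Ext1 :: "nat \<Rightarrow> rep \<Rightarrow> rep \<Rightarrow> extension set set" where
  "Ext1 n M N = extensions n M N // ext_equiv n M N"

definition Ext1_zero :: "nat \<Rightarrow> rep \<Rightarrow> rep \<Rightarrow> extension set" where
  "Ext1_zero n M N = ext_equiv n M N `` {(direct_sum N M, sum_inj N M, sum_proj N M)}"

definition Ext1_vanishes :: "nat \<Rightarrow> rep \<Rightarrow> rep \<Rightarrow> bool" where
  "Ext1_vanishes n M N \<longleftrightarrow> Ext1 n M N = {Ext1_zero n M N}"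

section \<open>Torsion classes\<close>

text \<open>Torsion classes are nonempty: they contain the zero representation.\<close>

definition torsion_class :: "nat \<Rightarrow> rep set \<Rightarrow> bool" where
  "torsion_class n T \<longleftrightarrow> T \<subseteq> reps n \<and> T \<noteq> {} \<and>
     (\<forall>M\<in>T. \<forall>N\<in>reps n. isomorphic n M N \<longrightarrow> N \<in> T) \<and>
     (\<forall>M\<in>T. \<forall>N\<in>reps n. is_quotient n M N \<longrightarrow> N \<in> T) \<and>
     (\<forall>A\<in>T. \<forall>B\<in>T. \<forall>E\<in>reps n. (\<exists>f g. short_exact n A f E g B) \<longrightarrow> E \<in> T)"

definition ATam_Tors :: "nat \<Rightarrow> rep set set" where
  "ATam_Tors n = {T. torsion_class n T}"

definition covers :: "nat \<Rightarrow> rep set \<Rightarrow> rep set \<Rightarrow> bool" where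
  "covers n T S \<longleftrightarrow> T \<in> ATam_Tors n \<and> S \<in> ATam_Tors n \<and> S \<subset> T \<and>
     \<not> (\<exists>U\<in>ATam_Tors n. S \<subset> U \<and> U \<subset> T)"

definition ext_projective :: "nat \<Rightarrow> rep set \<Rightarrow> rep \<Rightarrow> bool" where
  "ext_projective n T M \<longleftrightarrow> M \<in> T \<and> (\<forall>N\<in>T. Ext1_vanishes n M N)"

text \<open>The s$\tau$-tilting module is determined up to isomorphism: \<open>Ms\<close> lists each isomorphism
  class of indecomposable Ext-projectives of \<open>T\<close> exactly once.\<close>

definition is_stau_tilting :: "nat \<Rightarrow> rep set \<Rightarrow> rep \<Rightarrow> bool" where
  "is_stau_tilting n T S \<longleftrightarrow> (\<exists>Ms.
     (\<forall>M\<in>set Ms. indecomposable n M \<and> ext_projective n T M) \<and>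
     sorted_wrt (\<lambda>M N. \<not> isomorphic n M N) Ms \<and>
     (\<forall>M. indecomposable n M \<and> ext_projective n T M \<longrightarrow> (\<exists>N\<in>set Ms. isomorphic n M N)) \<and>
     S = direct_sum_list Ms)"

section \<open>Tagged arcs of the once-punctured polygon\<close>

text \<open>
  The vertex immediately counterclockwise of edge \<open>a\<close> (between edges \<open>a - 1\<close> and \<open>a\<close>) is
  denoted by \<open>a mod n\<close>, so the vertex immediately clockwise of edge \<open>b\<close> is \<open>(b + 1) mod n\<close>.
  Tagged arcs are recorded up to isotopy: \<open>Clockwise v w\<close> starts at vertex \<open>v\<close> and moves
  clockwise around the puncture to vertex \<open>w\<close>, passing at least two and at most \<open>n - 1\<close>
  edges, and is determined by its two endpoints.
\<close>

datatype tagged_arc = Clockwise int int | Plain_Radial int | Notched_Radial int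

definition arc_a :: "nat \<Rightarrow> int \<Rightarrow> int \<Rightarrow> tagged_arc" where
  "arc_a n a b =
     (if b = a + int n - 1 then Plain_Radial (a mod int n)
      else Clockwise (a mod int n) ((b + 1) mod int n))"

definition arc_r :: "nat \<Rightarrow> int \<Rightarrow> tagged_arc" where
  "arc_r n a = Notched_Radial ((a + 1) mod int n)"

definition triangulation :: "nat \<Rightarrow> rep set \<Rightarrow> tagged_arc set" where
  "triangulation n T =
     {arc_a n a b | a b. a < b \<and> b < a + int n \<and>
        (\<exists>S. is_stau_tilting n T S \<and> is_summand n (string_rep n a b) S)} \<union>
     {arc_r n a | a. \<forall>M\<in>T. \<not> is_subquotient n M (string_rep n a (a + 1))}"

definition flip_related :: "nat \<Rightarrow> tagged_arc set \<Rightarrow> tagged_arc set \<Rightarrow> bool" where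
  "flip_related n D D' \<longleftrightarrow> card (D \<inter> D') = n - 1"

end

theory Submission
  imports Defs
begin

text \<open>
  Write \<open>M(a,b)\<close> for \<open>string_rep n a b\<close>. The proof translates both sides of the equivalence into
  statements about functions \<open>e\<close> from \<open>\<int>\<close> to \<open>\<int>\<close> and compares them there.

  A longest nonzero path in a representation spans a string that splits off
  (\<open>string_retract\<close>, \<open>thin_retract_complement\<close>), so every representation is a direct sum of strings
  (\<open>reps_induct\<close>). A torsion class is therefore determined by the strings in it, and since the
  quotients of \<open>M(a,b)\<close> are the \<open>M(a,d)\<close> with \<open>d \<le> b\<close>, by the function \<open>e = reach n T\<close> for which
  \<open>M(a,b)\<close> lies in \<open>T\<close> if and only if \<open>b \<le> e a\<close>. Closure under extensions makes \<open>e\<close> a \<open>torsion_fun\<close>: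
  if \<open>a < b \<le> e a < a + n - 1\<close> then \<open>e b \<le> e a\<close>, because \<open>M(a,c)\<close> is an extension of \<open>M(a,b)\<close> by
  \<open>M(b,c)\<close>. Every such function occurs (\<open>reach_class_of_fun\<close>), so inclusion of torsion classes is the
  pointwise order of functions, and covers are covers of functions (\<open>covers_iff_fun_covers\<close>).

  The triangulation also depends on \<open>e\<close> only. Extensions of \<open>M(a,b)\<close> by \<open>X\<close> split precisely if every
  vector of \<open>X\<close> at \<open>b\<close> that dies on the way to \<open>a + n - 1\<close> comes from \<open>X\<close> at \<open>a\<close>; for a string \<open>X\<close>
  this fails just when \<open>X\<close> is some \<open>M(p,q)\<close> with \<open>a < p \<le> b < q \<le> a + n - 1\<close>. Hence \<open>M(a,b)\<close> is
  Ext-projective if and only if \<open>a < b \<le> e a\<close> and either \<open>b = a + n - 1\<close> or no \<open>p\<close> with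
  \<open>a < p \<le> b\<close> satisfies \<open>e p > b\<close> (\<open>ext_projective_string_iff\<close>).
  It follows that every vertex \<open>v\<close> contributes one arc (\<open>vertex_arc\<close>): if \<open>e v > v\<close>, the arc for
  \<open>M(v, e v)\<close>; if \<open>e v = v\<close>, the arc for \<open>M(a,v)\<close> with the last \<open>a < v\<close> such that \<open>e a > v\<close>, or the
  notched arc at \<open>v\<close> if there is no such \<open>a\<close>. In particular a triangulation has \<open>n\<close> arcs
  (\<open>card_arcs\<close>), and a flip means that each of the two triangulations has exactly one arc that the
  other lacks.

  Suppose that \<open>e' a < e a\<close>. Then the arc for \<open>M(a, e a)\<close> belongs to \<open>e\<close> only, and the arc that \<open>e'\<close> has
  at its fixed point \<open>e' a\<close> belongs to \<open>e'\<close> only; the latter is not the arc for any \<open>M(v, e' v)\<close>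
  (\<open>arc_lost\<close>, \<open>arc_gained\<close>). So under a flip from \<open>e\<close> to \<open>e'\<close> the values drop at one residue and
  rise nowhere, or conversely, and a function strictly between \<open>e'\<close> and \<open>e\<close> would yield a second arc of
  \<open>e\<close> that \<open>e'\<close> lacks: a flip is a cover. Conversely, let \<open>e\<close> cover \<open>e'\<close>, and choose \<open>a\<close> with \<open>e' a < e a\<close> so that
  \<open>e' a - a\<close> is minimal. Lowering \<open>e\<close> at the residue of \<open>a\<close> alone to the value \<open>e' a\<close> is then already a
  torsion function (\<open>lower_torsion_fun\<close>), so it is \<open>e'\<close>, and a comparison of the pairs above shows that
  \<open>e\<close> has no other arc than the one for \<open>M(a, e a)\<close> that \<open>e'\<close> lacks (\<open>flip_if_fun_covers\<close>).
\<close>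

section \<open>Matrices and vector spaces\<close>

text \<open>Side conditions on \<open>dim_row\<close> and \<open>dim_col\<close> contain no dimensions that occur on neither side of
  the equation, so the simplifier can discharge them.\<close>

lemma mult_assoc_dim:
  "dim_col A = dim_row B \<Longrightarrow> dim_col B = dim_row C \<Longrightarrow> (A * B) * C = A * (B * (C :: complex mat))"
  by (rule assoc_mult_mat[of _ "dim_row A" "dim_col A" _ "dim_col B" _ "dim_col C"]) auto

lemma distrib_left_dim:
  "dim_col A = dim_row B \<Longrightarrow> dim_row B = dim_row C \<Longrightarrow> dim_col B = dim_col C \<Longrightarrow>
    A * (B + C) = A * B + A * (C :: complex mat)"
  by (rule mult_add_distrib_mat[of _ "dim_row A" "dim_col A" _ "dim_col B"]) auto

lemma distrib_right_dim:
  "dim_row A = dim_row B \<Longrightarrow> dim_col A = dim_col B \<Longrightarrow> dim_col A = dim_row C \<Longrightarrow>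
    (A + B) * C = A * C + B * (C :: complex mat)"
  by (rule add_mult_distrib_mat[of _ "dim_row A" "dim_col A" _ _ "dim_col C"]) auto

lemma diff_distrib_left_dim:
  "dim_col A = dim_row B \<Longrightarrow> dim_row B = dim_row C \<Longrightarrow> dim_col B = dim_col C \<Longrightarrow>
    A * (B - C) = A * B - A * (C :: complex mat)"
  by (rule mult_minus_distrib_mat[of _ "dim_row A" "dim_col A" _ "dim_col B"]) auto

lemma diff_distrib_right_dim:
  "dim_row A = dim_row B \<Longrightarrow> dim_col A = dim_col B \<Longrightarrow> dim_col A = dim_row C \<Longrightarrow>
    (A - B) * C = A * C - B * (C :: complex mat)"
  by (rule minus_mult_distrib_mat[of _ "dim_row A" "dim_col A" _ _ "dim_col C"]) auto

lemma one_left_dim: "dim_row A = k \<Longrightarrow> 1\<^sub>m k * A = (A :: complex mat)"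
  by (rule left_mult_one_mat[of _ k "dim_col A"]) auto

lemma one_right_dim: "dim_col A = k \<Longrightarrow> A * 1\<^sub>m k = (A :: complex mat)"
  by (rule right_mult_one_mat[of _ "dim_row A" k]) auto

lemma zero_left_dim: "dim_row A = k \<Longrightarrow> 0\<^sub>m r k * A = (0\<^sub>m r (dim_col A) :: complex mat)"
  by (rule left_mult_zero_mat[of _ k "dim_col A"]) auto

lemma zero_right_dim: "dim_col A = k \<Longrightarrow> A * 0\<^sub>m k c = (0\<^sub>m (dim_row A) c :: complex mat)"
  by (rule right_mult_zero_mat[of _ "dim_row A" k]) auto

lemma add_zero_dim: "dim_row A = r \<Longrightarrow> dim_col A = c \<Longrightarrow> A + 0\<^sub>m r c = (A :: complex mat)"
  by (rule right_add_zero_mat[of _ r c]) auto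

lemma zero_add_dim: "dim_row A = r \<Longrightarrow> dim_col A = c \<Longrightarrow> 0\<^sub>m r c + A = (A :: complex mat)"
  by (rule left_add_zero_mat[of _ r c]) auto

lemma mult_vec_dim:
  "dim_col A = dim_row B \<Longrightarrow> dim_vec v = dim_col B \<Longrightarrow> (A * B) *\<^sub>v v = A *\<^sub>v (B *\<^sub>v (v :: complex vec))"
  by (rule assoc_mult_mat_vec[of _ "dim_row A" "dim_col A" _ "dim_col B"]) (auto intro: carrier_vecI)

lemma vec_add_dim:
  "dim_col A = dim_vec v \<Longrightarrow> dim_vec w = dim_vec v \<Longrightarrow> A *\<^sub>v (v + w) = A *\<^sub>v v + A *\<^sub>v (w :: complex vec)"
  by (rule mult_add_distrib_mat_vec[of _ "dim_row A" "dim_col A"]) (auto intro: carrier_vecI)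

lemma mat_add_vec_dim:
  "dim_row A = dim_row B \<Longrightarrow> dim_col A = dim_col B \<Longrightarrow> dim_col A = dim_vec v \<Longrightarrow>
    (A + B) *\<^sub>v v = A *\<^sub>v v + B *\<^sub>v (v :: complex vec)"
  by (rule add_mult_distrib_mat_vec[of _ "dim_row A" "dim_col A"]) (auto intro: carrier_vecI)

lemma mult_mat_vec_carrier_dim [simp]: "dim_row A = k \<Longrightarrow> A *\<^sub>v v \<in> carrier_vec k"
  by (rule carrier_vecI) simp

lemmas mat_alg = mult_assoc_dim distrib_left_dim distrib_right_dim diff_distrib_left_dim
  diff_distrib_right_dim one_left_dim one_right_dim zero_left_dim zero_right_dim
  add_zero_dim zero_add_dim

lemma one_mat_zero_dim: "1\<^sub>m k = (0\<^sub>m k k :: complex mat) \<Longrightarrow> k = 0"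
proof (rule ccontr)
  assume eq: "1\<^sub>m k = (0\<^sub>m k k :: complex mat)" and "k \<noteq> 0"
  then have "(1\<^sub>m k :: complex mat) $$ (0, 0) = 0" by (simp add: eq del: index_one_mat)
  then show False using \<open>k \<noteq> 0\<close> by simp
qed

lemma eq_mat_empty:
  fixes A B :: "complex mat"
  shows "dim_row A = dim_row B \<Longrightarrow> dim_col A = dim_col B \<Longrightarrow> dim_row A = 0 \<or> dim_col A = 0 \<Longrightarrow> A = B"
  by (rule eq_matI) auto

text \<open>Left multiples of a known product, for use on right-nested products.\<close>

lemma mult_eq_left:
  "A * B = (C :: complex mat) \<Longrightarrow> dim_col A = dim_row B \<Longrightarrow> dim_col B = dim_row X \<Longrightarrow> A * (B * X) = C * X"
  by (metis mult_assoc_dim)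

lemma col_mult_vec: "c < dim_col B \<Longrightarrow> dim_col A = dim_row B \<Longrightarrow> col (A * B) c = A *\<^sub>v col B (c :: nat)"
  for A B :: "complex mat"
  by (rule eq_vecI) auto

text \<open>Vectors are one-column matrices; a matrix equation can be solved column by column.\<close>

lemma mat_solve:
  fixes A B :: "complex mat"
  assumes "\<And>c. c < dim_col B \<Longrightarrow> \<exists>v\<in>carrier_vec (dim_col A). A *\<^sub>v v = col B c"
    and "dim_row A = dim_row B"
  shows "\<exists>C\<in>carrier_mat (dim_col A) (dim_col B). A * C = B"
proof -
  have "\<exists>f. \<forall>c<dim_col B. f c \<in> carrier_vec (dim_col A) \<and> A *\<^sub>v f c = col B c"
    using assms(1) by metis
  then obtain f where f: "\<And>c. c < dim_col B \<Longrightarrow> f c \<in> carrier_vec (dim_col A)"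
    "\<And>c. c < dim_col B \<Longrightarrow> A *\<^sub>v f c = col B c" by blast
  define C where "C = mat (dim_col A) (dim_col B) (\<lambda>(r, c). f c $ r)"
  have colC: "col C c = f c" if "c < dim_col B" for c
    using f(1)[OF that] that unfolding C_def by (intro eq_vecI) auto
  have "A * C = B"
  proof (rule mat_col_eqI)
    fix c assume c: "c < dim_col B"
    then show "col (A * C) c = col B c"
      using f(2)[OF c] colC[OF c] by (subst col_mult_vec) (auto simp: C_def)
  qed (auto simp: assms C_def)
  then show ?thesis by (intro bexI[of _ C]) (auto simp: C_def)
qed

lemma inj_mult_cancel:
  fixes A C D :: "complex mat"
  assumes "inj_on (\<lambda>v. A *\<^sub>v v) (carrier_vec (dim_col A))" "A * C = A * D"
    "dim_row C = dim_col A" "dim_row D = dim_col A" "dim_col C = dim_col D"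
  shows "C = D"
proof (rule mat_col_eqI)
  fix c assume c: "c < dim_col D"
  have "A *\<^sub>v col C c = A *\<^sub>v col D c"
    using assms c by (metis col_mult_vec)
  moreover have "col C c \<in> carrier_vec (dim_col A)" "col D c \<in> carrier_vec (dim_col A)"
    using assms(3,4) by (metis col_dim)+
  ultimately show "col C c = col D c" using assms(1) by (auto dest: inj_onD)
qed (use assms in auto)

lemma left_inverse_inj:
  fixes f u :: "complex mat"
  assumes "u * f = 1\<^sub>m (dim_col f)" "dim_col u = dim_row f"
  shows "inj_on (\<lambda>v. f *\<^sub>v v) (carrier_vec (dim_col f))"
proof (rule inj_onI)
  fix v w assume v: "v \<in> carrier_vec (dim_col f)" "w \<in> carrier_vec (dim_col f)" "f *\<^sub>v v = f *\<^sub>v w"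
  have "(u * f) *\<^sub>v v = (u * f) *\<^sub>v w"
    using v assms(2) by (simp add: mult_vec_dim)
  then show "v = w" using assms(1) v by simp
qed

lemma right_inverse_surj:
  fixes g w :: "complex mat"
  assumes "g * w = 1\<^sub>m (dim_row g)" "dim_row w = dim_col g"
  shows "(\<lambda>v. g *\<^sub>v v) ` carrier_vec (dim_col g) = carrier_vec (dim_row g)"
proof -
  have "v \<in> (\<lambda>v. g *\<^sub>v v) ` carrier_vec (dim_col g)" if v: "v \<in> carrier_vec (dim_row g)" for v
  proof -
    have "dim_col w = dim_row g" using assms(1) by (metis index_mult_mat(3) index_one_mat(3))
    then have "g *\<^sub>v (w *\<^sub>v v) = v"
      using v assms by (subst mult_vec_dim[symmetric]) auto
    moreover have "w *\<^sub>v v \<in> carrier_vec (dim_col g)"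
      using assms(2) by (metis dim_mult_mat_vec carrier_vec_dim_vec)
    ultimately show ?thesis by (metis imageI)
  qed
  then show ?thesis by auto
qed

text \<open>The columns of \<open>w\<close> are preimages of the unit vectors under \<open>g\<close>. Then \<open>1 - w * g\<close> maps into
  the kernel of \<open>g\<close>, which is the image of \<open>f\<close>, and \<open>u\<close> is the resulting factor. The next lemma is
  the converse; short exact sequences of representations are handled through such splittings at
  each vertex.\<close>

lemma vector_space_splitting:
  fixes f g :: "complex mat"
  assumes f: "f \<in> carrier_mat e d" and g: "g \<in> carrier_mat m e"
    and inj: "inj_on (\<lambda>v. f *\<^sub>v v) (carrier_vec d)"
    and surj: "(\<lambda>v. g *\<^sub>v v) ` carrier_vec e = carrier_vec m"
    and exact: "(\<lambda>v. f *\<^sub>v v) ` carrier_vec d = mat_kernel g"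
  shows "\<exists>u w. u \<in> carrier_mat d e \<and> w \<in> carrier_mat e m \<and>
    u * f = 1\<^sub>m d \<and> g * w = 1\<^sub>m m \<and> f * u + w * g = 1\<^sub>m e"
proof -
  have [simp]: "dim_row f = e" "dim_col f = d" "dim_row g = m" "dim_col g = e"
    using f g by auto
  have "\<exists>w\<in>carrier_mat (dim_col g) (dim_col (1\<^sub>m m :: complex mat)). g * w = 1\<^sub>m m"
  proof (rule mat_solve)
    fix c assume "c < dim_col (1\<^sub>m m :: complex mat)"
    then have "col (1\<^sub>m m) c \<in> (\<lambda>v. g *\<^sub>v v) ` carrier_vec e"
      unfolding surj by auto
    then show "\<exists>v\<in>carrier_vec (dim_col g). g *\<^sub>v v = col (1\<^sub>m m) c" by auto
  qed auto
  then obtain w where w: "w \<in> carrier_mat e m" "g * w = 1\<^sub>m m" by auto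
  then have [simp]: "dim_row w = e" "dim_col w = m" by auto
  have gf: "g * f = 0\<^sub>m m d"
  proof (rule mat_col_eqI)
    fix c assume c: "c < dim_col (0\<^sub>m m d :: complex mat)"
    have "f *\<^sub>v unit_vec d c \<in> mat_kernel g" unfolding exact[symmetric] by auto
    then have "g *\<^sub>v (f *\<^sub>v unit_vec d c) = 0\<^sub>v m" unfolding mat_kernel_def by auto
    moreover have "f *\<^sub>v unit_vec d c = col f c"
      using f c by (intro eq_vecI) auto
    ultimately show "col (g * f) c = col (0\<^sub>m m d) c"
      using c by (subst col_mult_vec) auto
  qed auto
  have g0: "g * (1\<^sub>m e - w * g) = 0\<^sub>m m e"
    using w g by (simp add: diff_distrib_left_dim mult_eq_left[OF w(2)] one_left_dim)
  have "\<exists>u\<in>carrier_mat (dim_col f) (dim_col (1\<^sub>m e - w * g)). f * u = 1\<^sub>m e - w * g"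
  proof (rule mat_solve)
    fix c assume c: "c < dim_col (1\<^sub>m e - w * g)"
    have "g *\<^sub>v col (1\<^sub>m e - w * g) c = 0\<^sub>v m"
      using c g0 by (subst col_mult_vec[symmetric]) auto
    then have "col (1\<^sub>m e - w * g) c \<in> mat_kernel g"
      unfolding mat_kernel_def by (auto intro: carrier_vecI)
    then show "\<exists>v\<in>carrier_vec (dim_col f). f *\<^sub>v v = col (1\<^sub>m e - w * g) c"
      unfolding exact[symmetric] by auto
  qed auto
  then obtain u where u: "u \<in> carrier_mat d e" "f * u = 1\<^sub>m e - w * g" by auto
  then have [simp]: "dim_row u = d" "dim_col u = e" by auto
  have "u * f = 1\<^sub>m d"
  proof (rule inj_mult_cancel[of f])
    have "f * (u * f) = (1\<^sub>m e - w * g) * f"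
      by (simp add: mult_assoc_dim[symmetric] u)
    also have "\<dots> = f - w * (g * f)"
      by (simp add: diff_distrib_right_dim one_left_dim mult_assoc_dim)
    also have "\<dots> = f * 1\<^sub>m d"
      unfolding gf by (rule eq_matI) (auto simp: zero_right_dim one_right_dim simp del: index_mult_mat(1))
    finally show "f * (u * f) = f * 1\<^sub>m d" .
  qed (use inj in auto)
  moreover have "f * u + w * g = 1\<^sub>m e"
    unfolding u(2) by (rule eq_matI) auto
  ultimately show ?thesis using u(1) w by auto
qed

lemma split_imp_exact:
  fixes f g u w :: "complex mat"
  assumes c: "f \<in> carrier_mat e d" "g \<in> carrier_mat m e" "u \<in> carrier_mat d e" "w \<in> carrier_mat e m"
    and "u * f = 1\<^sub>m d" "g * w = 1\<^sub>m m" "f * u + w * g = 1\<^sub>m e"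
  shows "inj_on (\<lambda>v. f *\<^sub>v v) (carrier_vec d)"
    and "(\<lambda>v. g *\<^sub>v v) ` carrier_vec e = carrier_vec m"
    and "(\<lambda>v. f *\<^sub>v v) ` carrier_vec d = mat_kernel g"
    and "g * f = 0\<^sub>m m d" and "u * w = 0\<^sub>m d m"
proof -
  have [simp]: "dim_row f = e" "dim_col f = d" "dim_row g = m" "dim_col g = e"
     "dim_row u = d" "dim_col u = e" "dim_row w = e" "dim_col w = m"
    using c by auto
  show "inj_on (\<lambda>v. f *\<^sub>v v) (carrier_vec d)"
    using left_inverse_inj[of u f] assms by simp
  show "(\<lambda>v. g *\<^sub>v v) ` carrier_vec e = carrier_vec m"
    using right_inverse_surj[of g w] assms by simp
  have cancel: "A = 0\<^sub>m r k" if "A + A = A" "A \<in> carrier_mat r k" for A :: "complex mat" and r k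
  proof (rule eq_matI)
    fix i j assume ij: "i < dim_row (0\<^sub>m r k :: complex mat)" "j < dim_col (0\<^sub>m r k :: complex mat)"
    have "(A + A) $$ (i, j) = A $$ (i, j)" by (simp only: that(1))
    then show "A $$ (i, j) = 0\<^sub>m r k $$ (i, j)" using that(2) ij by simp
  qed (use that in auto)
  have "g * ((f * u + w * g) * f) = g * f" by (simp add: assms one_left_dim)
  then have "g * f + g * f = g * f"
    by (simp add: mat_alg mult_eq_left[OF assms(6)] assms(5))
  then show gf: "g * f = 0\<^sub>m m d" by (rule cancel) auto
  have "u * ((f * u + w * g) * w) = u * w" by (simp add: assms one_left_dim)
  then have "u * w + u * w = u * w"
    by (simp add: mat_alg mult_eq_left[OF assms(5)] assms(6))
  then show "u * w = 0\<^sub>m d m" by (rule cancel) auto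
  show "(\<lambda>v. f *\<^sub>v v) ` carrier_vec d = mat_kernel g"
  proof (intro equalityI subsetI)
    fix x assume "x \<in> (\<lambda>v. f *\<^sub>v v) ` carrier_vec d"
    then obtain v where v: "v \<in> carrier_vec d" "x = f *\<^sub>v v" by auto
    then have "g *\<^sub>v x = 0\<^sub>m m d *\<^sub>v v" by (simp add: mult_vec_dim[symmetric] gf)
    then show "x \<in> mat_kernel g" using v by (auto simp: mat_kernel_def)
  next
    fix x assume "x \<in> mat_kernel g"
    then have x: "x \<in> carrier_vec e" "g *\<^sub>v x = 0\<^sub>v m" by (auto simp: mat_kernel_def)
    have "x = (f * u + w * g) *\<^sub>v x" using x assms by simp
    also have "\<dots> = f *\<^sub>v (u *\<^sub>v x) + w *\<^sub>v (g *\<^sub>v x)"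
      using x(1) by (simp add: mat_add_vec_dim mult_vec_dim)
    also have "w *\<^sub>v (g *\<^sub>v x) = 0\<^sub>v e" using x(2) by (intro eq_vecI) (auto simp: scalar_prod_def)
    finally have "x = f *\<^sub>v (u *\<^sub>v x)" by simp
    moreover have "u *\<^sub>v x \<in> carrier_vec d" using c(3) by simp
    ultimately show "x \<in> (\<lambda>v. f *\<^sub>v v) ` carrier_vec d" by (metis imageI)
  qed
qed

text \<open>The line spanned by \<open>s\<close> has the kernel of \<open>r\<close> as a complement when \<open>r * s = 1\<close>; the
  coordinates of the complement omit an index at which \<open>r\<close> does not vanish.\<close>

lemma complement_of_line:
  fixes r s :: "complex mat"
  assumes r: "r \<in> carrier_mat 1 d" and s: "s \<in> carrier_mat d 1" and rs: "r * s = 1\<^sub>m 1"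
  shows "\<exists>j q. j \<in> carrier_mat d (d - 1) \<and> q \<in> carrier_mat (d - 1) d \<and> 0 < d \<and>
    q * j = 1\<^sub>m (d - 1) \<and> s * r + j * q = 1\<^sub>m d"
proof -
  have [simp]: "dim_row r = 1" "dim_col r = d" "dim_row s = d" "dim_col s = 1" using r s by auto
  have "(r * s) $$ (0, 0) = 1" using rs by simp
  then have sum1: "(\<Sum>i<d. r $$ (0, i) * s $$ (i, 0)) = 1"
    by (simp add: scalar_prod_def lessThan_atLeast0)
  then have "\<exists>c<d. r $$ (0, c) \<noteq> 0"
    by (metis (no_types, lifting) lessThan_iff mult_zero_left sum.neutral zero_neq_one)
  then obtain c where c: "c < d" "r $$ (0, c) \<noteq> 0" by blast
  define \<iota> where "\<iota> i = (if i < c then i else Suc i)" for i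
  have \<iota>: "\<iota> i < d" "\<iota> i \<noteq> c" if "i < d - 1" for i using that c by (auto simp: \<iota>_def)
  have \<iota>_inj: "\<iota> i = \<iota> k \<longleftrightarrow> i = k" for i k by (auto simp: \<iota>_def)
  define j where "j = mat d (d - 1) (\<lambda>(x, i). of_bool (x = \<iota> i)
    - (if x = c then r $$ (0, \<iota> i) / r $$ (0, c) else 0))"
  define q where "q = mat (d - 1) d (\<lambda>(i, x). of_bool (x = \<iota> i) - s $$ (\<iota> i, 0) * r $$ (0, x))"
  have [simp]: "dim_row j = d" "dim_col j = d - 1" "dim_row q = d - 1" "dim_col q = d"
    by (auto simp: j_def q_def)
  have pick: "(\<Sum>x<d. of_bool (x = y) * g x) = g y" "(\<Sum>x<d. g x * of_bool (x = y)) = g y"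
    if "y < d" for y and g :: "nat \<Rightarrow> complex"
    using that by (simp_all add: of_bool_def if_distrib if_distribR cong: if_cong)
  have rj: "r * j = 0\<^sub>m 1 (d - 1)"
  proof (rule eq_matI)
    fix a b assume ab: "a < dim_row (0\<^sub>m 1 (d - 1) :: complex mat)"
      "b < dim_col (0\<^sub>m 1 (d - 1) :: complex mat)"
    have "(r * j) $$ (a, b) = (\<Sum>x<d. r $$ (0, x) * (of_bool (x = \<iota> b)
      - (if x = c then r $$ (0, \<iota> b) / r $$ (0, c) else 0)))"
      using ab by (simp add: scalar_prod_def lessThan_atLeast0 j_def)
    also have "\<dots> = (\<Sum>x<d. r $$ (0, x) * of_bool (x = \<iota> b)
      - (r $$ (0, x) * r $$ (0, \<iota> b) / r $$ (0, c)) * of_bool (x = c))"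
      by (intro sum.cong) (auto simp: field_simps)
    also have "\<dots> = r $$ (0, \<iota> b) - r $$ (0, c) * r $$ (0, \<iota> b) / r $$ (0, c)"
      using ab \<iota>[of b] c by (simp only: sum_subtractf pick) (simp add: pick)
    also have "\<dots> = 0" using c by simp
    finally show "(r * j) $$ (a, b) = 0\<^sub>m 1 (d - 1) $$ (a, b)" using ab by simp
  qed auto
  have qs: "q * s = 0\<^sub>m (d - 1) 1"
  proof (rule eq_matI)
    fix a b assume ab: "a < dim_row (0\<^sub>m (d - 1) 1 :: complex mat)"
      "b < dim_col (0\<^sub>m (d - 1) 1 :: complex mat)"
    have "(q * s) $$ (a, b) = (\<Sum>x<d. (of_bool (x = \<iota> a) - s $$ (\<iota> a, 0) * r $$ (0, x)) * s $$ (x, 0))"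
      using ab by (simp add: scalar_prod_def lessThan_atLeast0 q_def)
    also have "\<dots> = (\<Sum>x<d. of_bool (x = \<iota> a) * s $$ (x, 0) - s $$ (\<iota> a, 0) * (r $$ (0, x) * s $$ (x, 0)))"
      by (intro sum.cong) (auto simp: algebra_simps)
    also have "\<dots> = s $$ (\<iota> a, 0) - s $$ (\<iota> a, 0) * 1"
      using ab \<iota>[of a] sum1
      by (simp only: sum_subtractf pick sum_distrib_left[symmetric]) (simp add: pick del: sum_of_bool_mult_eq)
    finally show "(q * s) $$ (a, b) = 0\<^sub>m (d - 1) 1 $$ (a, b)" using ab by simp
  qed auto
  have qj: "q * j = 1\<^sub>m (d - 1)"
  proof (rule eq_matI)
    fix a b assume ab: "a < dim_row (1\<^sub>m (d - 1) :: complex mat)"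
      "b < dim_col (1\<^sub>m (d - 1) :: complex mat)"
    have "(r * j) $$ (0, b) = 0" using ab by (simp add: rj)
    then have rj0: "(\<Sum>x<d. r $$ (0, x) * j $$ (x, b)) = 0"
      using ab by (simp add: scalar_prod_def lessThan_atLeast0)
    have "(q * j) $$ (a, b) = (\<Sum>x<d. (of_bool (x = \<iota> a) - s $$ (\<iota> a, 0) * r $$ (0, x)) * j $$ (x, b))"
      using ab by (simp add: scalar_prod_def lessThan_atLeast0 q_def)
    also have "\<dots> = (\<Sum>x<d. of_bool (x = \<iota> a) * j $$ (x, b) - s $$ (\<iota> a, 0) * (r $$ (0, x) * j $$ (x, b)))"
      by (intro sum.cong) (auto simp: algebra_simps)
    also have "\<dots> = j $$ (\<iota> a, b)"
      using ab \<iota>[of a] rj0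
      by (simp only: sum_subtractf pick sum_distrib_left[symmetric]) (simp add: pick del: sum_of_bool_mult_eq)
    also have "\<dots> = of_bool (a = b)" using ab \<iota>[of a] by (simp add: j_def \<iota>_inj)
    finally show "(q * j) $$ (a, b) = 1\<^sub>m (d - 1) $$ (a, b)" using ab by simp
  qed auto
  \<comment> \<open>\<open>C * B = 1\<close> says exactly the four products just computed, and then \<open>B * C = 1\<close> as well.\<close>
  define B where "B = mat d d (\<lambda>(x, y). if y = 0 then s $$ (x, 0) else j $$ (x, y - 1))"
  define C where "C = mat d d (\<lambda>(x, y). if x = 0 then r $$ (0, y) else q $$ (x - 1, y))"
  have "C * B = 1\<^sub>m d"
  proof (rule eq_matI)
    fix a b assume ab: "a < dim_row (1\<^sub>m d :: complex mat)" "b < dim_col (1\<^sub>m d :: complex mat)"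
    have "(C * B) $$ (a, b) = row C a \<bullet> col B b" using ab by (simp add: B_def C_def)
    moreover have "row C a = (if a = 0 then row r 0 else row q (a - 1))"
      using ab by (auto simp: C_def row_def)
    moreover have "col B b = (if b = 0 then col s 0 else col j (b - 1))"
      using ab by (auto simp: B_def col_def)
    moreover have "row r 0 \<bullet> col s 0 = 1" using arg_cong[OF rs, of "\<lambda>A. A $$ (0, 0)"] by simp
    moreover have "row r 0 \<bullet> col j k = 0" if "k < d - 1" for k
      using arg_cong[OF rj, of "\<lambda>A. A $$ (0, k)"] that by simp
    moreover have "row q k \<bullet> col s 0 = 0" if "k < d - 1" for k
      using arg_cong[OF qs, of "\<lambda>A. A $$ (k, 0)"] that by simp
    moreover have "row q k \<bullet> col j l = of_bool (k = l)" if "k < d - 1" "l < d - 1" for k l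
      using arg_cong[OF qj, of "\<lambda>A. A $$ (k, l)"] that by simp
    ultimately show "(C * B) $$ (a, b) = 1\<^sub>m d $$ (a, b)" using ab by auto
  qed (auto simp: B_def C_def)
  then have "B * C = 1\<^sub>m d"
    by (rule mat_mult_left_right_inverse[rotated 2]) (auto simp: B_def C_def)
  moreover have "B * C = s * r + j * q"
  proof (rule eq_matI)
    fix a b assume "a < dim_row (s * r + j * q)" "b < dim_col (s * r + j * q)"
    then have ab: "a < d" "b < d" by auto
    have "(B * C) $$ (a, b) = (\<Sum>x<d. (if x = 0 then s $$ (a, 0) else j $$ (a, x - 1)) *
       (if x = 0 then r $$ (0, b) else q $$ (x - 1, b)))"
      using ab by (simp add: scalar_prod_def lessThan_atLeast0 B_def C_def)
    also have "\<dots> = s $$ (a, 0) * r $$ (0, b) + (\<Sum>x<d - 1. j $$ (a, x) * q $$ (x, b))"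
      using c(1) by (cases d) (simp_all add: sum.lessThan_Suc_shift del: sum.lessThan_Suc)
    also have "\<dots> = (s * r + j * q) $$ (a, b)"
      using ab by (simp add: scalar_prod_def lessThan_atLeast0)
    finally show "(B * C) $$ (a, b) = (s * r + j * q) $$ (a, b)" .
  qed (auto simp: B_def C_def)
  ultimately show ?thesis using qj c(1)
    by (intro exI[of _ j] exI[of _ q]) auto
qed

section \<open>The category of representations\<close>

subsection \<open>Periodic families\<close>

lemma periodic_shift:
  assumes "\<And>i. f (i + int n) = f i"
  shows "f (i + int n * t) = f i"
proof (induction t rule: int_induct[of _ 0])
  case (step1 t)
  have "f (i + int n * (t + 1)) = f ((i + int n * t) + int n)" by (simp add: algebra_simps)
  then show ?case using assms step1 by simp
next
  case (step2 t)
  have "f (i + int n * (t - 1)) = f (i + int n * (t - 1) + int n)" using assms by simp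
  also have "\<dots> = f (i + int n * t)" by (simp add: algebra_simps)
  finally show ?case using step2 by simp
qed simp

lemma periodic_cong:
  assumes "\<And>i. f (i + int n) = f i" "i mod int n = j mod int n"
  shows "f i = f j"
proof -
  have "i = j + int n * (i div int n - j div int n)"
    using assms(2) by (metis (no_types, lifting) add.commute add_diff_cancel_left' add_diff_eq
      diff_add_cancel int_distrib(4) mod_mult_div_eq)
  then show ?thesis using periodic_shift[of f n j, OF assms(1)] by metis
qed

text \<open>Choosing a value for each residue and extending it periodically.\<close>

lemma periodic_choice:
  assumes "\<And>i. \<exists>x. Q i x" and "\<And>i. Q (i + int n) = Q i"
  shows "\<exists>f. (\<forall>i. f (i + int n) = f i) \<and> (\<forall>i. Q i (f i))"
proof -
  obtain g where g: "\<And>i. Q i (g i)" using assms(1) by metis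
  have "Q (i mod int n) = Q i" for i
    by (rule periodic_cong[of Q n, OF assms(2)]) simp
  then have "Q i (g (i mod int n))" for i using g[of "i mod int n"] by simp
  then show ?thesis by (intro exI[of _ "\<lambda>i. g (i mod int n)"]) simp
qed

lemma periodic_choice2:
  assumes "\<And>i. \<exists>x y. Q i x y" and "\<And>i. Q (i + int n) = Q i"
  shows "\<exists>f g. (\<forall>i. f (i + int n) = f i \<and> g (i + int n) = g i) \<and> (\<forall>i. Q i (f i) (g i))"
proof -
  have "\<exists>h. (\<forall>i. h (i + int n) = h i) \<and> (\<forall>i. case h i of (x, y) \<Rightarrow> Q i x y)"
    by (rule periodic_choice) (use assms in auto)
  then obtain h where h: "\<And>i. h (i + int n) = h i" "\<And>i. case h i of (x, y) \<Rightarrow> Q i x y" by blast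
  show ?thesis
    by (intro exI[of _ "fst \<circ> h"] exI[of _ "snd \<circ> h"]) (use h in \<open>auto simp: case_prod_unfold\<close>)
qed

subsection \<open>Representations and paths\<close>

lemma reps_periodic:
  assumes "M \<in> reps n"
  shows "vdim M (i + int n) = vdim M i" "arr M (i + int n) = arr M i"
  using assms unfolding reps_def by auto

lemma arr_dims:
  assumes "M \<in> reps n"
  shows "dim_row (arr M i) = vdim M (i + 1)" "dim_col (arr M i) = vdim M i"
  using assms unfolding reps_def by auto

lemma path_map_dims:
  assumes "M \<in> reps n"
  shows "dim_row (path_map M i k) = vdim M (i + int k)" "dim_col (path_map M i k) = vdim M i"
  by (induction k) (auto simp: arr_dims[OF assms] add_ac)

lemmas reps_dims = arr_dims path_map_dims

lemma path_map_periodic: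
  assumes "M \<in> reps n"
  shows "path_map M (i + int n) k = path_map M i k"
proof (induction k)
  case (Suc k)
  have "arr M (i + int n + int k) = arr M (i + int k)"
    using reps_periodic(2)[OF assms, of "i + int k"] by (simp add: algebra_simps)
  then show ?case using Suc by simp
qed (simp add: reps_periodic[OF assms])

lemma path_map_add:
  assumes "M \<in> reps n"
  shows "path_map M i (j + k) = path_map M (i + int j) k * path_map M i j"
proof (induction k)
  case 0
  then show ?case by (simp add: one_left_dim reps_dims[OF assms])
next
  case (Suc k)
  then show ?case by (simp add: mult_assoc_dim reps_dims[OF assms] add.assoc)
qed

lemma path_map_Suc_left:
  assumes "M \<in> reps n"
  shows "path_map M i (Suc k) = path_map M (i + 1) k * arr M i"
  using path_map_add[OF assms, of i "Suc 0" k] by (simp add: one_right_dim arr_dims[OF assms])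

lemma path_map_long:
  assumes "M \<in> reps n" "n - 1 \<le> k"
  shows "path_map M i k = 0\<^sub>m (vdim M (i + int k)) (vdim M i)"
proof -
  have "path_map M i k = path_map M (i + int (n - 1)) (k - (n - 1)) * path_map M i (n - 1)"
    using path_map_add[OF assms(1), of i "n - 1" "k - (n - 1)"] assms(2) by simp
  moreover have "path_map M i (n - 1) = 0\<^sub>m (vdim M (i + int (n - 1))) (vdim M i)"
    using assms(1) unfolding reps_def by blast
  ultimately show ?thesis
    using assms(2) by (simp add: zero_right_dim reps_dims[OF assms(1)] of_nat_diff algebra_simps)
qed

lemma repsI:
  assumes "\<And>i. vdim M (i + int n) = vdim M i" "\<And>i. arr M (i + int n) = arr M i"
    "\<And>i. arr M i \<in> carrier_mat (vdim M (i + 1)) (vdim M i)"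
    "\<And>i. path_map M i (n - 1) = 0\<^sub>m (vdim M (i + int (n - 1))) (vdim M i)"
  shows "M \<in> reps n"
  using assms unfolding reps_def by blast

subsection \<open>Homomorphisms\<close>

lemma homI:
  assumes "\<And>i. f (i + int n) = f i" "\<And>i. dim_row (f i) = vdim N i" "\<And>i. dim_col (f i) = vdim M i"
    "\<And>i. f (i + 1) * arr M i = arr N i * f i"
  shows "is_hom n M N f"
  using assms unfolding is_hom_def carrier_mat_def by auto

lemma hom_dims:
  assumes "is_hom n M N f"
  shows "dim_row (f i) = vdim N i" "dim_col (f i) = vdim M i"
  using assms unfolding is_hom_def by auto

lemma hom_periodic: "is_hom n M N f \<Longrightarrow> f (i + int n) = f i"
  unfolding is_hom_def by auto

lemma hom_arr: "is_hom n M N f \<Longrightarrow> f (i + 1) * arr M i = arr N i * f i"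
  unfolding is_hom_def by auto

lemma hom_path:
  assumes f: "is_hom n M N f" and M: "M \<in> reps n" and N: "N \<in> reps n"
  shows "f (i + int k) * path_map M i k = path_map N i k * f i"
proof (induction k)
  case 0
  then show ?case by (simp add: one_left_dim one_right_dim hom_dims[OF f])
next
  case (Suc k)
  note [simp] = hom_dims[OF f] reps_dims[OF M] reps_dims[OF N]
  have "f (i + int (Suc k)) * path_map M i (Suc k) = f (i + int k + 1) * arr M (i + int k) * path_map M i k"
    by (simp add: mult_assoc_dim add_ac)
  also have "\<dots> = arr N (i + int k) * (f (i + int k) * path_map M i k)"
    by (simp add: hom_arr[OF f] mult_assoc_dim)
  also have "\<dots> = path_map N i (Suc k) * f i" by (simp add: Suc mult_assoc_dim)
  finally show ?case .
qed

lemma hom_path_vec: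
  assumes f: "is_hom n M N f" and M: "M \<in> reps n" and N: "N \<in> reps n" and x: "x \<in> carrier_vec (vdim M i)"
  shows "path_map N i k *\<^sub>v (f i *\<^sub>v x) = f (i + int k) *\<^sub>v (path_map M i k *\<^sub>v x)"
proof -
  note [simp] = hom_dims[OF f] reps_dims[OF M] reps_dims[OF N]
  have "path_map N i k *\<^sub>v (f i *\<^sub>v x) = (path_map N i k * f i) *\<^sub>v x"
    using x by (subst mult_vec_dim) auto
  also have "\<dots> = f (i + int k) *\<^sub>v (path_map M i k *\<^sub>v x)"
    unfolding hom_path[OF f M N, symmetric] using x by (subst mult_vec_dim) auto
  finally show ?thesis .
qed

lemma hom_id: "M \<in> reps n \<Longrightarrow> is_hom n M M (\<lambda>i. 1\<^sub>m (vdim M i))"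
  by (rule homI) (simp_all add: reps_periodic one_left_dim one_right_dim arr_dims)

lemma hom_comp:
  assumes f: "is_hom n M N f" and g: "is_hom n N P g"
    and MNP: "M \<in> reps n" "N \<in> reps n" "P \<in> reps n"
  shows "is_hom n M P (\<lambda>i. g i * f i)"
proof (rule homI)
  fix i
  note [simp] = hom_dims[OF f] hom_dims[OF g] arr_dims[OF MNP(1)] arr_dims[OF MNP(2)] arr_dims[OF MNP(3)]
  have "g (i + 1) * f (i + 1) * arr M i = g (i + 1) * (arr N i * f i)"
    by (simp add: mult_assoc_dim hom_arr[OF f])
  also have "\<dots> = arr P i * (g i * f i)"
    by (simp add: mult_assoc_dim[symmetric] hom_arr[OF g])
  finally show "g (i + 1) * f (i + 1) * arr M i = arr P i * (g i * f i)" .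
qed (simp_all add: hom_dims[OF f] hom_dims[OF g] hom_periodic[OF f] hom_periodic[OF g])

lemma hom_add:
  assumes f: "is_hom n M N f" and g: "is_hom n M N g" and MN: "M \<in> reps n" "N \<in> reps n"
  shows "is_hom n M N (\<lambda>i. f i + g i)"
proof (rule homI)
  fix i
  note [simp] = hom_dims[OF f] hom_dims[OF g] arr_dims[OF MN(1)] arr_dims[OF MN(2)]
  show "(f (i + 1) + g (i + 1)) * arr M i = arr N i * (f i + g i)"
    by (simp add: mat_alg hom_arr[OF f] hom_arr[OF g])
qed (simp_all add: hom_dims[OF f] hom_dims[OF g] hom_periodic[OF f] hom_periodic[OF g])

lemma isomorphicI:
  assumes "is_hom n M N f" "is_hom n N M g"
    "\<And>i. g i * f i = 1\<^sub>m (vdim M i)" "\<And>i. f i * g i = 1\<^sub>m (vdim N i)"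
  shows "isomorphic n M N"
  using assms unfolding isomorphic_def is_iso_def by blast

lemma isomorphicE:
  assumes "isomorphic n M N"
  obtains f g where "is_hom n M N f" "is_hom n N M g"
    "\<forall>i. g i * f i = 1\<^sub>m (vdim M i) \<and> f i * g i = 1\<^sub>m (vdim N i)"
  using assms unfolding isomorphic_def is_iso_def by (elim exE conjE) rule

lemma is_iso_id: "M \<in> reps n \<Longrightarrow> is_iso n M M (\<lambda>i. 1\<^sub>m (vdim M i))"
  unfolding is_iso_def by (auto intro!: hom_id exI[of _ "\<lambda>i. 1\<^sub>m (vdim M i)"] simp: one_left_dim)

lemma is_iso_inverse:
  assumes "is_iso n M N f"
  obtains g where "is_iso n N M g" "\<forall>i. g i * f i = 1\<^sub>m (vdim M i) \<and> f i * g i = 1\<^sub>m (vdim N i)"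
  using assms unfolding is_iso_def by blast

lemma is_iso_comp:
  assumes "is_iso n M N f" "is_iso n N P g" and MNP: "M \<in> reps n" "N \<in> reps n" "P \<in> reps n"
  shows "is_iso n M P (\<lambda>i. g i * f i)"
proof -
  obtain f' where f: "is_hom n M N f" "is_hom n N M f'"
    and ff: "\<forall>i. f' i * f i = 1\<^sub>m (vdim M i) \<and> f i * f' i = 1\<^sub>m (vdim N i)"
    using assms(1) unfolding is_iso_def by blast
  obtain g' where g: "is_hom n N P g" "is_hom n P N g'"
    and gg: "\<forall>i. g' i * g i = 1\<^sub>m (vdim N i) \<and> g i * g' i = 1\<^sub>m (vdim P i)"
    using assms(2) unfolding is_iso_def by blast
  note [simp] = hom_dims[OF f(1)] hom_dims[OF f(2)] hom_dims[OF g(1)] hom_dims[OF g(2)]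
  have "f' i * g' i * (g i * f i) = 1\<^sub>m (vdim M i) \<and> g i * f i * (f' i * g' i) = 1\<^sub>m (vdim P i)" for i
    using ff gg
    by (simp add: mult_assoc_dim mult_eq_left[of "g' i" "g i"] mult_eq_left[of "f i" "f' i"] one_left_dim)
  then show ?thesis
    unfolding is_iso_def using hom_comp[OF f(1) g(1) MNP] hom_comp[OF g(2) f(2) MNP(3,2,1)] by blast
qed

lemma isomorphic_refl: "M \<in> reps n \<Longrightarrow> isomorphic n M M"
  unfolding isomorphic_def using is_iso_id by blast

lemma isomorphic_sym: "isomorphic n M N \<Longrightarrow> isomorphic n N M"
  unfolding isomorphic_def by (metis is_iso_inverse)

lemma isomorphic_trans:
  "isomorphic n M N \<Longrightarrow> isomorphic n N P \<Longrightarrow> M \<in> reps n \<Longrightarrow> N \<in> reps n \<Longrightarrow> P \<in> reps n \<Longrightarrow>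
    isomorphic n M P"
  unfolding isomorphic_def using is_iso_comp by blast

lemma is_quotientI:
  assumes f: "is_hom n M N f" and "\<And>i. f i * s i = 1\<^sub>m (vdim N i)" and "\<And>i. dim_row (s i) = vdim M i"
  shows "is_quotient n M N"
proof -
  have "(\<lambda>v. f i *\<^sub>v v) ` carrier_vec (vdim M i) = carrier_vec (vdim N i)" for i
    using right_inverse_surj[of "f i" "s i"] assms(2,3)[of i] by (simp add: hom_dims[OF f])
  then show ?thesis using f unfolding is_quotient_def is_epi_def by blast
qed

lemma short_exactI:
  assumes f: "is_hom n N E f" and g: "is_hom n E M g"
    and "\<And>i. u i \<in> carrier_mat (vdim N i) (vdim E i)" "\<And>i. w i \<in> carrier_mat (vdim E i) (vdim M i)"
    and "\<And>i. u i * f i = 1\<^sub>m (vdim N i)" "\<And>i. g i * w i = 1\<^sub>m (vdim M i)"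
      "\<And>i. f i * u i + w i * g i = 1\<^sub>m (vdim E i)"
  shows "short_exact n N f E g M"
proof -
  have fc: "f i \<in> carrier_mat (vdim E i) (vdim N i)" "g i \<in> carrier_mat (vdim M i) (vdim E i)" for i
    using hom_dims[OF f, of i] hom_dims[OF g, of i] by auto
  show ?thesis
    unfolding short_exact_def is_mono_def is_epi_def
    using f g split_imp_exact[OF fc assms(3,4) assms(5-7)] by blast
qed

lemma short_exact_splitting:
  assumes "short_exact n N f E g M" "N \<in> reps n" "E \<in> reps n" "M \<in> reps n"
  obtains u w where "\<forall>i. u (i + int n) = u i \<and> w (i + int n) = w i"
    and "\<forall>i. u i \<in> carrier_mat (vdim N i) (vdim E i) \<and> w i \<in> carrier_mat (vdim E i) (vdim M i) \<and>
      u i * f i = 1\<^sub>m (vdim N i) \<and> g i * w i = 1\<^sub>m (vdim M i) \<and> f i * u i + w i * g i = 1\<^sub>m (vdim E i)"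
proof -
  have fg: "is_hom n N E f" "is_hom n E M g"
    using assms(1) unfolding short_exact_def is_mono_def is_epi_def by auto
  let ?Q = "\<lambda>i u w. u \<in> carrier_mat (vdim N i) (vdim E i) \<and> w \<in> carrier_mat (vdim E i) (vdim M i) \<and>
    u * f i = 1\<^sub>m (vdim N i) \<and> g i * w = 1\<^sub>m (vdim M i) \<and> f i * u + w * g i = 1\<^sub>m (vdim E i)"
  have "\<exists>u w. (\<forall>i. u (i + int n) = u i \<and> w (i + int n) = w i) \<and> (\<forall>i. ?Q i (u i) (w i))"
  proof (rule periodic_choice2)
    fix i
    show "\<exists>u w. ?Q i u w"
    proof (rule vector_space_splitting)
      show "f i \<in> carrier_mat (vdim E i) (vdim N i)" "g i \<in> carrier_mat (vdim M i) (vdim E i)"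
        using hom_dims[OF fg(1), of i] hom_dims[OF fg(2), of i] by auto
    qed (use assms(1) in \<open>auto simp: short_exact_def is_mono_def is_epi_def\<close>)
    show "?Q (i + int n) = ?Q i"
      by (intro ext) (simp add: reps_periodic[OF assms(2)] reps_periodic[OF assms(3)]
          reps_periodic[OF assms(4)] hom_periodic[OF fg(1)] hom_periodic[OF fg(2)])
  qed
  then show ?thesis using that by blast
qed

section \<open>Direct sums and twisted sums\<close>

definition block_inj1 :: "nat \<Rightarrow> nat \<Rightarrow> complex mat" where
  "block_inj1 m k = mat (m + k) m (\<lambda>(r, c). of_bool (r = c))"

definition block_inj2 :: "nat \<Rightarrow> nat \<Rightarrow> complex mat" where
  "block_inj2 m k = mat (m + k) k (\<lambda>(r, c). of_bool (r = m + c))"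

definition block_proj1 :: "nat \<Rightarrow> nat \<Rightarrow> complex mat" where
  "block_proj1 m k = mat m (m + k) (\<lambda>(r, c). of_bool (c = r))"

definition block_proj2 :: "nat \<Rightarrow> nat \<Rightarrow> complex mat" where
  "block_proj2 m k = mat k (m + k) (\<lambda>(r, c). of_bool (c = m + r))"

lemma block_dims [simp]:
  "dim_row (block_inj1 m k) = m + k" "dim_col (block_inj1 m k) = m"
  "dim_row (block_inj2 m k) = m + k" "dim_col (block_inj2 m k) = k"
  "dim_row (block_proj1 m k) = m" "dim_col (block_proj1 m k) = m + k"
  "dim_row (block_proj2 m k) = k" "dim_col (block_proj2 m k) = m + k"
  by (simp_all add: block_inj1_def block_inj2_def block_proj1_def block_proj2_def)

text \<open>Multiplication by a 0-1 matrix with one nonzero entry in each column selects columns, and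
  likewise for rows.\<close>

lemma mult_select_right:
  assumes "b < c" "h b < dim_col A" "a < dim_row A"
  shows "(A * mat (dim_col A) c (\<lambda>(r, b). of_bool (r = h b))) $$ (a, b) = (A :: complex mat) $$ (a, h b)"
  using assms by (simp add: scalar_prod_def of_bool_def if_distrib if_distribR cong: if_cong)

lemma mult_select_left:
  assumes "a < c" "h a < dim_row A" "b < dim_col A"
  shows "(mat c (dim_row A) (\<lambda>(a, r). of_bool (r = h a)) * A) $$ (a, b) = (A :: complex mat) $$ (h a, b)"
  using assms by (simp add: scalar_prod_def of_bool_def if_distrib if_distribR cong: if_cong)

lemma block_inj1_entry:
  "dim_col A = m + k \<Longrightarrow> a < dim_row A \<Longrightarrow> b < m \<Longrightarrow> (A * block_inj1 m k) $$ (a, b) = A $$ (a, b)"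
  using mult_select_right[of b m "\<lambda>b. b" A a] by (simp add: block_inj1_def)

lemma block_inj2_entry:
  "dim_col A = m + k \<Longrightarrow> a < dim_row A \<Longrightarrow> b < k \<Longrightarrow> (A * block_inj2 m k) $$ (a, b) = A $$ (a, m + b)"
  using mult_select_right[of b k "\<lambda>b. m + b" A a] by (simp add: block_inj2_def)

lemma block_proj1_entry:
  "dim_row A = m + k \<Longrightarrow> a < m \<Longrightarrow> b < dim_col A \<Longrightarrow> (block_proj1 m k * A) $$ (a, b) = A $$ (a, b)"
  using mult_select_left[of a m "\<lambda>b. b" A b] by (simp add: block_proj1_def)

lemma block_proj2_entry:
  "dim_row A = m + k \<Longrightarrow> a < k \<Longrightarrow> b < dim_col A \<Longrightarrow> (block_proj2 m k * A) $$ (a, b) = A $$ (m + a, b)"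
  using mult_select_left[of a k "\<lambda>b. m + b" A b] by (simp add: block_proj2_def)

lemma mult_block_proj2_entry:
  assumes "dim_col A = k" "a < dim_row A" "b < m + k"
  shows "(A * block_proj2 m k) $$ (a, b) = (if b < m then 0 else A $$ (a, b - m))"
proof -
  have "(A * block_proj2 m k) $$ (a, b) = (\<Sum>x<k. A $$ (a, x) * of_bool (b = m + x))"
    using assms by (simp add: scalar_prod_def block_proj2_def lessThan_atLeast0)
  also have "\<dots> = (\<Sum>x<k. if x = b - m then (if b < m then 0 else A $$ (a, x)) else 0)"
    by (intro sum.cong) auto
  also have "\<dots> = (if b < m then 0 else A $$ (a, b - m))"
    using assms(3) by auto
  finally show ?thesis .
qed

lemma block_products:
  "block_proj1 m k * block_inj1 m k = 1\<^sub>m m"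
  "block_proj2 m k * block_inj2 m k = 1\<^sub>m k"
  "block_proj1 m k * block_inj2 m k = 0\<^sub>m m k"
  "block_proj2 m k * block_inj1 m k = 0\<^sub>m k m"
  by (rule eq_matI;
      simp add: block_inj1_entry block_inj2_entry del: index_mult_mat(1);
      simp add: block_proj1_def block_proj2_def)+

lemmas block_mult = block_products[THEN mult_eq_left]

text \<open>Maps into a direct sum are compared after both projections.\<close>

lemma block_cancel:
  fixes A B :: "complex mat"
  assumes "block_proj1 m k * A = block_proj1 m k * B" "block_proj2 m k * A = block_proj2 m k * B"
    "dim_row A = m + k" "dim_row B = m + k" "dim_col A = dim_col B"
  shows "A = B"
proof (rule eq_matI)
  fix a b assume ab: "a < dim_row B" "b < dim_col B"
  show "A $$ (a, b) = B $$ (a, b)"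
  proof (cases "a < m")
    case True
    then show ?thesis
      using arg_cong[OF assms(1), of "\<lambda>C. C $$ (a, b)"] ab assms(3-5)
      by (simp add: block_proj1_entry del: index_mult_mat(1))
  next
    case False
    then have "a - m < k" "m + (a - m) = a" using ab assms(4) by auto
    then show ?thesis
      using arg_cong[OF assms(2), of "\<lambda>C. C $$ (a - m, b)"] ab assms(3-5)
      by (simp add: block_proj2_entry del: index_mult_mat(1))
  qed
qed (use assms in auto)

lemma block_sum: "block_inj1 m k * block_proj1 m k + block_inj2 m k * block_proj2 m k = 1\<^sub>m (m + k)"
  by (rule block_cancel[of m k])
    (simp_all add: mat_alg block_mult)

abbreviation inc1 :: "rep \<Rightarrow> rep \<Rightarrow> int \<Rightarrow> complex mat" where
  "inc1 X M i \<equiv> block_inj1 (vdim X i) (vdim M i)"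

abbreviation inc2 :: "rep \<Rightarrow> rep \<Rightarrow> int \<Rightarrow> complex mat" where
  "inc2 X M i \<equiv> block_inj2 (vdim X i) (vdim M i)"

abbreviation prj1 :: "rep \<Rightarrow> rep \<Rightarrow> int \<Rightarrow> complex mat" where
  "prj1 X M i \<equiv> block_proj1 (vdim X i) (vdim M i)"

abbreviation prj2 :: "rep \<Rightarrow> rep \<Rightarrow> int \<Rightarrow> complex mat" where
  "prj2 X M i \<equiv> block_proj2 (vdim X i) (vdim M i)"

text \<open>Every extension of \<open>M\<close> by \<open>X\<close> is, in suitable coordinates, a twisted sum: the arrows are
  block triangular, with an off-diagonal block \<open>Y i\<close> from \<open>M\<close> at \<open>i\<close> to \<open>X\<close> at \<open>i + 1\<close>.\<close>

definition twisted_sum :: "rep \<Rightarrow> rep \<Rightarrow> (int \<Rightarrow> complex mat) \<Rightarrow> rep" where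
  "twisted_sum X M Y =
     \<lparr>vdim = (\<lambda>i. vdim X i + vdim M i),
      arr = (\<lambda>i. four_block_mat (arr X i) (Y i) (0\<^sub>m (vdim M (i + 1)) (vdim X i)) (arr M i))\<rparr>"

lemma vdim_twisted_sum [simp]: "vdim (twisted_sum X M Y) i = vdim X i + vdim M i"
  by (simp add: twisted_sum_def)

lemma vdim_direct_sum [simp]: "vdim (direct_sum X M) i = vdim X i + vdim M i"
  by (simp add: direct_sum_def)

lemma direct_sum_twisted: "direct_sum X M = twisted_sum X M (\<lambda>i. 0\<^sub>m (vdim X (i + 1)) (vdim M i))"
  unfolding direct_sum_def twisted_sum_def by simp

text \<open>The off-diagonal block of the path map of a twisted sum, by \<open>path_map_twisted\<close> below.\<close>

fun path_twist :: "rep \<Rightarrow> rep \<Rightarrow> (int \<Rightarrow> complex mat) \<Rightarrow> int \<Rightarrow> nat \<Rightarrow> complex mat" where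
  "path_twist X M Y i 0 = 0\<^sub>m (vdim X i) (vdim M i)"
| "path_twist X M Y i (Suc k) = arr X (i + int k) * path_twist X M Y i k + Y (i + int k) * path_map M i k"

text \<open>The last condition on a twist says that the paths of length \<open>n - 1\<close> vanish in its twisted sum.\<close>

definition twist :: "nat \<Rightarrow> rep \<Rightarrow> rep \<Rightarrow> (int \<Rightarrow> complex mat) \<Rightarrow> bool" where
  "twist n X M Y \<longleftrightarrow> (\<forall>i. Y (i + int n) = Y i \<and> Y i \<in> carrier_mat (vdim X (i + 1)) (vdim M i) \<and>
     path_twist X M Y i (n - 1) = 0\<^sub>m (vdim X (i + int (n - 1))) (vdim M i))"

lemma twistD:
  assumes "twist n X M Y"
  shows "Y (i + int n) = Y i" "dim_row (Y i) = vdim X (i + 1)" "dim_col (Y i) = vdim M i"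
    "path_twist X M Y i (n - 1) = 0\<^sub>m (vdim X (i + int (n - 1))) (vdim M i)"
  using assms unfolding twist_def by auto

context
  fixes n :: nat and X M :: rep
  assumes X: "X \<in> reps n" and M: "M \<in> reps n"
begin

lemma path_twist_dims:
  assumes "\<And>i. Y i \<in> carrier_mat (vdim X (i + 1)) (vdim M i)"
  shows "path_twist X M Y i k \<in> carrier_mat (vdim X (i + int k)) (vdim M i)"
proof -
  have [simp]: "dim_row (Y i) = vdim X (i + 1)" "dim_col (Y i) = vdim M i" for i
    using assms[of i] by auto
  show ?thesis
    by (induction k) (auto simp: reps_dims[OF X] reps_dims[OF M] add_ac)
qed

lemma path_map_twisted:
  assumes Y: "\<And>i. Y i \<in> carrier_mat (vdim X (i + 1)) (vdim M i)"
  shows "path_map (twisted_sum X M Y) i k = four_block_mat (path_map X i k) (path_twist X M Y i k)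
    (0\<^sub>m (vdim M (i + int k)) (vdim X i)) (path_map M i k)"
proof (induction k)
  case 0
  then show ?case by (simp add: twisted_sum_def)
next
  case (Suc k)
  have c: "arr X (i + int k) \<in> carrier_mat (vdim X (i + int k + 1)) (vdim X (i + int k))"
    "arr M (i + int k) \<in> carrier_mat (vdim M (i + int k + 1)) (vdim M (i + int k))"
    "path_map X i k \<in> carrier_mat (vdim X (i + int k)) (vdim X i)"
    "path_map M i k \<in> carrier_mat (vdim M (i + int k)) (vdim M i)"
    by (auto simp: reps_dims[OF X] reps_dims[OF M])
  note [simp] = reps_dims[OF X] reps_dims[OF M] carrier_matD[OF Y]
    carrier_matD[OF path_twist_dims[of Y, OF Y]]
  have "path_map (twisted_sum X M Y) i (Suc k) =
     four_block_mat (arr X (i + int k)) (Y (i + int k)) (0\<^sub>m (vdim M (i + int k + 1)) (vdim X (i + int k))) (arr M (i + int k)) *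
     four_block_mat (path_map X i k) (path_twist X M Y i k) (0\<^sub>m (vdim M (i + int k)) (vdim X i)) (path_map M i k)"
    using Suc by (simp add: twisted_sum_def)
  also have "\<dots> = four_block_mat (path_map X i (Suc k)) (path_twist X M Y i (Suc k))
    (0\<^sub>m (vdim M (i + int (Suc k))) (vdim X i)) (path_map M i (Suc k))"
    by (subst mult_four_block_mat[OF c(1) Y _ c(2) c(3) path_twist_dims[of Y, OF Y] _ c(4)])
      (simp_all add: mat_alg zero_left_dim zero_right_dim add_ac)
  finally show ?case .
qed

lemma twisted_sum_in_reps: "twist n X M Y \<Longrightarrow> twisted_sum X M Y \<in> reps n"
proof (rule repsI)
  fix i assume Y: "twist n X M Y"
  then have Yc: "Y i \<in> carrier_mat (vdim X (i + 1)) (vdim M i)" for i unfolding twist_def by auto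
  show "vdim (twisted_sum X M Y) (i + int n) = vdim (twisted_sum X M Y) i"
    by (simp add: twisted_sum_def reps_periodic[OF X] reps_periodic[OF M])
  have "vdim M (i + int n + 1) = vdim M (i + 1)"
    using reps_periodic(1)[OF M, of "i + 1"] by (simp add: algebra_simps)
  then show "arr (twisted_sum X M Y) (i + int n) = arr (twisted_sum X M Y) i"
    by (simp add: twisted_sum_def reps_periodic[OF X] reps_periodic[OF M] twistD(1)[OF Y])
  show "arr (twisted_sum X M Y) i \<in> carrier_mat (vdim (twisted_sum X M Y) (i + 1)) (vdim (twisted_sum X M Y) i)"
    by (auto simp: twisted_sum_def reps_dims[OF X] reps_dims[OF M])
  show "path_map (twisted_sum X M Y) i (n - 1) = 0\<^sub>m (vdim (twisted_sum X M Y) (i + int (n - 1))) (vdim (twisted_sum X M Y) i)"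
    unfolding path_map_twisted[of Y, OF Yc] twistD(4)[OF Y]
    by (simp add: path_map_long[OF X] path_map_long[OF M] twisted_sum_def)
qed

lemma zero_twist: "twist n X M (\<lambda>i. 0\<^sub>m (vdim X (i + 1)) (vdim M i))"
proof -
  have "path_twist X M (\<lambda>i. 0\<^sub>m (vdim X (i + 1)) (vdim M i)) i k = 0\<^sub>m (vdim X (i + int k)) (vdim M i)" for i k
    by (induction k) (simp_all add: mat_alg reps_dims[OF X] reps_dims[OF M] add_ac)
  moreover have "vdim X (i + int n + 1) = vdim X (i + 1)" for i
    using reps_periodic(1)[OF X, of "i + 1"] by (simp add: algebra_simps)
  ultimately show ?thesis
    unfolding twist_def by (simp add: reps_periodic[OF M])
qed

lemma direct_sum_in_reps: "direct_sum X M \<in> reps n"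
  unfolding direct_sum_twisted by (rule twisted_sum_in_reps[OF zero_twist])

lemma twisted_sum_arr:
  assumes "\<And>i. Y i \<in> carrier_mat (vdim X (i + 1)) (vdim M i)"
  shows "arr (twisted_sum X M Y) i * inc1 X M i =
      inc1 X M (i + 1) * arr X i"
    and "prj2 X M (i + 1) * arr (twisted_sum X M Y) i =
      arr M i * prj2 X M i"
    and "prj1 X M (i + 1) * arr (twisted_sum X M Y) i * inc2 X M i = Y i"
proof -
  note [simp] = reps_dims[OF X] reps_dims[OF M] carrier_matD[OF assms]
  have [simp]: "dim_row (arr (twisted_sum X M Y) i) = vdim X (i + 1) + vdim M (i + 1)"
    "dim_col (arr (twisted_sum X M Y) i) = vdim X i + vdim M i" by (auto simp: twisted_sum_def)
  show "arr (twisted_sum X M Y) i * inc1 X M i =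
      inc1 X M (i + 1) * arr X i"
  proof (rule block_cancel)
    show "prj1 X M (i + 1) * (arr (twisted_sum X M Y) i * inc1 X M i) =
      prj1 X M (i + 1) * (inc1 X M (i + 1) * arr X i)"
      by (subst block_mult(1), simp, simp, rule eq_matI)
        (simp_all add: block_proj1_entry block_inj1_entry one_left_dim twisted_sum_def del: index_mult_mat(1))
    show "prj2 X M (i + 1) * (arr (twisted_sum X M Y) i * inc1 X M i) =
      prj2 X M (i + 1) * (inc1 X M (i + 1) * arr X i)"
      by (subst block_mult(4), simp, simp, rule eq_matI)
        (simp_all add: block_proj2_entry block_inj1_entry zero_left_dim twisted_sum_def del: index_mult_mat(1))
  qed simp_all
  show "prj2 X M (i + 1) * arr (twisted_sum X M Y) i =
      arr M i * prj2 X M i"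
    by (rule eq_matI) (auto simp: block_proj2_entry mult_block_proj2_entry twisted_sum_def simp del: index_mult_mat(1))
  show "prj1 X M (i + 1) * arr (twisted_sum X M Y) i * inc2 X M i = Y i"
    by (rule eq_matI) (simp_all add: block_proj1_entry block_inj2_entry twisted_sum_def del: index_mult_mat(1))
qed

end

lemma sum_inj_eq: "sum_inj X M i = inc1 X M i"
  by (simp add: sum_inj_def block_inj1_def)

lemma sum_proj_eq: "sum_proj X M i = prj2 X M i"
  by (simp add: sum_proj_def block_proj2_def)

context
  fixes n :: nat and X M :: rep
  assumes X: "X \<in> reps n" and M: "M \<in> reps n"
begin

lemma twisted_short_exact:
  assumes "twist n X M Y"
  shows "short_exact n X (sum_inj X M) (twisted_sum X M Y) (sum_proj X M) M"
proof -
  have Y: "Y i \<in> carrier_mat (vdim X (i + 1)) (vdim M i)" for i using assms unfolding twist_def by auto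
  show ?thesis
  proof (rule short_exactI)
    show "is_hom n X (twisted_sum X M Y) (sum_inj X M)"
      by (rule homI) (simp_all add: sum_inj_eq reps_periodic[OF X] reps_periodic[OF M]
          twisted_sum_arr(1)[OF X M Y])
    show "is_hom n (twisted_sum X M Y) M (sum_proj X M)"
      by (rule homI) (simp_all add: sum_proj_eq reps_periodic[OF X] reps_periodic[OF M]
          twisted_sum_arr(2)[OF X M Y])
    show "prj1 X M i \<in> carrier_mat (vdim X i) (vdim (twisted_sum X M Y) i)"
      "inc2 X M i \<in> carrier_mat (vdim (twisted_sum X M Y) i) (vdim M i)" for i
      by auto
  qed (simp_all add: sum_inj_eq sum_proj_eq block_products block_sum)
qed

lemma twisted_sum_arr_inj2:
  assumes Y: "\<And>i. Y i \<in> carrier_mat (vdim X (i + 1)) (vdim M i)"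
  shows "arr (twisted_sum X M Y) i * inc2 X M i =
    inc1 X M (i + 1) * Y i + inc2 X M (i + 1) * arr M i"
proof -
  note [simp] = reps_dims[OF X] reps_dims[OF M] carrier_matD[OF Y]
  have d [simp]: "dim_row (arr (twisted_sum X M Y) i) = vdim X (i + 1) + vdim M (i + 1)"
    "dim_col (arr (twisted_sum X M Y) i) = vdim X i + vdim M i" by (auto simp: twisted_sum_def)
  show ?thesis
  proof (rule block_cancel)
    show "prj1 X M (i + 1) * (arr (twisted_sum X M Y) i * inc2 X M i) =
      prj1 X M (i + 1) *
        (inc1 X M (i + 1) * Y i + inc2 X M (i + 1) * arr M i)"
      using twisted_sum_arr(3)[OF X M Y, of i]
      by (simp add: mat_alg block_mult(1) block_mult(3))
    show "prj2 X M (i + 1) * (arr (twisted_sum X M Y) i * inc2 X M i) =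
      prj2 X M (i + 1) *
        (inc1 X M (i + 1) * Y i + inc2 X M (i + 1) * arr M i)"
      by (simp add: mat_alg mult_eq_left[OF twisted_sum_arr(2)[OF X M Y]] block_mult(4)
          block_mult(2) block_products)
  qed simp_all
qed

lemma twisted_sum_proj1_arr:
  assumes Y: "\<And>i. Y i \<in> carrier_mat (vdim X (i + 1)) (vdim M i)"
  shows "prj1 X M (i + 1) * arr (twisted_sum X M Y) i =
    arr X i * prj1 X M i + Y i * prj2 X M i"
proof -
  note [simp] = reps_dims[OF X] reps_dims[OF M] carrier_matD[OF Y]
  have d [simp]: "dim_row (arr (twisted_sum X M Y) i) = vdim X (i + 1) + vdim M (i + 1)"
    "dim_col (arr (twisted_sum X M Y) i) = vdim X i + vdim M i" by (auto simp: twisted_sum_def)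
  have "prj1 X M (i + 1) * arr (twisted_sum X M Y) i =
    prj1 X M (i + 1) * arr (twisted_sum X M Y) i *
     (inc1 X M i * prj1 X M i +
      inc2 X M i * prj2 X M i)"
    by (simp add: block_sum one_right_dim)
  also have "\<dots> = prj1 X M (i + 1) *
      (arr (twisted_sum X M Y) i * inc1 X M i) * prj1 X M i +
    prj1 X M (i + 1) * arr (twisted_sum X M Y) i *
      inc2 X M i * prj2 X M i"
    by (simp add: mult_assoc_dim distrib_left_dim)
  also have "\<dots> = arr X i * prj1 X M i + Y i * prj2 X M i"
    unfolding twisted_sum_arr(1,3)[OF X M Y]
    by (simp add: mat_alg block_mult(1))
  finally show ?thesis .
qed

lemma direct_sum_homs:
  shows "is_hom n X (direct_sum X M) (inc1 X M)"
    and "is_hom n M (direct_sum X M) (inc2 X M)"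
    and "is_hom n (direct_sum X M) X (prj1 X M)"
    and "is_hom n (direct_sum X M) M (prj2 X M)"
proof -
  let ?Y = "\<lambda>i. 0\<^sub>m (vdim X (i + 1)) (vdim M i)"
  have Y: "?Y i \<in> carrier_mat (vdim X (i + 1)) (vdim M i)" for i by simp
  note [simp] = reps_periodic[OF X] reps_periodic[OF M] reps_dims[OF X] reps_dims[OF M]
  show "is_hom n X (direct_sum X M) (inc1 X M)"
    unfolding direct_sum_twisted by (rule homI) (simp_all add: twisted_sum_arr(1)[OF X M Y])
  show "is_hom n (direct_sum X M) M (prj2 X M)"
    unfolding direct_sum_twisted by (rule homI) (simp_all add: twisted_sum_arr(2)[OF X M Y])
  show "is_hom n M (direct_sum X M) (inc2 X M)"
    unfolding direct_sum_twisted
    by (rule homI) (simp_all add: twisted_sum_arr_inj2[OF Y] mat_alg)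
  show "is_hom n (direct_sum X M) X (prj1 X M)"
    unfolding direct_sum_twisted
    by (rule homI) (simp_all add: twisted_sum_proj1_arr[OF Y] mat_alg)
qed

end

text \<open>Direct sum decompositions are used through the four maps of a biproduct diagram, which can be
  composed with other homomorphisms.\<close>

definition biproduct :: "nat \<Rightarrow> rep \<Rightarrow> rep \<Rightarrow> rep \<Rightarrow>
    (int \<Rightarrow> complex mat) \<Rightarrow> (int \<Rightarrow> complex mat) \<Rightarrow> (int \<Rightarrow> complex mat) \<Rightarrow> (int \<Rightarrow> complex mat) \<Rightarrow> bool" where
  "biproduct n E X M s1 s2 r1 r2 \<longleftrightarrow>
    is_hom n X E s1 \<and> is_hom n M E s2 \<and> is_hom n E X r1 \<and> is_hom n E M r2 \<and>
    (\<forall>i. r1 i * s1 i = 1\<^sub>m (vdim X i) \<and> r2 i * s2 i = 1\<^sub>m (vdim M i) \<and>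
         s1 i * r1 i + s2 i * r2 i = 1\<^sub>m (vdim E i))"

lemma biproductD:
  assumes "biproduct n E X M s1 s2 r1 r2"
  shows "is_hom n X E s1" "is_hom n M E s2" "is_hom n E X r1" "is_hom n E M r2"
    "r1 i * s1 i = 1\<^sub>m (vdim X i)" "r2 i * s2 i = 1\<^sub>m (vdim M i)"
    "s1 i * r1 i + s2 i * r2 i = 1\<^sub>m (vdim E i)"
    "r2 i * s1 i = 0\<^sub>m (vdim M i) (vdim X i)" "r1 i * s2 i = 0\<^sub>m (vdim X i) (vdim M i)"
proof -
  show h: "is_hom n X E s1" "is_hom n M E s2" "is_hom n E X r1" "is_hom n E M r2"
    and e: "r1 i * s1 i = 1\<^sub>m (vdim X i)" "r2 i * s2 i = 1\<^sub>m (vdim M i)"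
      "s1 i * r1 i + s2 i * r2 i = 1\<^sub>m (vdim E i)"
    using assms unfolding biproduct_def by auto
  have c: "s1 i \<in> carrier_mat (vdim E i) (vdim X i)" "r2 i \<in> carrier_mat (vdim M i) (vdim E i)"
    "r1 i \<in> carrier_mat (vdim X i) (vdim E i)" "s2 i \<in> carrier_mat (vdim E i) (vdim M i)"
    using h unfolding is_hom_def by auto
  show "r2 i * s1 i = 0\<^sub>m (vdim M i) (vdim X i)" "r1 i * s2 i = 0\<^sub>m (vdim X i) (vdim M i)"
    using split_imp_exact(4,5)[OF c e] by auto
qed

lemma biproduct_dims:
  assumes "biproduct n E X M s1 s2 r1 r2"
  shows "dim_row (s1 i) = vdim E i" "dim_col (s1 i) = vdim X i" "dim_row (s2 i) = vdim E i" "dim_col (s2 i) = vdim M i"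
    "dim_row (r1 i) = vdim X i" "dim_col (r1 i) = vdim E i" "dim_row (r2 i) = vdim M i" "dim_col (r2 i) = vdim E i"
  using assms unfolding biproduct_def is_hom_def by auto

lemma biproduct_iso:
  assumes b: "biproduct n E X M s1 s2 r1 r2" and E: "E \<in> reps n" and X: "X \<in> reps n" and M: "M \<in> reps n"
  shows "is_iso n (direct_sum X M) E (\<lambda>i. s1 i * prj1 X M i + s2 i * prj2 X M i)"
    (is "is_iso n ?S E ?f")
proof -
  note S = direct_sum_in_reps[OF X M] and H = direct_sum_homs[OF X M] and bp = biproductD[OF b]
  note [simp] = biproduct_dims[OF b]
  let ?g = "\<lambda>i. inc1 X M i * r1 i + inc2 X M i * r2 i"
  have "is_hom n ?S E ?f"
    by (rule hom_add[OF hom_comp[OF H(3) bp(1) S X E] hom_comp[OF H(4) bp(2) S M E] S E])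
  moreover have "is_hom n E ?S ?g"
    by (rule hom_add[OF hom_comp[OF bp(3) H(1) E X S] hom_comp[OF bp(4) H(2) E M S] E S])
  moreover have "?f i * ?g i = 1\<^sub>m (vdim E i)" for i
    using bp(7)[of i] by (simp add: mat_alg block_mult)
  moreover have "?g i * ?f i = 1\<^sub>m (vdim ?S i)" for i
    using block_sum[of "vdim X i" "vdim M i"]
    by (simp add: mat_alg bp(5,6,8,9)[THEN mult_eq_left])
  ultimately show ?thesis unfolding is_iso_def by blast
qed

lemma isomorphic_direct_sum_iff:
  assumes E: "E \<in> reps n" and X: "X \<in> reps n" and M: "M \<in> reps n"
  shows "isomorphic n E (direct_sum X M) \<longleftrightarrow> (\<exists>s1 s2 r1 r2. biproduct n E X M s1 s2 r1 r2)"
proof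
  assume "isomorphic n E (direct_sum X M)"
  then obtain f g where f: "is_hom n E (direct_sum X M) f" "is_hom n (direct_sum X M) E g"
    and fg: "\<forall>i. g i * f i = 1\<^sub>m (vdim E i) \<and> f i * g i = 1\<^sub>m (vdim (direct_sum X M) i)"
    by (rule isomorphicE)
  have fg: "g i * f i = 1\<^sub>m (vdim E i)" "f i * g i = 1\<^sub>m (vdim (direct_sum X M) i)" for i using fg by auto
  note S = direct_sum_in_reps[OF X M] and H = direct_sum_homs[OF X M]
  note [simp] = hom_dims[OF f(1)] hom_dims[OF f(2)]
  have "biproduct n E X M (\<lambda>i. g i * inc1 X M i) (\<lambda>i. g i * inc2 X M i) (\<lambda>i. prj1 X M i * f i) (\<lambda>i. prj2 X M i * f i)"
    unfolding biproduct_def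
  proof (intro conjI allI)
    fix i
    show "prj1 X M i * f i * (g i * inc1 X M i) = 1\<^sub>m (vdim X i)" "prj2 X M i * f i * (g i * inc2 X M i) = 1\<^sub>m (vdim M i)"
      by (simp_all add: mult_assoc_dim mult_eq_left[OF fg(2)] one_left_dim block_products)
    have "g i * inc1 X M i * (prj1 X M i * f i) + g i * inc2 X M i * (prj2 X M i * f i) =
      g i * ((inc1 X M i * prj1 X M i + inc2 X M i * prj2 X M i) * f i)"
      by (simp add: mult_assoc_dim distrib_left_dim distrib_right_dim)
    also have "\<dots> = 1\<^sub>m (vdim E i)" by (simp add: block_sum one_left_dim fg(1))
    finally show "g i * inc1 X M i * (prj1 X M i * f i) + g i * inc2 X M i * (prj2 X M i * f i) = 1\<^sub>m (vdim E i)" .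
  qed (use hom_comp[OF H(1) f(2) X S E] hom_comp[OF H(2) f(2) M S E]
        hom_comp[OF f(1) H(3) E S X] hom_comp[OF f(1) H(4) E S M] in auto)
  then show "\<exists>s1 s2 r1 r2. biproduct n E X M s1 s2 r1 r2" by blast
next
  assume "\<exists>s1 s2 r1 r2. biproduct n E X M s1 s2 r1 r2"
  then show "isomorphic n E (direct_sum X M)"
    using biproduct_iso[OF _ E X M] isomorphic_sym unfolding isomorphic_def by blast
qed

lemma biproduct_direct_sum:
  assumes "X \<in> reps n" "M \<in> reps n"
  shows "biproduct n (direct_sum X M) X M (inc1 X M) (inc2 X M)
    (prj1 X M) (prj2 X M)"
  unfolding biproduct_def
  using direct_sum_homs[OF assms] by (simp add: block_products block_sum)

lemma biproduct_short_exact: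
  assumes "biproduct n E X M s1 s2 r1 r2"
  shows "short_exact n X s1 E r2 M"
proof -
  note b = biproductD[OF assms]
  show ?thesis
  proof (rule short_exactI[OF b(1) b(4), of r1 s2])
    show "r1 i \<in> carrier_mat (vdim X i) (vdim E i)" "s2 i \<in> carrier_mat (vdim E i) (vdim M i)" for i
      using hom_dims[OF b(3), of i] hom_dims[OF b(2), of i] by auto
  qed (use b(5-7) in auto)
qed

section \<open>Extensions\<close>

text \<open>The twist that a change of the vertexwise splitting by \<open>h\<close> produces.\<close>

definition coboundary :: "nat \<Rightarrow> rep \<Rightarrow> rep \<Rightarrow> (int \<Rightarrow> complex mat) \<Rightarrow> bool" where
  "coboundary n X M Y \<longleftrightarrow> (\<exists>h. (\<forall>i. h (i + int n) = h i \<and> h i \<in> carrier_mat (vdim X i) (vdim M i) \<and>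
     Y i = arr X i * h i - h (i + 1) * arr M i))"

lemma extensionD:
  assumes "(E, f, g) \<in> extensions n M X"
  shows "E \<in> reps n" "is_hom n X E f" "is_hom n E M g"
  using assms unfolding extensions_def short_exact_def is_mono_def is_epi_def by auto

lemma ext_equivE:
  assumes "(e, e') \<in> ext_equiv n M X"
  obtains E f g E' f' g' h where "e = (E, f, g)" "e' = (E', f', g')"
    "(E, f, g) \<in> extensions n M X" "(E', f', g') \<in> extensions n M X"
    "is_iso n E E' h" "\<forall>i. h i * f i = f' i \<and> g' i * h i = g i"
  using assms unfolding ext_equiv_def by blast

lemma ext_equivI:
  assumes "(E, f, g) \<in> extensions n M X" "(E', f', g') \<in> extensions n M X"
    "is_iso n E E' h" "\<And>i. h i * f i = f' i" "\<And>i. g' i * h i = g i"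
  shows "((E, f, g), (E', f', g')) \<in> ext_equiv n M X"
  using assms unfolding ext_equiv_def by blast

lemma equiv_ext_equiv: "equiv (extensions n M X) (ext_equiv n M X)"
proof (rule equivI)
  show "ext_equiv n M X \<subseteq> extensions n M X \<times> extensions n M X" unfolding ext_equiv_def by auto
  show "refl_on (extensions n M X) (ext_equiv n M X)"
  proof (rule refl_onI)
    fix e assume e: "e \<in> extensions n M X"
    obtain E f g where [simp]: "e = (E, f, g)" by (cases e)
    note h = extensionD[OF e[simplified]]
    show "(e, e) \<in> ext_equiv n M X"
      using e is_iso_id[OF h(1)] hom_dims[OF h(2)] hom_dims[OF h(3)]
      by (auto intro!: ext_equivI one_left_dim one_right_dim)
  qed
  show "sym (ext_equiv n M X)"
  proof (rule symI)
    fix e e' assume "(e, e') \<in> ext_equiv n M X"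
    then obtain E f g E' f' g' h where [simp]: "e = (E, f, g)" "e' = (E', f', g')"
      and ext: "(E, f, g) \<in> extensions n M X" "(E', f', g') \<in> extensions n M X"
      and h: "is_iso n E E' h" and hc: "\<forall>i. h i * f i = f' i \<and> g' i * h i = g i"
      by (rule ext_equivE)
    obtain k where k: "is_iso n E' E k" and hk: "\<forall>i. k i * h i = 1\<^sub>m (vdim E i) \<and> h i * k i = 1\<^sub>m (vdim E' i)"
      by (rule is_iso_inverse[OF h])
    have d: "is_hom n E E' h" "is_hom n E' E k" using h k unfolding is_iso_def by auto
    note [simp] = hom_dims[OF d(1)] hom_dims[OF d(2)] hom_dims[OF extensionD(2)[OF ext(1)]]
      hom_dims[OF extensionD(3)[OF ext(2)]]
    have "k i * f' i = f i" "g i * k i = g' i" for i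
    proof -
      have "k i * f' i = k i * h i * f i" using hc by (simp add: mult_assoc_dim)
      then show "k i * f' i = f i" using hk by (simp add: one_left_dim)
      have "g i * k i = g' i * h i * k i" using hc by simp
      then show "g i * k i = g' i" using hk by (simp add: mult_assoc_dim one_right_dim)
    qed
    then show "(e', e) \<in> ext_equiv n M X" using ext_equivI[OF ext(2,1) k] by simp
  qed
  show "trans (ext_equiv n M X)"
  proof (rule transI)
    fix e e' e'' assume 1: "(e, e') \<in> ext_equiv n M X" and 2: "(e', e'') \<in> ext_equiv n M X"
    obtain E f g E' f' g' h where [simp]: "e = (E, f, g)" "e' = (E', f', g')"
      and ext: "(E, f, g) \<in> extensions n M X" "(E', f', g') \<in> extensions n M X"
      and h: "is_iso n E E' h" and hc: "\<forall>i. h i * f i = f' i \<and> g' i * h i = g i"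
      using 1 by (rule ext_equivE)
    obtain E'' f'' g'' h' where [simp]: "e'' = (E'', f'', g'')" and ext': "(E'', f'', g'') \<in> extensions n M X"
      and h': "is_iso n E' E'' h'" and hc': "\<forall>i. h' i * f' i = f'' i \<and> g'' i * h' i = g' i"
      using 2 by (elim ext_equivE) auto
    have d: "is_hom n E E' h" "is_hom n E' E'' h'" using h h' unfolding is_iso_def by auto
    note [simp] = hom_dims[OF d(1)] hom_dims[OF d(2)] hom_dims[OF extensionD(2)[OF ext(1)]]
      hom_dims[OF extensionD(3)[OF ext']]
    have "h' i * h i * f i = f'' i" for i using hc hc' by (simp add: mult_assoc_dim)
    moreover have "g'' i * (h' i * h i) = g i" for i using hc hc' by (simp add: mult_assoc_dim[symmetric])
    ultimately show "(e, e'') \<in> ext_equiv n M X"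
      using ext_equivI[OF ext(1) ext' is_iso_comp[OF h h' extensionD(1)[OF ext(1)] extensionD(1)[OF ext(2)] extensionD(1)[OF ext']]]
      by simp
  qed
qed

lemma split_extension:
  assumes M: "M \<in> reps n" and X: "X \<in> reps n"
  shows "(direct_sum X M, sum_inj X M, sum_proj X M) \<in> extensions n M X"
  unfolding extensions_def using direct_sum_in_reps[OF X M] twisted_short_exact[OF X M zero_twist[OF X M]]
  by (simp add: direct_sum_twisted)

text \<open>Two classes of an equivalence relation coincide as soon as their representatives are related, so
  only the comparison with the split extension remains.\<close>

lemma Ext1_vanishes_iff_all_split:
  assumes M: "M \<in> reps n" and X: "X \<in> reps n"
  shows "Ext1_vanishes n M X \<longleftrightarrow>
    (\<forall>e\<in>extensions n M X. ((direct_sum X M, sum_inj X M, sum_proj X M), e) \<in> ext_equiv n M X)"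
proof -
  let ?x = "(direct_sum X M, sum_inj X M, sum_proj X M)" and ?A = "extensions n M X" and ?R = "ext_equiv n M X"
  note eq = equiv_ext_equiv[of n M X] and x = split_extension[OF M X]
  have "?A // ?R = {?R `` {?x}} \<longleftrightarrow> (\<forall>e\<in>?A. ?R `` {e} = ?R `` {?x})"
  proof -
    have "(\<Union>y\<in>A. {F y}) = {F x} \<longleftrightarrow> (\<forall>y\<in>A. F y = F x)"
      if "x \<in> A" for x and A :: "extension set" and F :: "extension \<Rightarrow> extension set"
      using that by blast
    from this[OF x, of "\<lambda>y. ?R `` {y}"] show ?thesis unfolding quotient_def .
  qed
  also have "\<dots> \<longleftrightarrow> (\<forall>e\<in>?A. (?x, e) \<in> ?R)"
    using eq_equiv_class_iff[OF eq _ x] by (metis (no_types, lifting) eq equivE symE)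
  finally show ?thesis unfolding Ext1_vanishes_def Ext1_def Ext1_zero_def .
qed

context
  fixes n :: nat and X M :: rep
  assumes X: "X \<in> reps n" and M: "M \<in> reps n"
begin

text \<open>A splitting of the twisted sum embeds \<open>M\<close> as \<open>w\<close>; the component of \<open>w\<close> in \<open>X\<close> is, up to sign,
  the required \<open>h\<close>.\<close>

lemma coboundary_if_split:
  assumes Y: "twist n X M Y" and van: "Ext1_vanishes n M X"
  shows "coboundary n X M Y"
proof -
  let ?E = "twisted_sum X M Y"
  have Yc: "Y i \<in> carrier_mat (vdim X (i + 1)) (vdim M i)" for i using Y unfolding twist_def by auto
  have E: "?E \<in> reps n" by (rule twisted_sum_in_reps[OF X M Y])
  have "(?E, sum_inj X M, sum_proj X M) \<in> extensions n M X"
    unfolding extensions_def using E twisted_short_exact[OF X M Y] by auto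
  then have "((direct_sum X M, sum_inj X M, sum_proj X M), (?E, sum_inj X M, sum_proj X M)) \<in> ext_equiv n M X"
    using van unfolding Ext1_vanishes_iff_all_split[OF M X] by blast
  then obtain h where h: "is_hom n (direct_sum X M) ?E h"
    and hc: "\<And>i. h i * sum_inj X M i = sum_inj X M i" "\<And>i. sum_proj X M i * h i = sum_proj X M i"
    unfolding ext_equiv_def is_iso_def by auto
  define w where "w i = h i * inc2 X M i" for i
  have w: "is_hom n M ?E w"
    unfolding w_def
    by (rule hom_comp[OF direct_sum_homs(2)[OF X M] h M direct_sum_in_reps[OF X M] E])
  note [simp] = hom_dims[OF h] hom_dims[OF w, simplified] reps_dims[OF X] reps_dims[OF M] carrier_matD[OF Yc] arr_dims[OF E, simplified]
  have p2w: "prj2 X M i * w i = 1\<^sub>m (vdim M i)" for i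
    using hc(2)[of i] unfolding sum_proj_eq w_def
    by (simp add: mult_assoc_dim[symmetric] block_products)
  define k where "k i = prj1 X M i * w i" for i
  have [simp]: "dim_row (k i) = vdim X i" "dim_col (k i) = vdim M i" for i by (auto simp: k_def)
  have per: "k (i + int n) = k i" for i
    by (simp add: k_def hom_periodic[OF w] reps_periodic[OF X] reps_periodic[OF M])
  have "k (i + 1) * arr M i = arr X i * k i + Y i" for i
  proof -
    have "k (i + 1) * arr M i = prj1 X M (i + 1) * arr ?E i * w i"
      by (simp add: k_def mult_assoc_dim hom_arr[OF w])
    also have "\<dots> = arr X i * k i + Y i"
      unfolding twisted_sum_proj1_arr[OF X M Yc]
      by (simp add: mat_alg p2w k_def)
    finally show ?thesis .
  qed
  then have eq: "Y i = arr X i * (- k i) - (- k (i + 1)) * arr M i" for i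
  proof -
    have e: "k (i + 1) * arr M i = arr X i * k i + Y i" by fact
    have "Y i $$ (a, b) = (k (i + 1) * arr M i) $$ (a, b) - (arr X i * k i) $$ (a, b)"
      if "a < vdim X (i + 1)" "b < vdim M i" for a b
      unfolding e using that by simp
    then show ?thesis
      by (intro eq_matI) (simp_all add: uminus_mult_left_mat uminus_mult_right_mat del: index_mult_mat(1))
  qed
  show ?thesis
    unfolding coboundary_def
    by (intro exI[of _ "\<lambda>i. - k i"] allI conjI) (use per eq in auto)
qed

text \<open>Conversely, a vertexwise splitting \<open>u\<close>, \<open>w\<close> of an extension has a twist \<open>u * arr E * w\<close>;
  when this is the coboundary of \<open>h\<close>, then \<open>w - f * h\<close> is a homomorphic section.\<close>

lemma split_if_coboundary:
  assumes cob: "\<And>Y. twist n X M Y \<Longrightarrow> coboundary n X M Y"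
    and ext: "(E, f, g) \<in> extensions n M X"
  shows "((direct_sum X M, sum_inj X M, sum_proj X M), (E, f, g)) \<in> ext_equiv n M X"
proof -
  have E: "E \<in> reps n" and ex: "short_exact n X f E g M" using ext unfolding extensions_def by auto
  have f: "is_hom n X E f" and g: "is_hom n E M g"
    using ex unfolding short_exact_def is_mono_def is_epi_def by auto
  obtain u w where uw_per: "\<forall>i. u (i + int n) = u i \<and> w (i + int n) = w i"
    and uw_split: "\<forall>i. u i \<in> carrier_mat (vdim X i) (vdim E i) \<and> w i \<in> carrier_mat (vdim E i) (vdim M i) \<and>
      u i * f i = 1\<^sub>m (vdim X i) \<and> g i * w i = 1\<^sub>m (vdim M i) \<and> f i * u i + w i * g i = 1\<^sub>m (vdim E i)"
    by (rule short_exact_splitting[OF ex X E M])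
  have per: "u (i + int n) = u i" "w (i + int n) = w i"
    and c: "u i \<in> carrier_mat (vdim X i) (vdim E i)" "w i \<in> carrier_mat (vdim E i) (vdim M i)"
    and uf: "u i * f i = 1\<^sub>m (vdim X i)" and gw: "g i * w i = 1\<^sub>m (vdim M i)"
    and sum1: "f i * u i + w i * g i = 1\<^sub>m (vdim E i)" for i
    using uw_per uw_split by auto
  note [simp] = hom_dims[OF f] hom_dims[OF g] carrier_matD[OF c(1)] carrier_matD[OF c(2)]
    reps_dims[OF X] reps_dims[OF M] reps_dims[OF E]
  have fc: "f i \<in> carrier_mat (vdim E i) (vdim X i)" and gc: "g i \<in> carrier_mat (vdim M i) (vdim E i)" for i
    by auto
  have gf: "g i * f i = 0\<^sub>m (vdim M i) (vdim X i)" and uw: "u i * w i = 0\<^sub>m (vdim X i) (vdim M i)" for i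
    using split_imp_exact(4,5)[OF fc gc c uf gw sum1] by auto
  define Y where "Y i = u (i + 1) * arr E i * w i" for i
  have Yc: "Y i \<in> carrier_mat (vdim X (i + 1)) (vdim M i)" for i unfolding Y_def by auto
  note [simp] = carrier_matD[OF Yc] carrier_matD[OF path_twist_dims[OF X M Yc]]
  \<comment> \<open>Inserting \<open>1 = f * u + w * g\<close> between consecutive arrows gives the recursion of \<open>path_twist\<close>.\<close>
  have tw: "u (i + int k) * path_map E i k * w i = path_twist X M Y i k" for i k
  proof (induction k)
    case 0
    then show ?case by (simp add: one_right_dim uw)
  next
    case (Suc k)
    have gpw: "g (i + int k) * path_map E i k * w i = path_map M i k"
      by (simp add: hom_path[OF g E M] mult_assoc_dim gw one_right_dim)
    have "u (i + int (Suc k)) * path_map E i (Suc k) * w i =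
      u (i + int k + 1) * (arr E (i + int k) * (f (i + int k) * u (i + int k) + w (i + int k) * g (i + int k))) * (path_map E i k * w i)"
      unfolding sum1 by (simp add: mult_assoc_dim one_right_dim add_ac)
    also have "\<dots> = u (i + int k + 1) * (arr E (i + int k) * f (i + int k)) * (u (i + int k) * path_map E i k * w i) +
      Y (i + int k) * (g (i + int k) * path_map E i k * w i)"
      by (simp add: mult_assoc_dim distrib_left_dim distrib_right_dim Y_def)
    also have "u (i + int k + 1) * (arr E (i + int k) * f (i + int k)) = arr X (i + int k)"
      unfolding hom_arr[OF f, symmetric] by (simp add: mult_eq_left[OF uf] one_left_dim)
    finally show ?case unfolding Suc gpw by simp
  qed
  have "twist n X M Y"
    unfolding twist_def
  proof (intro allI conjI)
    fix i
    have "u (i + int n + 1) = u (i + 1)" using per(1)[of "i + 1"] by (simp add: algebra_simps)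
    then show "Y (i + int n) = Y i" by (simp add: Y_def per reps_periodic[OF E])
    show "Y i \<in> carrier_mat (vdim X (i + 1)) (vdim M i)" by (rule Yc)
    show "path_twist X M Y i (n - 1) = 0\<^sub>m (vdim X (i + int (n - 1))) (vdim M i)"
      unfolding tw[symmetric] by (simp add: path_map_long[OF E] mat_alg)
  qed
  then obtain h where hper: "\<And>i. h (i + int n) = h i" and hc: "\<And>i. h i \<in> carrier_mat (vdim X i) (vdim M i)"
    and hY: "\<And>i. Y i = arr X i * h i - h (i + 1) * arr M i"
    using cob unfolding coboundary_def by blast
  note [simp] = carrier_matD[OF hc]
  define s where "s i = w i - f i * h i" for i
  define r where "r i = u i + h i * g i" for i
  have [simp]: "dim_row (s i) = vdim E i" "dim_col (s i) = vdim M i"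
    "dim_row (r i) = vdim X i" "dim_col (r i) = vdim E i" for i by (auto simp: s_def r_def)
  have s: "is_hom n M E s"
  proof (rule homI)
    fix i
    have "arr E i * w i = (f (i + 1) * u (i + 1) + w (i + 1) * g (i + 1)) * (arr E i * w i)"
      unfolding sum1 by (simp add: one_left_dim)
    also have "\<dots> = f (i + 1) * Y i + w (i + 1) * (g (i + 1) * arr E i * w i)"
      by (simp add: mult_assoc_dim distrib_right_dim Y_def)
    also have "g (i + 1) * arr E i * w i = arr M i"
      by (simp add: hom_arr[OF g] mult_assoc_dim gw one_right_dim)
    finally have aw: "arr E i * w i = f (i + 1) * Y i + w (i + 1) * arr M i" .
    have af: "arr E i * (f i * h i) = f (i + 1) * (arr X i * h i)"
      by (simp add: mult_eq_left[OF hom_arr[OF f, symmetric]] mult_assoc_dim)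
    have "arr E i * s i = f (i + 1) * (arr X i * h i) - f (i + 1) * (h (i + 1) * arr M i)
        + w (i + 1) * arr M i - f (i + 1) * (arr X i * h i)"
      by (simp add: s_def diff_distrib_left_dim aw af hY)
    also have "\<dots> = w (i + 1) * arr M i - f (i + 1) * (h (i + 1) * arr M i)"
      by (rule eq_matI) (simp_all del: index_mult_mat(1))
    also have "\<dots> = s (i + 1) * arr M i"
      by (simp add: s_def diff_distrib_right_dim mult_assoc_dim)
    finally show "s (i + 1) * arr M i = arr E i * s i" by simp
  qed (simp_all add: s_def per hper hom_periodic[OF f])
  have gs: "g i * s i = 1\<^sub>m (vdim M i)" for i
  proof -
    have "g i * s i = 1\<^sub>m (vdim M i) - 0\<^sub>m (vdim M i) (vdim M i)"
      by (simp add: s_def diff_distrib_left_dim gw mult_eq_left[OF gf] zero_left_dim)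
    then show ?thesis by (simp, intro eq_matI) auto
  qed
  have rf: "r i * f i = 1\<^sub>m (vdim X i)" for i
    by (simp add: r_def mat_alg uf gf)
  have rs: "r i * s i = 0\<^sub>m (vdim X i) (vdim M i)" for i
  proof -
    have "r i * s i = (u i * w i - u i * (f i * h i)) + h i * (g i * s i)"
      by (simp add: r_def s_def distrib_right_dim distrib_left_dim diff_distrib_left_dim mult_assoc_dim,
          rule eq_matI, simp_all del: index_mult_mat(1))
    also have "\<dots> = (0\<^sub>m (vdim X i) (vdim M i) - h i) + h i"
      by (simp add: uw gs mult_eq_left[OF uf] mat_alg)
    also have "\<dots> = 0\<^sub>m (vdim X i) (vdim M i)" by (rule eq_matI) auto
    finally show ?thesis .
  qed
  have frsg: "f i * r i + s i * g i = 1\<^sub>m (vdim E i)" for i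
  proof -
    have "f i * r i + s i * g i = (f i * u i + f i * (h i * g i)) + (w i * g i - f i * (h i * g i))"
      by (simp add: r_def s_def distrib_left_dim diff_distrib_right_dim mult_assoc_dim)
    also have "\<dots> = f i * u i + w i * g i" by (rule eq_matI) (simp_all del: index_mult_mat(1))
    finally show ?thesis using sum1 by simp
  qed
  have r: "is_hom n E X r"
  proof (rule homI)
    fix i
    \<comment> \<open>The maps \<open>f\<close> and \<open>s\<close> are homomorphisms that together span \<open>E\<close>, so it suffices to test on them.\<close>
    have "r (i + 1) * arr E i = r (i + 1) * arr E i * (f i * r i + s i * g i)"
      by (simp add: frsg one_right_dim)
    also have "\<dots> = r (i + 1) * (arr E i * f i) * r i + r (i + 1) * (arr E i * s i) * g i"
      by (simp add: distrib_left_dim mult_assoc_dim)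
    also have "\<dots> = arr X i * r i"
      unfolding hom_arr[OF f, symmetric] hom_arr[OF s, symmetric]
      by (simp add: mult_assoc_dim[symmetric] rf rs) (simp add: mat_alg)
    finally show "r (i + 1) * arr E i = arr X i * r i" .
  qed (simp_all add: r_def per hper hom_periodic[OF g])
  have b: "biproduct n E X M f s r g"
    unfolding biproduct_def using f s r g rf gs frsg by blast
  show ?thesis
    by (rule ext_equivI[OF split_extension[OF M X] ext biproduct_iso[OF b E X M]])
      (simp_all add: sum_inj_eq sum_proj_eq mat_alg block_products gf[THEN mult_eq_left] gs[THEN mult_eq_left])
qed

lemma Ext1_vanishes_iff_coboundary:
  "Ext1_vanishes n M X \<longleftrightarrow> (\<forall>Y. twist n X M Y \<longrightarrow> coboundary n X M Y)"
proof
  show "Ext1_vanishes n M X \<Longrightarrow> \<forall>Y. twist n X M Y \<longrightarrow> coboundary n X M Y"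
    using coboundary_if_split by blast
  assume "\<forall>Y. twist n X M Y \<longrightarrow> coboundary n X M Y"
  then show "Ext1_vanishes n M X"
    unfolding Ext1_vanishes_iff_all_split[OF M X] using split_if_coboundary by (metis prod_cases3)
qed

end

text \<open>Twists and coboundaries can be pulled back along homomorphisms; this is how vanishing of
  extensions passes to retracts and to direct sums.\<close>

lemma twist_pullback:
  assumes Y: "twist n X M Y" and f: "is_hom n M' M f"
    and r: "X \<in> reps n" "M \<in> reps n" "M' \<in> reps n"
  shows "twist n X M' (\<lambda>i. Y i * f i)"
proof -
  have Yc: "Y i \<in> carrier_mat (vdim X (i + 1)) (vdim M i)" for i using Y unfolding twist_def by auto
  note [simp] = hom_dims[OF f] carrier_matD[OF Yc] carrier_matD[OF path_twist_dims[OF r(1,2) Yc]]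
     reps_dims[OF r(1)] reps_dims[OF r(2)] reps_dims[OF r(3)]
  have "path_twist X M' (\<lambda>i. Y i * f i) i k = path_twist X M Y i k * f i" for i k
  proof (induction k)
    case (Suc k)
    then show ?case
      using hom_path[OF f r(3,2), of i k] by (simp add: mat_alg)
  qed (simp add: mat_alg)
  then show ?thesis
    using twistD(1,4)[OF Y] unfolding twist_def
    by (auto simp: hom_periodic[OF f] zero_left_dim)
qed

lemma coboundary_pullback:
  assumes Y: "coboundary n X M Y" and f: "is_hom n M' M f"
    and r: "X \<in> reps n" "M \<in> reps n" "M' \<in> reps n"
  shows "coboundary n X M' (\<lambda>i. Y i * f i)"
proof -
  obtain h where hper: "\<And>i. h (i + int n) = h i" and hc: "\<And>i. h i \<in> carrier_mat (vdim X i) (vdim M i)"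
    and hY: "\<And>i. Y i = arr X i * h i - h (i + 1) * arr M i"
    using Y unfolding coboundary_def by blast
  note [simp] = hom_dims[OF f] carrier_matD[OF hc] reps_dims[OF r(1)] reps_dims[OF r(2)] reps_dims[OF r(3)]
  have "Y i * f i = arr X i * (h i * f i) - h (i + 1) * f (i + 1) * arr M' i" for i
    by (simp add: hY mat_alg hom_arr[OF f])
  then show ?thesis
    unfolding coboundary_def
    by (intro exI[of _ "\<lambda>i. h i * f i"]) (auto simp: hper hom_periodic[OF f])
qed

lemma coboundary_add:
  assumes Y: "coboundary n X M Y" and Y': "coboundary n X M Y'" and r: "X \<in> reps n" "M \<in> reps n"
  shows "coboundary n X M (\<lambda>i. Y i + Y' i)"
proof -
  obtain h where hper: "\<And>i. h (i + int n) = h i" and hc: "\<And>i. h i \<in> carrier_mat (vdim X i) (vdim M i)"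
    and hY: "\<And>i. Y i = arr X i * h i - h (i + 1) * arr M i"
    using Y unfolding coboundary_def by blast
  obtain h' where hper': "\<And>i. h' (i + int n) = h' i" and hc': "\<And>i. h' i \<in> carrier_mat (vdim X i) (vdim M i)"
    and hY': "\<And>i. Y' i = arr X i * h' i - h' (i + 1) * arr M i"
    using Y' unfolding coboundary_def by blast
  note [simp] = carrier_matD[OF hc] carrier_matD[OF hc'] reps_dims[OF r(1)] reps_dims[OF r(2)]
  have "Y i + Y' i = arr X i * (h i + h' i) - (h (i + 1) + h' (i + 1)) * arr M i" for i
    by (rule eq_matI) (simp_all add: hY hY' distrib_left_dim distrib_right_dim del: index_mult_mat(1))
  then show ?thesis
    unfolding coboundary_def
    by (intro exI[of _ "\<lambda>i. h i + h' i"]) (auto simp: hper hper')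
qed

lemma Ext1_vanishes_retract:
  assumes "Ext1_vanishes n M X" and s: "is_hom n M' M s" and r: "is_hom n M M' r"
    and rs: "\<And>i. r i * s i = 1\<^sub>m (vdim M' i)" and R: "X \<in> reps n" "M \<in> reps n" "M' \<in> reps n"
  shows "Ext1_vanishes n M' X"
  unfolding Ext1_vanishes_iff_coboundary[OF R(1,3)]
proof (intro allI impI)
  fix Y assume Y: "twist n X M' Y"
  note [simp] = hom_dims[OF s] hom_dims[OF r] twistD(2,3)[OF Y]
  have "coboundary n X M (\<lambda>i. Y i * r i)"
    using assms(1) twist_pullback[OF Y r R(1,3,2)] unfolding Ext1_vanishes_iff_coboundary[OF R(1,2)] by blast
  then have "coboundary n X M' (\<lambda>i. Y i * r i * s i)"
    by (rule coboundary_pullback[OF _ s R])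
  moreover have "Y i * r i * s i = Y i" for i
    by (simp add: mult_assoc_dim rs one_right_dim)
  ultimately show "coboundary n X M' Y" by simp
qed

lemma Ext1_vanishes_biproduct:
  assumes b: "biproduct n E M M' s1 s2 r1 r2"
    and van: "Ext1_vanishes n M X" "Ext1_vanishes n M' X"
    and R: "X \<in> reps n" "M \<in> reps n" "M' \<in> reps n" "E \<in> reps n"
  shows "Ext1_vanishes n E X"
  unfolding Ext1_vanishes_iff_coboundary[OF R(1,4)]
proof (intro allI impI)
  note bp = biproductD[OF b]
  fix Y assume Y: "twist n X E Y"
  note [simp] = biproduct_dims[OF b] twistD(2,3)[OF Y]
  have "coboundary n X M (\<lambda>i. Y i * s1 i)"
    using van(1) twist_pullback[OF Y bp(1) R(1,4,2)] unfolding Ext1_vanishes_iff_coboundary[OF R(1,2)] by blast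
  then have 1: "coboundary n X E (\<lambda>i. Y i * s1 i * r1 i)"
    by (rule coboundary_pullback[OF _ bp(3) R(1,2,4)])
  have "coboundary n X M' (\<lambda>i. Y i * s2 i)"
    using van(2) twist_pullback[OF Y bp(2) R(1,4,3)] unfolding Ext1_vanishes_iff_coboundary[OF R(1,3)] by blast
  then have 2: "coboundary n X E (\<lambda>i. Y i * s2 i * r2 i)"
    by (rule coboundary_pullback[OF _ bp(4) R(1,3,4)])
  have "Y i * s1 i * r1 i + Y i * s2 i * r2 i = Y i * (s1 i * r1 i + s2 i * r2 i)" for i
    by (simp add: mult_assoc_dim distrib_left_dim)
  then have "Y i * s1 i * r1 i + Y i * s2 i * r2 i = Y i" for i
    by (simp add: bp(7) one_right_dim)
  then show "coboundary n X E Y" using coboundary_add[OF 1 2 R(1,4)] by simp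
qed

section \<open>String representations\<close>

text \<open>Between spaces of dimension at most one every map is of this form.\<close>

definition const_mat :: "nat \<Rightarrow> nat \<Rightarrow> complex \<Rightarrow> complex mat" where
  "const_mat r c x = mat r c (\<lambda>_. x)"

lemma const_mat_dims [simp]: "dim_row (const_mat r c x) = r" "dim_col (const_mat r c x) = c"
  by (simp_all add: const_mat_def)

lemma const_mat_mult: "const_mat r m x * const_mat m c y = const_mat r c (of_nat m * (x * y))"
  by (rule eq_matI) (simp_all add: const_mat_def scalar_prod_def)

lemma const_mat_add: "const_mat r c x + const_mat r c y = const_mat r c (x + y)"
  by (rule eq_matI) (simp_all add: const_mat_def)

lemma const_mat_zero: "0\<^sub>m r c = const_mat r c 0"
  by (rule eq_matI) (simp_all add: const_mat_def)

lemma const_mat_one: "k \<le> 1 \<Longrightarrow> 1\<^sub>m k = const_mat k k 1"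
  by (rule eq_matI) (auto simp: const_mat_def)

lemma const_mat_eq_iff: "const_mat r c x = const_mat r c y \<longleftrightarrow> r = 0 \<or> c = 0 \<or> x = y"
proof
  assume "const_mat r c x = const_mat r c y"
  then have "r \<noteq> 0 \<Longrightarrow> c \<noteq> 0 \<Longrightarrow> const_mat r c x $$ (0, 0) = const_mat r c y $$ (0, 0)" by simp
  then show "r = 0 \<or> c = 0 \<or> x = y" by (auto simp: const_mat_def)
qed (auto simp: const_mat_def intro!: eq_matI)

lemma offset_eqI: "0 \<le> x \<Longrightarrow> x < int n \<Longrightarrow> i = a + x + int n * t \<Longrightarrow> (i - a) mod int n = x"
  by simp

lemma offset_exists:
  assumes "0 < n"
  obtains x t where "0 \<le> x" "x < int n" "i = a + x + int n * t" "(i - a) mod int n = x"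
  using that[of "(i - a) mod int n" "(i - a) div int n"] assms by simp

lemma offset_succ:
  assumes "0 < n"
  shows "(i + 1 - a) mod int n = (if (i - a) mod int n + 1 = int n then 0 else (i - a) mod int n + 1)"
proof -
  obtain x t where x: "0 \<le> x" "x < int n" "i = a + x + int n * t" "(i - a) mod int n = x"
    by (rule offset_exists[OF assms])
  show ?thesis
  proof (cases "x + 1 = int n")
    case True
    then have "i + 1 = a + 0 + int n * (t + 1)" using x by (simp add: algebra_simps)
    then have "(i + 1 - a) mod int n = 0" using assms by (intro offset_eqI) auto
    then show ?thesis using True x by simp
  next
    case False
    then have "(i + 1 - a) mod int n = x + 1" using x by (intro offset_eqI[of _ _ _ _ t]) auto
    then show ?thesis using False x by simp
  qed
qed

text \<open>The support of \<open>string_rep n a b\<close> in terms of the offset of a vertex from \<open>a\<close>.\<close>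

lemma string_support:
  assumes "a < b" "b < a + int n" "0 \<le> d"
  shows "(\<exists>k. k mod int n = i mod int n \<and> a \<le> k \<and> k \<le> b - 1 - d) \<longleftrightarrow> (i - a) mod int n + d < b - a"
proof
  have n: "0 < n" using assms by simp
  obtain x t where x: "0 \<le> x" "x < int n" "i = a + x + int n * t" "(i - a) mod int n = x"
    by (rule offset_exists[OF n])
  {
    assume "(i - a) mod int n + d < b - a"
    then show "\<exists>k. k mod int n = i mod int n \<and> a \<le> k \<and> k \<le> b - 1 - d"
      using x by (intro exI[of _ "a + x"]) auto
  }
  assume "\<exists>k. k mod int n = i mod int n \<and> a \<le> k \<and> k \<le> b - 1 - d"
  then obtain k where k: "k mod int n = i mod int n" "a \<le> k" "k \<le> b - 1 - d" by blast
  have "(i - a) mod int n = (k - a) mod int n" using k(1) by (metis mod_diff_left_eq)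
  also have "\<dots> = k - a" using assms k by (intro mod_pos_pos_trivial) auto
  finally show "(i - a) mod int n + d < b - a" using k by simp
qed

lemma vdim_string:
  assumes "a < b" "b < a + int n"
  shows "vdim (string_rep n a b) i = (if (i - a) mod int n < b - a then 1 else 0)"
  using string_support[OF assms, of 0 i] by (simp add: string_rep_def Let_def)

lemma arr_string:
  assumes "a < b" "b < a + int n"
  shows "arr (string_rep n a b) i = const_mat (vdim (string_rep n a b) (i + 1)) (vdim (string_rep n a b) i)
    (if (i - a) mod int n + 1 < b - a then 1 else 0)"
proof -
  have n: "0 < n" using assms by simp
  have "(\<exists>k. k mod int n = i mod int n \<and> a \<le> k \<and> k \<le> b - 2) \<longleftrightarrow> (i - a) mod int n + 1 < b - a"
    using string_support[OF assms, of 1 i] by simp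
  then have "arr (string_rep n a b) i = (if (i - a) mod int n + 1 < b - a then 1\<^sub>m 1
    else 0\<^sub>m (vdim (string_rep n a b) (i + 1)) (vdim (string_rep n a b) i))"
    by (simp add: string_rep_def Let_def)
  moreover have "vdim (string_rep n a b) (i + 1) = 1 \<and> vdim (string_rep n a b) i = 1"
    if "(i - a) mod int n + 1 < b - a"
    using that assms by (simp add: vdim_string[OF assms] offset_succ[OF n])
  ultimately show ?thesis by (simp add: const_mat_one const_mat_zero)
qed

lemma offset_add:
  assumes "0 < n" "(i - a) mod int n + int k < int n"
  shows "(i + int k - a) mod int n = (i - a) mod int n + int k"
proof -
  obtain x t where "0 \<le> x" "x < int n" "i = a + x + int n * t" "(i - a) mod int n = x"
    by (rule offset_exists[OF assms(1)])
  then show ?thesis using assms by (intro offset_eqI[of _ _ _ _ t]) auto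
qed

lemma path_map_string:
  assumes ab: "a < b" "b < a + int n"
  shows "path_map (string_rep n a b) i k = const_mat (vdim (string_rep n a b) (i + int k)) (vdim (string_rep n a b) i)
    (if (i - a) mod int n + int k < b - a then 1 else 0)"
proof (induction k)
  case 0
  show ?case by (auto simp: const_mat_one vdim_string[OF ab] const_mat_eq_iff)
next
  case (Suc k)
  have n: "0 < n" using ab by simp
  show ?case
  proof (cases "(i - a) mod int n + int k < b - a")
    case True
    then have off: "(i + int k - a) mod int n = (i - a) mod int n + int k"
      using ab by (intro offset_add[OF n]) auto
    then have "vdim (string_rep n a b) (i + int k) = 1" using True by (simp add: vdim_string[OF ab])
    then show ?thesis
      using Suc True off by (simp add: arr_string[OF ab] const_mat_mult add_ac)
  next
    case False
    then show ?thesis using Suc by (simp add: arr_string[OF ab] const_mat_mult add_ac)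
  qed
qed

lemma string_in_reps:
  assumes ab: "a < b" "b < a + int n"
  shows "string_rep n a b \<in> reps n"
proof (rule repsI)
  have n: "0 < n" using ab by simp
  have sh: "(i + int n - a) mod int n = (i - a) mod int n" for i
    by (metis add_diff_eq diff_add_eq mod_add_self2)
  show v: "vdim (string_rep n a b) (i + int n) = vdim (string_rep n a b) i" for i
    by (simp add: vdim_string[OF ab] sh)
  show "arr (string_rep n a b) (i + int n) = arr (string_rep n a b) i" for i
    using v[of i] v[of "i + 1"] by (simp add: arr_string[OF ab] sh add_ac)
  show "arr (string_rep n a b) i \<in> carrier_mat (vdim (string_rep n a b) (i + 1)) (vdim (string_rep n a b) i)" for i
    by (simp add: arr_string[OF ab] carrier_matI)
  have "0 \<le> (i - a) mod int n" for i using n by simp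
  then have "\<not> (i - a) mod int n + int (n - 1) < b - a" for i
    using ab by (smt (verit) n of_nat_1 of_nat_diff One_nat_def Suc_leI)
  then show "path_map (string_rep n a b) i (n - 1) =
      0\<^sub>m (vdim (string_rep n a b) (i + int (n - 1))) (vdim (string_rep n a b) i)" for i
    by (simp add: path_map_string[OF ab] const_mat_zero)
qed

text \<open>The map between two strings that is the identity at the vertices from \<open>a\<close> to \<open>d - 1\<close> and zero
  elsewhere. The supports may also meet at vertices beyond \<open>d - 1\<close>, one turn around the cycle later,
  and there the map has to vanish; hence the factor in the definition.\<close>

definition string_hom :: "nat \<Rightarrow> int \<Rightarrow> int \<Rightarrow> int \<Rightarrow> int \<Rightarrow> int \<Rightarrow> complex mat" where
  "string_hom n a b c d i = const_mat (vdim (string_rep n c d) i) (vdim (string_rep n a b) i)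
     (if (i - a) mod int n < d - a then 1 else 0)"

lemma string_hom_dims [simp]:
  "dim_row (string_hom n a b c d i) = vdim (string_rep n c d) i"
  "dim_col (string_hom n a b c d i) = vdim (string_rep n a b) i"
  by (simp_all add: string_hom_def)

lemma offset_change:
  assumes "c \<le> a" "(i - a) mod int n < d - a" "d < c + int n" "0 < n"
  shows "(i - c) mod int n = (i - a) mod int n + (a - c)"
proof -
  obtain x t where "0 \<le> x" "x < int n" "i = a + x + int n * t" "(i - a) mod int n = x"
    by (rule offset_exists[OF assms(4)])
  then show ?thesis using assms by (intro offset_eqI[of _ _ _ _ t]) auto
qed

lemma string_hom_is_hom:
  assumes "c \<le> a" "a < d" "d \<le> b" "b < a + int n" "d < c + int n"
  shows "is_hom n (string_rep n a b) (string_rep n c d) (string_hom n a b c d)"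
proof (rule homI)
  have n: "0 < n" using assms by simp
  have ab: "a < b" "b < a + int n" and cd: "c < d" "d < c + int n" using assms by auto
  note R = string_in_reps[OF ab] string_in_reps[OF cd]
  have sh: "(i + int n - a) mod int n = (i - a) mod int n" for i
    by (metis add_diff_eq diff_add_eq mod_add_self2)
  show "string_hom n a b c d (i + int n) = string_hom n a b c d i" for i
    by (simp add: string_hom_def reps_periodic[OF R(1)] reps_periodic[OF R(2)] sh)
  fix i
  define x where "x = (i - a) mod int n"
  have x: "0 \<le> x" "x < int n" using n by (auto simp: x_def)
  have xc: "(i - c) mod int n = x + (a - c)" if "x < d - a"
    using offset_change[of c a i n d] assms n that x_def by simp
  have xs: "(i + 1 - a) mod int n = (if x + 1 = int n then 0 else x + 1)"
    using offset_succ[OF n, of i a] by (simp add: x_def)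
  consider "x + 1 < d - a" | "x + 1 = d - a" | "d - a \<le> x" by linarith
  then show "string_hom n a b c d (i + 1) * arr (string_rep n a b) i =
    arr (string_rep n c d) i * string_hom n a b c d i"
  proof cases
    case 1
    then show ?thesis
      using assms xc xs x
      by (simp add: string_hom_def arr_string[OF ab] arr_string[OF cd] const_mat_mult x_def[symmetric]
          vdim_string[OF ab] vdim_string[OF cd])
  next
    case 2
    then show ?thesis
      using assms xc xs x
      by (simp add: string_hom_def arr_string[OF ab] arr_string[OF cd] const_mat_mult x_def[symmetric]
          vdim_string[OF ab] vdim_string[OF cd])
  next
    case 3
    then show ?thesis
      using assms xs x
      by (auto simp: string_hom_def arr_string[OF ab] arr_string[OF cd] const_mat_mult x_def[symmetric]
          const_mat_eq_iff)
  qed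
qed simp_all

lemma string_quotient:
  assumes "a < d" "d \<le> b" "b < a + int n"
  shows "is_quotient n (string_rep n a b) (string_rep n a d)"
proof (rule is_quotientI)
  have ab: "a < b" "b < a + int n" and ad: "a < d" "d < a + int n" using assms by auto
  show "is_hom n (string_rep n a b) (string_rep n a d) (string_hom n a b a d)"
    by (rule string_hom_is_hom) (use assms in auto)
  fix i
  show "string_hom n a b a d i * const_mat (vdim (string_rep n a b) i) (vdim (string_rep n a d) i) 1 = 1\<^sub>m (vdim (string_rep n a d) i)"
    using assms by (auto simp: string_hom_def const_mat_mult vdim_string[OF ab] vdim_string[OF ad]
        const_mat_one const_mat_eq_iff)
qed simp

lemma string_mono:
  assumes "c \<le> a" "a < b" "b < c + int n"
  shows "is_mono n (string_rep n a b) (string_rep n c b) (string_hom n a b c b)"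
proof -
  have n: "0 < n" using assms by simp
  have ab: "a < b" "b < a + int n" and cb: "c < b" "b < c + int n" using assms by auto
  have "inj_on (\<lambda>v. string_hom n a b c b i *\<^sub>v v) (carrier_vec (vdim (string_rep n a b) i))" for i
  proof -
    have "const_mat (vdim (string_rep n a b) i) (vdim (string_rep n c b) i) 1 * string_hom n a b c b i =
       1\<^sub>m (vdim (string_rep n a b) i)"
      using assms offset_change[of c a i n b] n
      by (auto simp: string_hom_def const_mat_mult vdim_string[OF ab] vdim_string[OF cb]
          const_mat_one const_mat_eq_iff)
    then show ?thesis using left_inverse_inj[of _ "string_hom n a b c b i"] by simp
  qed
  then show ?thesis
    unfolding is_mono_def using string_hom_is_hom[of c a b b n] assms by auto
qed

text \<open>Each vertex of the long string supports exactly one of its tail and its head, which splits the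
  sequence at that vertex.\<close>

lemma string_short_exact:
  assumes "a < b" "b < d" "d < a + int n"
  shows "short_exact n (string_rep n b d) (string_hom n b d a d) (string_rep n a d)
    (string_hom n a d a b) (string_rep n a b)"
proof (rule short_exactI)
  have n: "0 < n" using assms by simp
  have ab: "a < b" "b < a + int n" and ad: "a < d" "d < a + int n" and bd: "b < d" "d < b + int n"
    using assms by auto
  show "is_hom n (string_rep n b d) (string_rep n a d) (string_hom n b d a d)"
    "is_hom n (string_rep n a d) (string_rep n a b) (string_hom n a d a b)"
    by (rule string_hom_is_hom; use assms in simp)+
  fix i
  define x where "x = (i - a) mod int n"
  have x: "0 \<le> x" "x < int n" using n by (auto simp: x_def)
  have 1: "(i - b) mod int n = x - (b - a)" if "b - a \<le> x"
  proof -
    obtain y t where "0 \<le> y" "y < int n" "i = a + y + int n * t" "(i - a) mod int n = y"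
      by (rule offset_exists[OF n])
    then show ?thesis using that assms by (intro offset_eqI[of _ _ _ _ t]) (auto simp: x_def)
  qed
  have 2: "(i - b) mod int n = x - (b - a) + int n" if "x < b - a"
  proof -
    obtain y t where "0 \<le> y" "y < int n" "i = a + y + int n * t" "(i - a) mod int n = y"
      by (rule offset_exists[OF n])
    then show ?thesis using that assms by (intro offset_eqI[of _ _ _ _ "t - 1"]) (auto simp: x_def algebra_simps)
  qed
  note v = vdim_string[OF ab] vdim_string[OF ad] vdim_string[OF bd] string_hom_def
  let ?u = "const_mat (vdim (string_rep n b d) i) (vdim (string_rep n a d) i) 1"
  let ?w = "const_mat (vdim (string_rep n a d) i) (vdim (string_rep n a b) i) 1"
  show "?u \<in> carrier_mat (vdim (string_rep n b d) i) (vdim (string_rep n a d) i)"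
    "?w \<in> carrier_mat (vdim (string_rep n a d) i) (vdim (string_rep n a b) i)" by (auto intro: carrier_matI)
  consider "x < b - a" | "b - a \<le> x" "x < d - a" | "d - a \<le> x" by linarith
  then have "?u * string_hom n b d a d i = 1\<^sub>m (vdim (string_rep n b d) i) \<and>
     string_hom n a d a b i * ?w = 1\<^sub>m (vdim (string_rep n a b) i) \<and>
     string_hom n b d a d i * ?u + ?w * string_hom n a d a b i = 1\<^sub>m (vdim (string_rep n a d) i)"
  proof cases
    case 1
    then show ?thesis using 2 assms x
      by (simp add: v const_mat_mult const_mat_add const_mat_one const_mat_eq_iff x_def[symmetric])
  next
    case 2
    then show ?thesis using 1 assms x
      by (simp add: v const_mat_mult const_mat_add const_mat_one const_mat_eq_iff x_def[symmetric])
  next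
    case 3
    then show ?thesis using 1 assms x
      by (simp add: v const_mat_mult const_mat_add const_mat_one const_mat_eq_iff x_def[symmetric])
  qed
  then show "?u * string_hom n b d a d i = 1\<^sub>m (vdim (string_rep n b d) i)"
    "string_hom n a d a b i * ?w = 1\<^sub>m (vdim (string_rep n a b) i)"
    "string_hom n b d a d i * ?u + ?w * string_hom n a d a b i = 1\<^sub>m (vdim (string_rep n a d) i)" by auto
qed

section \<open>Decomposition into strings\<close>

lemma matrix_nonzero_entry:
  assumes "A \<noteq> 0\<^sub>m r c" "dim_row A = r" "dim_col A = c"
  shows "\<exists>i<r. \<exists>j<c. A $$ (i, j) \<noteq> 0"
proof (rule ccontr)
  assume "\<not> ?thesis"
  then have "A = 0\<^sub>m r c" using assms by (intro eq_matI) auto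
  then show False using assms by simp
qed

text \<open>Let \<open>k\<close> be the largest length of a nonzero path map of \<open>M\<close>, and \<open>\<phi> * P * x = 1\<close> for such a
  path map \<open>P\<close> out of vertex \<open>a\<close>. The images of \<open>x\<close> along the path span a copy of a string, and
  following the path up to its end and applying \<open>\<phi>\<close> is a retraction onto it: both maps commute with
  the arrows because paths of length \<open>k + 1\<close> vanish.\<close>

lemma string_retract:
  assumes M: "M \<in> reps n" and nz: "\<not> is_zero M"
  shows "\<exists>a b s r. a < b \<and> b < a + int n \<and> is_hom n (string_rep n a b) M s \<and> is_hom n M (string_rep n a b) r \<and>
    (\<forall>i. r i * s i = 1\<^sub>m (vdim (string_rep n a b) i))"
proof -
  \<comment> \<open>Lengths of nonzero paths are below \<open>n - 1\<close>, so the vertices of the string are distinct.\<close>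
  define K where "K = {k. \<exists>i. path_map M i k \<noteq> 0\<^sub>m (vdim M (i + int k)) (vdim M i)}"
  have Kb: "k < n - 1" if "k \<in> K" for k
    using that path_map_long[OF M, of k] unfolding K_def by force
  have fin: "finite K" by (rule finite_subset[of _ "{..<n - 1}"]) (use Kb in auto)
  obtain i0 where i0: "vdim M i0 \<noteq> 0" using nz unfolding is_zero_def by auto
  have "1\<^sub>m (vdim M i0) \<noteq> (0\<^sub>m (vdim M i0) (vdim M i0) :: complex mat)"
  proof
    assume "1\<^sub>m (vdim M i0) = (0\<^sub>m (vdim M i0) (vdim M i0) :: complex mat)"
    then have "1\<^sub>m (vdim M i0) $$ (0, 0) = (0\<^sub>m (vdim M i0) (vdim M i0) :: complex mat) $$ (0, 0)" by simp
    then show False using i0 by simp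
  qed
  then have "0 \<in> K" unfolding K_def by (auto intro!: exI[of _ i0])
  define l where "l = Max K"
  have lK: "l \<in> K" unfolding l_def using fin \<open>0 \<in> K\<close> by (intro Max_in) auto
  have "Suc l \<notin> K" using Max_ge[OF fin, of "Suc l"] unfolding l_def by auto
  then have top: "path_map M i (Suc l) = 0\<^sub>m (vdim M (i + int (Suc l))) (vdim M i)" for i
    unfolding K_def by blast
  have ln: "l < n - 1" using Kb lK by auto
  then have n: "0 < n" by simp
  obtain a where a: "path_map M a l \<noteq> 0\<^sub>m (vdim M (a + int l)) (vdim M a)"
    using lK unfolding K_def by auto
  note [simp] = reps_dims[OF M]
  obtain p c where pc: "p < vdim M (a + int l)" "c < vdim M a" "path_map M a l $$ (p, c) \<noteq> 0"
    using matrix_nonzero_entry[OF a] by auto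
  define x :: "complex mat" where "x = mat (vdim M a) 1 (\<lambda>(r, _). of_bool (r = c))"
  define \<phi> :: "complex mat" where
    "\<phi> = mat 1 (vdim M (a + int l)) (\<lambda>(_, y). if y = p then 1 / path_map M a l $$ (p, c) else 0)"
  have [simp]: "dim_row x = vdim M a" "dim_col x = 1" "dim_row \<phi> = 1" "dim_col \<phi> = vdim M (a + int l)"
    by (auto simp: x_def \<phi>_def)
  have px: "(path_map M a l * x) $$ (r, 0) = path_map M a l $$ (r, c)" if "r < vdim M (a + int l)" for r
    using mult_select_right[of 0 1 "\<lambda>_. c" "path_map M a l" r] that pc by (simp add: x_def)
  have \<phi>x: "\<phi> * (path_map M a l * x) = 1\<^sub>m 1"
  proof (rule eq_matI)
    fix u v assume uv: "u < dim_row (1\<^sub>m 1 :: complex mat)" "v < dim_col (1\<^sub>m 1 :: complex mat)"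
    have "(\<phi> * (path_map M a l * x)) $$ (0, 0) =
       (\<Sum>y<vdim M (a + int l). \<phi> $$ (0, y) * (path_map M a l * x) $$ (y, 0))"
      by (simp add: scalar_prod_def lessThan_atLeast0 del: assoc_mult_mat)
    also have "\<dots> = (\<Sum>y<vdim M (a + int l). if y = p then 1 else 0)"
      using pc by (intro sum.cong) (auto simp: px \<phi>_def simp del: index_mult_mat(1))
    finally show "(\<phi> * (path_map M a l * x)) $$ (u, v) = 1\<^sub>m 1 $$ (u, v)" using uv pc by simp
  qed simp_all
  define b where "b = a + int l + 1"
  have ab: "a < b" "b < a + int n" using ln by (auto simp: b_def)
  let ?S = "string_rep n a b"
  have ba: "b - a = int l + 1" by (simp add: b_def)
  define off where "off i = nat ((i - a) mod int n)" for i
  have ioff: "int (off i) = (i - a) mod int n" for i using n by (simp add: off_def)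
  have offn: "off i < n" for i
    using pos_mod_bound[of "int n" "i - a"] n ioff[of i] by linarith
  have off_Suc: "off (i + 1) = (if off i + 1 = n then 0 else off i + 1)" for i
    using offset_succ[OF n, of i a] ioff[of i] ioff[of "i + 1"] by (auto split: if_splits)
  have offmod: "(a + int (off i) + y) mod int n = (i + y) mod int n" for i y
  proof -
    have "(a + int (off i) + y) mod int n = ((a + y) + (i - a) mod int n) mod int n"
      by (simp add: ioff algebra_simps)
    also have "\<dots> = ((a + y) + (i - a)) mod int n" by (rule mod_add_right_eq)
    finally show ?thesis by (simp add: add.commute)
  qed
  have at: "vdim M (a + int (off i) + y) = vdim M (i + y)" "arr M (a + int (off i) + y) = arr M (i + y)"
     "path_map M (a + int (off i) + y) = path_map M (i + y)" for i y
    by (rule periodic_cong[of _ n]; simp add: reps_periodic[OF M] offmod)+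
       (rule periodic_cong[of "path_map M" n], simp add: path_map_periodic[OF M] ext, simp add: offmod)
  note at0 = at[of _ 0, simplified]
  have vS: "vdim ?S i = (if off i \<le> l then 1 else 0)" for i
    unfolding vdim_string[OF ab] ba using ioff[of i] by auto
  have aS: "arr ?S i = const_mat (vdim ?S (i + 1)) (vdim ?S i) (if off i + 1 \<le> l then 1 else 0)" for i
    unfolding arr_string[OF ab] ba const_mat_eq_iff using ioff[of i] by auto
  have aS1: "arr ?S i = 1\<^sub>m 1" if "off i + 1 \<le> l" for i
    using that ln by (simp add: aS vS off_Suc const_mat_one)
  define s where "s i = (if off i \<le> l then path_map M a (off i) * x else 0\<^sub>m (vdim M i) 0)" for i
  define r where "r i = (if off i \<le> l then \<phi> * path_map M i (l - off i) else 0\<^sub>m 0 (vdim M i))" for i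
  have offper: "off (i + int n) = off i" for i
    unfolding off_def by (metis add_diff_eq diff_add_eq mod_add_self2)
  have path_end: "vdim M (i + int (l - off i)) = vdim M (a + int l)" if "off i \<le> l" for i
    using at(1)[of i "int (l - off i)"] that by simp
  have [simp]: "dim_row (s i) = vdim M i" "dim_col (s i) = vdim ?S i"
    "dim_row (r i) = vdim ?S i" "dim_col (r i) = vdim M i" for i
    by (auto simp: s_def r_def vS at0)
  have s: "is_hom n ?S M s"
  proof (rule homI)
    show "s (i + int n) = s i" for i by (simp add: s_def offper reps_periodic[OF M])
    fix i
    consider "off i + 1 \<le> l" | "off i = l" | "l < off i" by linarith
    then show "s (i + 1) * arr ?S i = arr M i * s i"
    proof cases
      case 1
      then have "off i + 1 \<noteq> n" using ln by linarith
      then have "s (i + 1) = arr M (a + int (off i)) * path_map M a (off i) * x"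
        using 1 by (simp add: s_def off_Suc del: assoc_mult_mat)
      then show ?thesis
        using 1 unfolding aS1[OF 1] by (simp add: s_def at0 mult_assoc_dim one_right_dim)
    next
      case 2
      have "arr M i * s i = arr M (a + int (off i)) * path_map M a (off i) * x"
        using eq_imp_le[OF 2] by (simp add: s_def mult_assoc_dim at0)
      also have "\<dots> = path_map M a (Suc l) * x" by (simp add: 2)
      also have "\<dots> = 0\<^sub>m (vdim M (i + 1)) 1"
        unfolding top using 2 at(1)[of i 1] by (simp add: zero_left_dim add_ac)
      finally show ?thesis
        using 2 ln by (simp add: aS vS off_Suc const_mat_zero[symmetric] zero_right_dim eq_mat_empty)
    next
      case 3
      then show ?thesis by (intro eq_mat_empty) (simp_all add: vS arr_dims[OF string_in_reps[OF ab]])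
    qed
  qed simp_all
  have r: "is_hom n M ?S r"
  proof (rule homI)
    show "r (i + int n) = r i" for i by (simp add: r_def offper reps_periodic[OF M] path_map_periodic[OF M])
    fix i
    consider "off i + 1 \<le> l" | "l \<le> off i" "off i + 1 < n" | "l \<le> off i" "off i + 1 = n"
      using offn[of i] by linarith
    then show "r (i + 1) * arr M i = arr ?S i * r i"
    proof cases
      case 1
      have o: "off (i + 1) = off i + 1" using 1 ln by (simp add: off_Suc)
      have "l - off i = Suc (l - off (i + 1))" using 1 o by simp
      then have "path_map M i (l - off i) = path_map M (i + 1) (l - off (i + 1)) * arr M i"
        by (simp only: path_map_Suc_left[OF M])
      then show ?thesis
        using 1 path_end[of "i + 1"] unfolding aS1[OF 1]
        by (simp add: r_def o mult_assoc_dim one_left_dim)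
    next
      case 2
      then show ?thesis by (intro eq_mat_empty) (simp_all add: vS off_Suc arr_dims[OF string_in_reps[OF ab]])
    next
      case 3
      have "r (i + 1) * arr M i = \<phi> * path_map M i (Suc l)"
        using 3 path_end[of "i + 1"] by (simp add: r_def off_Suc mult_assoc_dim path_map_Suc_left[OF M] del: path_map.simps)
      also have "\<dots> = 0\<^sub>m 1 (vdim M i)"
      proof -
        have "off (i + 1) = 0" using 3 by (simp add: off_Suc)
        then have "vdim M (i + int (Suc l)) = vdim M (a + int l)" using path_end[of "i + 1"] by (simp add: add_ac)
        then show ?thesis unfolding top by (simp only:) (simp add: zero_right_dim)
      qed
      also have "\<dots> = arr ?S i * r i"
        using 3 ln by (simp add: aS vS off_Suc const_mat_zero[symmetric] zero_left_dim)
      finally show ?thesis .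
    qed
  qed simp_all
  have "r i * s i = 1\<^sub>m (vdim ?S i)" for i
  proof (cases "off i \<le> l")
    case True
    have "path_map M a l = path_map M i (l - off i) * path_map M a (off i)"
      using path_map_add[OF M, of a "off i" "l - off i"] True by (simp add: at0)
    then show ?thesis
      using True \<phi>x path_end[OF True] by (simp add: r_def s_def vS mult_assoc_dim at0)
  next
    case False
    then show ?thesis by (intro eq_mat_empty) (simp_all add: vS)
  qed
  then show ?thesis using ab s r by blast
qed

text \<open>At each vertex the kernel of \<open>r\<close> is the whole space or the complement of a line. The arrows of
  \<open>N\<close> are those of \<open>M\<close> between these kernels, in coordinates from \<open>complement_of_line\<close>.\<close>

lemma thin_retract_complement:
  assumes M: "M \<in> reps n" and S: "S \<in> reps n" and thin: "\<And>i. vdim S i \<le> 1"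
    and s: "is_hom n S M s" and r: "is_hom n M S r" and rs: "\<And>i. r i * s i = 1\<^sub>m (vdim S i)"
  shows "\<exists>N\<in>reps n. (\<exists>j q. biproduct n M S N s j r q) \<and> (\<forall>i. vdim M i = vdim S i + vdim N i)"
proof -
  note [simp] = hom_dims[OF s] hom_dims[OF r] reps_dims[OF M] reps_dims[OF S]
  let ?d = "\<lambda>i. vdim M i - vdim S i"
  let ?Q = "\<lambda>i j q. j \<in> carrier_mat (vdim M i) (?d i) \<and> q \<in> carrier_mat (?d i) (vdim M i) \<and>
    vdim S i \<le> vdim M i \<and> q * j = 1\<^sub>m (?d i) \<and> s i * r i + j * q = 1\<^sub>m (vdim M i)"
  have "\<exists>j q. (\<forall>i. j (i + int n) = j i \<and> q (i + int n) = q i) \<and> (\<forall>i. ?Q i (j i) (q i))"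
  proof (rule periodic_choice2)
    fix i
    show "?Q (i + int n) = ?Q i"
      by (intro ext) (simp add: reps_periodic[OF M] reps_periodic[OF S] hom_periodic[OF s] hom_periodic[OF r])
    show "\<exists>j q. ?Q i j q"
    proof (cases "vdim S i = 0")
      case True
      have "s i * r i = 0\<^sub>m (vdim M i) (vdim M i)"
        by (rule eq_matI) (auto simp: True scalar_prod_def)
      then show ?thesis
        using True by (intro exI[of _ "1\<^sub>m (vdim M i)"]) (simp add: one_left_dim zero_add_dim)
    next
      case False
      then have 1: "vdim S i = 1" using thin[of i] by simp
      have "r i \<in> carrier_mat 1 (vdim M i)" "s i \<in> carrier_mat (vdim M i) 1" "r i * s i = 1\<^sub>m 1"
        using 1 rs[of i] by auto
      from complement_of_line[OF this] obtain j q where "j \<in> carrier_mat (vdim M i) (vdim M i - 1)"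
        "q \<in> carrier_mat (vdim M i - 1) (vdim M i)" "0 < vdim M i" "q * j = 1\<^sub>m (vdim M i - 1)"
        "s i * r i + j * q = 1\<^sub>m (vdim M i)" by blast
      then show ?thesis unfolding 1 by (intro exI[of _ j] exI[of _ q]) auto
    qed
  qed
  then obtain j q where per: "\<And>i. j (i + int n) = j i" "\<And>i. q (i + int n) = q i" and Q: "\<And>i. ?Q i (j i) (q i)"
    by blast
  have jc: "j i \<in> carrier_mat (vdim M i) (?d i)" and qc: "q i \<in> carrier_mat (?d i) (vdim M i)"
    and le: "vdim S i \<le> vdim M i" and qj: "q i * j i = 1\<^sub>m (?d i)"
    and sum1: "s i * r i + j i * q i = 1\<^sub>m (vdim M i)" for i
    using Q[of i] by auto
  note [simp] = carrier_matD[OF jc] carrier_matD[OF qc]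
  have sc: "s i \<in> carrier_mat (vdim M i) (vdim S i)" and rc: "r i \<in> carrier_mat (vdim S i) (vdim M i)" for i by auto
  have qs: "q i * s i = 0\<^sub>m (?d i) (vdim S i)" and rj: "r i * j i = 0\<^sub>m (vdim S i) (?d i)" for i
    using split_imp_exact(4,5)[OF sc qc rc jc rs qj sum1] by auto
  define N where "N = \<lparr>vdim = ?d, arr = (\<lambda>i. q (i + 1) * arr M i * j i)\<rparr>"
  have [simp]: "vdim N i = ?d i" for i by (simp add: N_def)
  have aN: "arr N i = q (i + 1) * arr M i * j i" for i by (simp add: N_def)
  have hq: "q (i + 1) * arr M i = arr N i * q i" for i
  proof -
    have "q (i + 1) * arr M i = q (i + 1) * (arr M i * (s i * r i + j i * q i))"
      by (simp add: sum1 one_right_dim)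
    also have "\<dots> = q (i + 1) * (arr M i * s i) * r i + arr N i * q i"
      by (simp add: aN mult_assoc_dim distrib_left_dim)
    also have "\<dots> = arr N i * q i"
      unfolding hom_arr[OF s, symmetric] by (simp add: mult_assoc_dim[symmetric] qs aN) (simp add: mat_alg)
    finally show ?thesis .
  qed
  have hj: "j (i + 1) * arr N i = arr M i * j i" for i
  proof -
    have "arr M i * j i = (s (i + 1) * r (i + 1) + j (i + 1) * q (i + 1)) * (arr M i * j i)"
      by (simp add: sum1 one_left_dim)
    also have "\<dots> = s (i + 1) * (r (i + 1) * arr M i * j i) + j (i + 1) * arr N i"
      by (simp add: aN mult_assoc_dim distrib_right_dim)
    also have "\<dots> = j (i + 1) * arr N i"
      unfolding hom_arr[OF r] by (simp add: mult_assoc_dim rj aN zero_right_dim zero_add_dim)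
    finally show ?thesis by simp
  qed
  have pN: "path_map N i k = q (i + int k) * path_map M i k * j i" for i k
  proof (induction k)
    case 0
    then show ?case by (simp add: one_right_dim qj)
  next
    case (Suc k)
    have "path_map N i (Suc k) = arr N (i + int k) * q (i + int k) * path_map M i k * j i"
      unfolding path_map.simps Suc by (simp add: aN mult_assoc_dim)
    also have "\<dots> = q (i + int (Suc k)) * path_map M i (Suc k) * j i"
      unfolding hq[symmetric] by (simp add: mult_assoc_dim add_ac)
    finally show ?case .
  qed
  have N: "N \<in> reps n"
  proof (rule repsI)
    fix i
    show "vdim N (i + int n) = vdim N i" by (simp add: reps_periodic[OF M] reps_periodic[OF S])
    have "q (i + int n + 1) = q (i + 1)" using per(2)[of "i + 1"] by (simp add: algebra_simps)
    then show "arr N (i + int n) = arr N i" by (simp add: aN per reps_periodic[OF M])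
    show "arr N i \<in> carrier_mat (vdim N (i + 1)) (vdim N i)" by (simp add: aN carrier_matI)
    show "path_map N i (n - 1) = 0\<^sub>m (vdim N (i + int (n - 1))) (vdim N i)"
      unfolding pN by (simp add: path_map_long[OF M] mat_alg)
  qed
  have "biproduct n M S N s j r q"
    unfolding biproduct_def
    using s r rs qj sum1 hq hj per by (auto intro!: homI)
  then show ?thesis using N le by (intro bexI[of _ N]) (auto intro!: exI)
qed

lemma decompose_string:
  assumes M: "M \<in> reps n" and nz: "\<not> is_zero M"
  shows "\<exists>a b N. a < b \<and> b < a + int n \<and> N \<in> reps n \<and> (\<exists>s1 s2 r1 r2. biproduct n M (string_rep n a b) N s1 s2 r1 r2) \<and>
    (\<Sum>i<n. vdim N (int i)) < (\<Sum>i<n. vdim M (int i))"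
proof -
  obtain a b s r where ab: "a < b" "b < a + int n" and s: "is_hom n (string_rep n a b) M s"
    and r: "is_hom n M (string_rep n a b) r" and rs: "\<And>i. r i * s i = 1\<^sub>m (vdim (string_rep n a b) i)"
    using string_retract[OF assms] by blast
  note S = string_in_reps[OF ab]
  have thin: "vdim (string_rep n a b) i \<le> 1" for i by (simp add: vdim_string[OF ab])
  obtain N where N: "N \<in> reps n" "\<exists>j q. biproduct n M (string_rep n a b) N s j r q"
    and dim: "\<forall>i. vdim M i = vdim (string_rep n a b) i + vdim N i"
    using thin_retract_complement[OF M S thin s r rs] by blast
  have n: "0 < n" using ab by simp
  have "vdim (string_rep n a b) (a mod int n) = vdim (string_rep n a b) a"
    by (rule periodic_cong[of _ n]) (simp_all add: reps_periodic[OF S])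
  then have "vdim (string_rep n a b) (int (nat (a mod int n))) = 1" "nat (a mod int n) < n"
    using ab n by (simp_all add: vdim_string[OF ab] nat_less_iff)
  then have "0 < (\<Sum>i<n. vdim (string_rep n a b) (int i))"
    by (metis finite_lessThan lessThan_iff less_one sum_eq_0_iff not_gr_zero)
  then show ?thesis using ab N by (intro exI[of _ a] exI[of _ b] exI[of _ N]) (auto simp: dim sum.distrib)
qed

text \<open>Splitting off strings lowers the total dimension. The resulting induction rule says that every
  representation is a finite direct sum of strings, and it is in this form that the decomposition is
  used.\<close>

lemma reps_induct [consumes 1, case_names zero sum]:
  assumes "M \<in> reps n"
    and zero: "\<And>M. M \<in> reps n \<Longrightarrow> is_zero M \<Longrightarrow> P M"
    and sum: "\<And>M N a b s1 s2 r1 r2. M \<in> reps n \<Longrightarrow> N \<in> reps n \<Longrightarrow> a < b \<Longrightarrow> b < a + int n \<Longrightarrow>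
      biproduct n M (string_rep n a b) N s1 s2 r1 r2 \<Longrightarrow> P N \<Longrightarrow> P M"
  shows "P M"
  using assms(1)
proof (induction "\<Sum>i<n. vdim M (int i)" arbitrary: M rule: less_induct)
  case less
  show ?case
  proof (cases "is_zero M")
    case True
    then show ?thesis using zero less by blast
  next
    case False
    then show ?thesis using decompose_string[OF less(2)] sum[OF less(2)] less(1) by meson
  qed
qed

section \<open>Torsion functions\<close>

text \<open>A torsion class is recorded by the function that sends \<open>a\<close> to the largest \<open>b\<close> such that the
  string from \<open>a\<close> to \<open>b\<close> belongs to the class, or to \<open>a\<close> itself if there is none. The last
  condition expresses closure under extensions: unless \<open>e a\<close> has its largest possible value, a string
  that starts between \<open>a\<close> and \<open>e a\<close> and ends after \<open>e a\<close> would prolong the string from \<open>a\<close>.\<close>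

definition torsion_fun :: "nat \<Rightarrow> (int \<Rightarrow> int) \<Rightarrow> bool" where
  "torsion_fun n e \<longleftrightarrow>
    (\<forall>a. e (a + int n) = e a + int n \<and> a \<le> e a \<and> e a \<le> a + int n - 1) \<and>
    (\<forall>a b. a < b \<and> b \<le> e a \<and> e a < a + int n - 1 \<longrightarrow> e b \<le> e a)"

text \<open>The pairs for which the string from \<open>a\<close> to \<open>d\<close> is Ext-projective in the torsion class of \<open>e\<close>.\<close>

definition projective_pair :: "nat \<Rightarrow> (int \<Rightarrow> int) \<Rightarrow> int \<Rightarrow> int \<Rightarrow> bool" where
  "projective_pair n e a d \<longleftrightarrow> a < d \<and> d \<le> e a \<and> (d = a + int n - 1 \<or> (\<forall>b. a < b \<and> b \<le> d \<longrightarrow> e b \<le> d))"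

text \<open>For the function of a torsion class these are the vertices outside the support of the class.\<close>

definition uncovered :: "(int \<Rightarrow> int) \<Rightarrow> int \<Rightarrow> bool" where
  "uncovered e d \<longleftrightarrow> (\<forall>c\<le>d. e c \<le> d)"

definition arcs :: "nat \<Rightarrow> (int \<Rightarrow> int) \<Rightarrow> tagged_arc set" where
  "arcs n e = {arc_a n a d | a d. projective_pair n e a d} \<union> {arc_r n d | d. uncovered e d}"

lemma torsion_funD:
  assumes "torsion_fun n e"
  shows "a \<le> e a" "e a \<le> a + int n - 1" "a < b \<Longrightarrow> b \<le> e a \<Longrightarrow> e a < a + int n - 1 \<Longrightarrow> e b \<le> e a"
  using assms unfolding torsion_fun_def by auto

lemma torsion_fun_pos: "torsion_fun n e \<Longrightarrow> 0 < n"
  using torsion_funD(1,2)[of n e 0] by (cases n) auto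

lemma torsion_fun_shift:
  assumes "torsion_fun n e"
  shows "e (a + int n * t) = e a + int n * t"
proof (induction t rule: int_induct[of _ 0])
  case (step1 t)
  have "e (a + int n * t + int n) = e (a + int n * t) + int n"
    using assms unfolding torsion_fun_def by blast
  moreover have "a + int n * t + int n = a + int n * (t + 1)" by (simp add: algebra_simps)
  ultimately show ?case using step1 by (simp add: algebra_simps)
next
  case (step2 t)
  have "e (a + int n * (t - 1) + int n) = e (a + int n * (t - 1)) + int n"
    using assms unfolding torsion_fun_def by blast
  moreover have "a + int n * (t - 1) + int n = a + int n * t" by (simp add: algebra_simps)
  ultimately show ?case using step2 by (simp add: algebra_simps)
qed simp

lemma mod_eq_shift:
  assumes "(x :: int) mod int n = y mod int n"
  obtains t where "x = y + int n * t"
proof -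
  have "int n dvd x - y" using assms by (simp add: mod_eq_dvd_iff)
  then obtain t where "x - y = int n * t" by blast
  then show ?thesis using that[of t] by simp
qed

lemma projective_pair_shift:
  assumes e: "torsion_fun n e"
  shows "projective_pair n e (a + int n * t) (d + int n * t) \<longleftrightarrow> projective_pair n e a d"
proof -
  have imp: "projective_pair n e a d \<Longrightarrow> projective_pair n e (a + int n * t) (d + int n * t)" for a d t
  proof -
    assume p: "projective_pair n e a d"
    have "e b \<le> d + int n * t" if "\<forall>b. a < b \<and> b \<le> d \<longrightarrow> e b \<le> d" "a + int n * t < b" "b \<le> d + int n * t" for b
    proof -
      have "e (b + int n * (- t)) \<le> d" using that by (intro that(1)[rule_format]) auto
      then show ?thesis unfolding torsion_fun_shift[OF e] by simp
    qed
    then show ?thesis using p unfolding projective_pair_def by (auto simp: torsion_fun_shift[OF e])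
  qed
  show ?thesis using imp[of a d t] imp[of "a + int n * t" "d + int n * t" "- t"] by auto
qed

lemma uncovered_shift:
  assumes e: "torsion_fun n e"
  shows "uncovered e (d + int n * t) \<longleftrightarrow> uncovered e d"
proof -
  have imp: "uncovered e d \<Longrightarrow> uncovered e (d + int n * t)" for d t
    unfolding uncovered_def
  proof (intro allI impI)
    fix c assume u: "\<forall>c\<le>d. e c \<le> d" and c: "c \<le> d + int n * t"
    have "e (c + int n * (- t)) \<le> d" using c by (intro u[rule_format]) auto
    then show "e c \<le> d + int n * t" unfolding torsion_fun_shift[OF e] by simp
  qed
  show ?thesis using imp[of d t] imp[of "d + int n * t" "- t"] by auto
qed

lemma arc_a_eq_iff:
  assumes "a < d" "d \<le> a + int n - 1" "a' < d'" "d' \<le> a' + int n - 1"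
  shows "arc_a n a d = arc_a n a' d' \<longleftrightarrow> (\<exists>t. a' = a + int n * t \<and> d' = d + int n * t)"
proof
  assume eq: "arc_a n a d = arc_a n a' d'"
  then have "a' mod int n = a mod int n" by (auto simp: arc_a_def split: if_splits)
  then obtain t where t: "a' = a + int n * t" by (rule mod_eq_shift)
  have "d' = d + int n * t"
  proof (cases "d = a + int n - 1")
    case True
    then show ?thesis using eq t by (auto simp: arc_a_def split: if_splits)
  next
    case False
    then have "(d' + 1) mod int n = (d + 1) mod int n" using eq by (auto simp: arc_a_def split: if_splits)
    then obtain s where s: "d' + 1 = d + 1 + int n * s" by (rule mod_eq_shift)
    then have d': "d' - a' = d - a + int n * (s - t)" using t by (simp add: algebra_simps)
    \<comment> \<open>Both pairs have a length below \<open>n\<close>, so their ends agree modulo \<open>n\<close> only if the same shift moves both.\<close>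
    have "s - t = 0"
    proof (rule ccontr)
      assume "s - t \<noteq> 0"
      then have "s - t \<ge> 1 \<or> s - t \<le> -1" by linarith
      then have "int n * (s - t) \<ge> int n * 1 \<or> int n * (s - t) \<le> int n * (-1)"
        by (meson mult_left_mono of_nat_0_le_iff)
      then show False using assms d' by linarith
    qed
    then show ?thesis using s by simp
  qed
  then show "\<exists>t. a' = a + int n * t \<and> d' = d + int n * t" using t by blast
next
  assume "\<exists>t. a' = a + int n * t \<and> d' = d + int n * t"
  then obtain t where "a' = a + int n * t" "d' = d + int n * t" by blast
  moreover have "(d + int n * t + 1) mod int n = (d + 1) mod int n"
    using mod_mult_self2[of "d + 1" "int n" t] by (simp add: add_ac)
  ultimately show "arc_a n a d = arc_a n a' d'" by (simp add: arc_a_def)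
qed

lemma arc_a_shift: "arc_a n (a + int n * t) (d + int n * t) = arc_a n a d"
proof -
  have "(d + int n * t + 1) mod int n = (d + 1) mod int n"
    using mod_mult_self2[of "d + 1" "int n" t] by (simp add: add_ac)
  then show ?thesis by (simp add: arc_a_def)
qed

lemma arc_r_eq_iff: "arc_r n d = arc_r n d' \<longleftrightarrow> (\<exists>t. d' = d + int n * t)"
proof
  assume "arc_r n d = arc_r n d'"
  then have "(d' + 1) mod int n = (d + 1) mod int n" by (simp add: arc_r_def)
  then obtain s where "d' + 1 = d + 1 + int n * s" by (rule mod_eq_shift)
  then show "\<exists>t. d' = d + int n * t" by auto
next
  assume "\<exists>t. d' = d + int n * t"
  then obtain t where "d' = d + int n * t" by blast
  then show "arc_r n d = arc_r n d'"
    using mod_mult_self2[of "d + 1" "int n" t] by (simp add: arc_r_def add_ac)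
qed

lemma arc_a_neq_arc_r [simp]: "arc_a n a d \<noteq> arc_r n x" "arc_r n x \<noteq> arc_a n a d"
  by (auto simp: arc_a_def arc_r_def)

lemma projective_pair_bounds:
  "torsion_fun n e \<Longrightarrow> projective_pair n e a d \<Longrightarrow> a < d \<and> d \<le> a + int n - 1"
  using torsion_funD(2)[of n e a] unfolding projective_pair_def by auto

lemma arc_a_in_arcs:
  assumes e: "torsion_fun n e" and "a < d" "d \<le> a + int n - 1"
  shows "arc_a n a d \<in> arcs n e \<longleftrightarrow> projective_pair n e a d"
proof
  assume "arc_a n a d \<in> arcs n e"
  then obtain a' d' where p: "projective_pair n e a' d'" "arc_a n a d = arc_a n a' d'"
    unfolding arcs_def by auto
  then obtain t where "a' = a + int n * t" "d' = d + int n * t"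
    using arc_a_eq_iff[of a d n a' d'] projective_pair_bounds[OF e p(1)] assms by auto
  then show "projective_pair n e a d" using p projective_pair_shift[OF e] by auto
qed (auto simp: arcs_def)

lemma arc_r_in_arcs:
  assumes e: "torsion_fun n e"
  shows "arc_r n d \<in> arcs n e \<longleftrightarrow> uncovered e d"
proof
  assume "arc_r n d \<in> arcs n e"
  then obtain d' where "uncovered e d'" "arc_r n d = arc_r n d'" unfolding arcs_def by auto
  then show "uncovered e d" using arc_r_eq_iff[of n d d'] uncovered_shift[OF e] by auto
qed (auto simp: arcs_def)

text \<open>For \<open>d = e a\<close> the condition on the values between \<open>a\<close> and \<open>d\<close> holds for every torsion
  function. If \<open>d < e a\<close>, then \<open>d\<close> differs from \<open>a + n - 1\<close>, and the condition at \<open>d\<close> itself makes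
  \<open>d\<close> a fixed point.\<close>

lemma projective_pair_iff:
  assumes e: "torsion_fun n e"
  shows "projective_pair n e a d \<longleftrightarrow> a < d \<and> (d = e a \<or>
    e d = d \<and> d < e a \<and> (\<forall>u. a < u \<and> u < d \<longrightarrow> e u \<le> d))"
proof
  assume p: "projective_pair n e a d"
  show "a < d \<and> (d = e a \<or> e d = d \<and> d < e a \<and> (\<forall>u. a < u \<and> u < d \<longrightarrow> e u \<le> d))"
  proof (cases "d = e a")
    case False
    then have "d < e a" "d \<noteq> a + int n - 1" using p torsion_funD(2)[OF e, of a] unfolding projective_pair_def by auto
    then have "\<forall>b. a < b \<and> b \<le> d \<longrightarrow> e b \<le> d" "a < d" using p unfolding projective_pair_def by auto
    then show ?thesis using \<open>d < e a\<close> torsion_funD(1)[OF e, of d] by force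
  qed (use p in \<open>auto simp: projective_pair_def\<close>)
next
  assume *: "a < d \<and> (d = e a \<or> e d = d \<and> d < e a \<and> (\<forall>u. a < u \<and> u < d \<longrightarrow> e u \<le> d))"
  show "projective_pair n e a d"
  proof (cases "d = e a")
    case True
    then show ?thesis
      using * torsion_funD(2)[OF e, of a] torsion_funD(3)[OF e, of a] unfolding projective_pair_def by force
  next
    case False
    then have "e b \<le> d" if "a < b" "b \<le> d" for b using * that by (cases "b = d") auto
    then show ?thesis using * False unfolding projective_pair_def by auto
  qed
qed

text \<open>The arc that the vertex \<open>v\<close> contributes. The three cases exclude each other and one of them
  always holds, so this relation is a bijection from residues to arcs.\<close>

definition vertex_arc :: "nat \<Rightarrow> (int \<Rightarrow> int) \<Rightarrow> int \<Rightarrow> tagged_arc \<Rightarrow> bool" where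
  "vertex_arc n e v A \<longleftrightarrow> (v < e v \<and> A = arc_a n v (e v)) \<or>
    (e v = v \<and> uncovered e v \<and> A = arc_r n v) \<or>
    (\<exists>a<v. e v = v \<and> v < e a \<and> (\<forall>u. a < u \<and> u < v \<longrightarrow> e u \<le> v) \<and> A = arc_a n a v)"

lemma vertex_arc_in_arcs: "torsion_fun n e \<Longrightarrow> vertex_arc n e v A \<Longrightarrow> A \<in> arcs n e"
  unfolding vertex_arc_def arcs_def by (auto simp: projective_pair_iff)

lemma vertex_arc_exists:
  assumes e: "torsion_fun n e"
  shows "\<exists>A. vertex_arc n e v A"
proof (cases "v < e v \<or> uncovered e v")
  case True
  then show ?thesis
    using torsion_funD(1)[OF e, of v] unfolding vertex_arc_def uncovered_def by (metis order.order_iff_strict order_refl)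
next
  case False
  then have v: "e v = v" using torsion_funD(1)[OF e, of v] by auto
  define U where "U = {u. u < v \<and> v < e u}"
  have "U \<subseteq> {v - int n..v}"
  proof
    fix u assume "u \<in> U"
    then show "u \<in> {v - int n..v}" using torsion_funD(2)[OF e, of u] unfolding U_def by auto
  qed
  then have fin: "finite U" by (rule finite_subset) simp
  have ne: "U \<noteq> {}" using False v unfolding uncovered_def U_def by (auto simp: not_le order.order_iff_strict)
  define a where "a = Max U"
  have "a \<in> U" using Max_in[OF fin ne] unfolding a_def .
  moreover have "e u \<le> v" if "a < u" "u < v" for u
  proof (rule ccontr)
    assume "\<not> e u \<le> v"
    then have "u \<in> U" using that(2) unfolding U_def by auto
    then have "u \<le> a" using fin unfolding a_def by (rule Max_ge[rotated])
    then show False using that(1) by simp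
  qed
  ultimately show ?thesis using v unfolding vertex_arc_def U_def by blast
qed

lemma vertex_arc_unique:
  assumes e: "torsion_fun n e" and A: "vertex_arc n e v A" and B: "vertex_arc n e v B"
  shows "A = B"
proof -
  have cov: "\<not> uncovered e v" if "a < v" "v < e a" for a
    using that unfolding uncovered_def by (auto intro!: exI[of _ a])
  have "a = b" if "a < v" "v < e a" "\<forall>u. a < u \<and> u < v \<longrightarrow> e u \<le> v"
    "b < v" "v < e b" "\<forall>u. b < u \<and> u < v \<longrightarrow> e u \<le> v" for a b
    using that by (metis linorder_not_le linorder_neqE)
  then show ?thesis using A B cov unfolding vertex_arc_def by (metis order_less_irrefl)
qed

text \<open>An arc for \<open>(v, e v)\<close> cannot coincide with an arc that ends at a fixed point \<open>w\<close>, because the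
  latter starts at a point whose value exceeds \<open>w\<close>.\<close>

lemma vertex_arc_inj:
  assumes e: "torsion_fun n e" and A: "vertex_arc n e v A" "vertex_arc n e w A"
  shows "v mod int n = w mod int n"
proof -
  have start: "False" if "v < e v" "a < w" "e w = w" "w < e a" "arc_a n v (e v) = arc_a n a w" for v w a
  proof -
    have "w \<le> a + int n - 1" using that torsion_funD(2)[OF e, of a] by simp
    then have "\<exists>t. a = v + int n * t \<and> w = e v + int n * t"
      using that torsion_funD(2)[OF e, of v] by (intro iffD1[OF arc_a_eq_iff]) auto
    then obtain t where "a = v + int n * t" "w = e v + int n * t" by blast
    then show False using that torsion_fun_shift[OF e, of v t] by simp
  qed
  have both1: "v mod int n = w mod int n" if "v < e v" "w < e w" "arc_a n v (e v) = arc_a n w (e w)"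
    using that by (auto simp: arc_a_def split: if_splits)
  have both2: "v mod int n = w mod int n" if "a < v" "v < e a" "b < w" "w < e b" "arc_a n a v = arc_a n b w" for a b
  proof -
    have "v \<le> a + int n - 1" "w \<le> b + int n - 1"
      using that torsion_funD(2)[OF e, of a] torsion_funD(2)[OF e, of b] by auto
    then have "\<exists>t. b = a + int n * t \<and> w = v + int n * t"
      using that by (intro iffD1[OF arc_a_eq_iff]) auto
    then show ?thesis by auto
  qed
  have both3: "v mod int n = w mod int n" if "arc_r n v = arc_r n w"
    using that unfolding arc_r_eq_iff by auto
  show ?thesis
    using A start[of v _ w] start[of w _ v] both1 both2 both3 unfolding vertex_arc_def
    by (elim disjE conjE exE) (auto, metis+)
qed

lemma arcs_vertex_arc:
  assumes e: "torsion_fun n e" and A: "A \<in> arcs n e"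
  shows "\<exists>v. 0 \<le> v \<and> v < int n \<and> vertex_arc n e v A"
proof -
  have n: "0 < n" by (rule torsion_fun_pos[OF e])
  have "\<exists>v. vertex_arc n e v A"
    using A unfolding arcs_def
  proof
    assume "A \<in> {arc_a n a d | a d. projective_pair n e a d}"
    then obtain a d where "A = arc_a n a d" "projective_pair n e a d" by blast
    then show ?thesis unfolding projective_pair_iff[OF e] vertex_arc_def by blast
  next
    assume "A \<in> {arc_r n d | d. uncovered e d}"
    then obtain d where d: "A = arc_r n d" "uncovered e d" by blast
    then have "e d = d" using torsion_funD(1)[OF e, of d] unfolding uncovered_def by (simp add: order_antisym)
    then show ?thesis using d unfolding vertex_arc_def by blast
  qed
  then obtain v where v: "vertex_arc n e v A" by blast
  obtain B where B: "vertex_arc n e (v mod int n) B" using vertex_arc_exists[OF e] by blast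
  define t where "t = v div int n"
  have vt: "v = v mod int n + int n * t" by (simp add: t_def)
  have "vertex_arc n e (v mod int n + int n * t) B"
    using B[unfolded vertex_arc_def]
  proof (elim disjE exE conjE)
    assume "v mod int n < e (v mod int n)" "B = arc_a n (v mod int n) (e (v mod int n))"
    then show ?thesis unfolding vertex_arc_def by (simp add: torsion_fun_shift[OF e] arc_a_shift)
  next
    assume "e (v mod int n) = v mod int n" "uncovered e (v mod int n)" "B = arc_r n (v mod int n)"
    moreover have "arc_r n (v mod int n) = arc_r n (v mod int n + int n * t)" using arc_r_eq_iff by blast
    ultimately show ?thesis
      unfolding vertex_arc_def torsion_fun_shift[OF e] uncovered_shift[OF e] by simp
  next
    fix a assume a: "a < v mod int n" "e (v mod int n) = v mod int n" "v mod int n < e a"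
      "\<forall>u. a < u \<and> u < v mod int n \<longrightarrow> e u \<le> v mod int n" "B = arc_a n a (v mod int n)"
    have "e u \<le> v mod int n + int n * t" if "a + int n * t < u" "u < v mod int n + int n * t" for u
    proof -
      have "e (u + int n * (- t)) \<le> v mod int n" using that by (intro a(4)[rule_format]) auto
      then show ?thesis unfolding torsion_fun_shift[OF e] by simp
    qed
    then show ?thesis
      unfolding vertex_arc_def torsion_fun_shift[OF e]
      using a by (intro disjI2 exI[of _ "a + int n * t"]) (simp add: torsion_fun_shift[OF e] arc_a_shift)
  qed
  then have "B = A" using vertex_arc_unique[OF e] v vt by metis
  then show ?thesis using B n by (intro exI[of _ "v mod int n"]) auto
qed

lemma card_arcs:
  assumes e: "torsion_fun n e"
  shows "card (arcs n e) = n" "finite (arcs n e)"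
proof -
  obtain \<alpha> where \<alpha>: "\<And>v. vertex_arc n e v (\<alpha> v)" using vertex_arc_exists[OF e] by metis
  have "arcs n e = \<alpha> ` {0..<int n}"
  proof (intro equalityI subsetI)
    fix A assume "A \<in> arcs n e"
    then obtain v where "0 \<le> v" "v < int n" "vertex_arc n e v A" using arcs_vertex_arc[OF e] by blast
    then show "A \<in> \<alpha> ` {0..<int n}" using vertex_arc_unique[OF e \<alpha>] by (metis atLeastLessThan_iff imageI)
  qed (use vertex_arc_in_arcs[OF e \<alpha>] in auto)
  moreover have "inj_on \<alpha> {0..<int n}"
  proof (rule inj_onI)
    fix v w assume vw: "v \<in> {0..<int n}" "w \<in> {0..<int n}" "\<alpha> v = \<alpha> w"
    then have "vertex_arc n e w (\<alpha> v)" using \<alpha>[of w] by simp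
    from vertex_arc_inj[OF e \<alpha> this] have "v mod int n = w mod int n" .
    then show "v = w" using vw by simp
  qed
  ultimately show "card (arcs n e) = n" "finite (arcs n e)" by (simp_all add: card_image)
qed

section \<open>Flips and covers of torsion functions\<close>

definition fun_covers :: "nat \<Rightarrow> (int \<Rightarrow> int) \<Rightarrow> (int \<Rightarrow> int) \<Rightarrow> bool" where
  "fun_covers n e e' \<longleftrightarrow> e' \<le> e \<and> e' \<noteq> e \<and>
    \<not> (\<exists>g. torsion_fun n g \<and> e' \<le> g \<and> g \<le> e \<and> g \<noteq> e \<and> g \<noteq> e')"

lemma arc_lost:
  assumes e: "torsion_fun n e" and e': "torsion_fun n e'" and lt: "e' a < e a"
  shows "arc_a n a (e a) \<in> arcs n e - arcs n e'"
proof -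
  have b: "a < e a" "e a \<le> a + int n - 1" using lt torsion_funD(1)[OF e', of a] torsion_funD(2)[OF e, of a] by auto
  have "projective_pair n e a (e a)" using b projective_pair_iff[OF e] by auto
  moreover have "\<not> projective_pair n e' a (e a)" using lt unfolding projective_pair_def by auto
  ultimately show ?thesis using arc_a_in_arcs[OF e b] arc_a_in_arcs[OF e' b] by auto
qed

text \<open>The new arc is the one at the fixed point \<open>d = e' a\<close> of \<open>e'\<close>. If it were the arc of a pair
  \<open>(y, d)\<close> of \<open>e\<close>, then \<open>e a > d\<close> would exclude \<open>y < a\<close>, and \<open>e' y > d\<close> would exclude \<open>a \<le> y\<close>
  because \<open>e'\<close> does not exceed \<open>d\<close> between \<open>a\<close> and \<open>d\<close>.\<close>

lemma arc_gained:
  assumes e: "torsion_fun n e" and e': "torsion_fun n e'" and lt: "e' a < e a"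
  shows "\<exists>A\<in>arcs n e' - arcs n e. \<forall>v. v < e' v \<longrightarrow> A \<noteq> arc_a n v (e' v)"
proof -
  define d where "d = e' a"
  have ad: "a \<le> d" "d < e a" "d < a + int n - 1"
    using torsion_funD(1)[OF e', of a] torsion_funD(2)[OF e, of a] lt by (auto simp: d_def)
  have below: "e' b \<le> d" if "a \<le> b" "b \<le> d" for b
    using that torsion_funD(3)[OF e', of a b] ad by (cases "a = b") (auto simp: d_def)
  have d: "e' d = d" using below[of d] ad torsion_funD(1)[OF e', of d] by simp
  obtain A where A: "vertex_arc n e' d A" using vertex_arc_exists[OF e'] by blast
  then consider "A = arc_r n d" "uncovered e' d" |
    y where "y < d" "d < e' y" "\<forall>u. y < u \<and> u < d \<longrightarrow> e' u \<le> d" "A = arc_a n y d"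
    using d unfolding vertex_arc_def by auto
  then show ?thesis
  proof cases
    case 1
    have "\<not> uncovered e d" using ad unfolding uncovered_def by (auto intro!: exI[of _ a])
    then have "A \<notin> arcs n e" unfolding 1 arc_r_in_arcs[OF e] .
    moreover have "A \<noteq> arc_a n v (e' v)" for v using 1 by simp
    ultimately show ?thesis using vertex_arc_in_arcs[OF e' A] by blast
  next
    case (2 y)
    have yb: "d < y + int n - 1" using 2 torsion_funD(2)[OF e', of y] by simp
    have "A \<notin> arcs n e"
    proof
      assume "A \<in> arcs n e"
      then have p: "projective_pair n e y d" using 2 yb arc_a_in_arcs[OF e, of y d] by simp
      then have small: "e b \<le> d" if "y < b" "b \<le> d" for b using that yb unfolding projective_pair_def by auto
      consider "y < a" | "a \<le> y" by linarith
      then show False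
      proof cases
        case 1
        then show False using small[of a] ad by simp
      next
        assume "a \<le> y"
        then show False using below[of y] 2 by simp
      qed
    qed
    moreover have "A \<noteq> arc_a n v (e' v)" if v: "v < e' v" for v
    proof
      assume "A = arc_a n v (e' v)"
      then have "arc_a n v (e' v) = arc_a n y d" using 2 by simp
      then have "\<exists>t. y = v + int n * t \<and> d = e' v + int n * t"
        using v 2 yb torsion_funD(2)[OF e', of v] by (intro iffD1[OF arc_a_eq_iff]) auto
      then show False using torsion_fun_shift[OF e', of v] 2 by auto
    qed
    ultimately show ?thesis using vertex_arc_in_arcs[OF e' A] by auto
  qed
qed

lemma fun_covers_if_flip:
  assumes e: "torsion_fun n e" and e': "torsion_fun n e'" and lt: "e' a < e a"
    and flip: "card (arcs n e - arcs n e') = 1" "card (arcs n e' - arcs n e) = 1"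
  shows "fun_covers n e e'"
proof -
  have uniq: "A = B" if "A \<in> arcs n e - arcs n e'" "B \<in> arcs n e - arcs n e'" for A B
    using flip(1) that by (metis card_1_singletonE singletonD)
  have uniq': "A = B" if "A \<in> arcs n e' - arcs n e" "B \<in> arcs n e' - arcs n e" for A B
    using flip(2) that by (metis card_1_singletonE singletonD)
  have le: "e' \<le> e"
  proof (rule le_funI, rule ccontr)
    fix v assume "\<not> e' v \<le> e v"
    then have v: "e v < e' v" by simp
    obtain A where A: "A \<in> arcs n e' - arcs n e" "\<forall>v. v < e' v \<longrightarrow> A \<noteq> arc_a n v (e' v)"
      using arc_gained[OF e e' lt] by blast
    have "v < e' v" using v torsion_funD(1)[OF e, of v] by simp
    then show False using A(2) uniq'[OF A(1) arc_lost[OF e' e v]] by blast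
  qed
  have ab: "a < e a" "e a \<le> a + int n - 1" using lt torsion_funD(1)[OF e', of a] torsion_funD(2)[OF e, of a] by auto
  have only: "\<exists>t. b = a + int n * t" if "e' b < e b" for b
  proof -
    have "arc_a n a (e a) = arc_a n b (e b)"
      by (rule uniq[OF arc_lost[OF e e' lt] arc_lost[OF e e' that]])
    then have "\<exists>t. b = a + int n * t \<and> e b = e a + int n * t"
      using ab that torsion_funD(1)[OF e', of b] torsion_funD(2)[OF e, of b]
      by (intro iffD1[OF arc_a_eq_iff]) auto
    then show ?thesis by blast
  qed
  \<comment> \<open>A function strictly between agrees with \<open>e\<close> off the residue of \<open>a\<close>, and then \<open>(a, g a)\<close> is a second
    pair of \<open>e\<close> that is not a pair of \<open>e'\<close>.\<close>
  have False if g: "torsion_fun n g" "e' \<le> g" "g \<le> e" "g \<noteq> e" "g \<noteq> e'" for g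
  proof -
    have same: "g v = h v" if "g a = h a" "h = e \<or> h = e'" "torsion_fun n h" for h v
    proof (cases "\<exists>t. v = a + int n * t")
      case True
      then show ?thesis using that torsion_fun_shift[OF g(1)] torsion_fun_shift[OF that(3)] by auto
    next
      case False
      then have "e' v = e v" using only[of v] le by (metis le_funD order.order_iff_strict)
      then show ?thesis using that(2) g(2,3) by (metis le_funD order_antisym)
    qed
    have "g a \<noteq> e a" using same[of e] e g(4) by auto
    moreover have "g a \<noteq> e' a" using same[of e'] e' g(5) by auto
    ultimately have ga: "e' a < g a" "g a < e a"
      using g(2,3) by (auto simp: le_fun_def order.order_iff_strict)
    have "e b \<le> g a" if b: "a < b" "b \<le> g a" for b
    proof -
      \<comment> \<open>The interval from \<open>a + 1\<close> to \<open>g a\<close> is too short to meet the residue of \<open>a\<close>.\<close>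
      have "b \<noteq> a + int n * t" for t
      proof
        assume bt: "b = a + int n * t"
        have "0 < int n * t" using b bt by linarith
        then have "1 \<le> t" by (simp add: zero_less_mult_iff)
        then have "int n * 1 \<le> int n * t" by (intro mult_left_mono) auto
        then show False using bt b ga ab by linarith
      qed
      then have "e' b = e b" using only[of b] le by (metis le_funD order.order_iff_strict)
      then have "e b = g b" using g(2,3) by (metis le_funD order_antisym)
      then show ?thesis using torsion_funD(3)[OF g(1) b] ga ab by simp
    qed
    then have "projective_pair n e a (g a)"
      using ga torsion_funD(1)[OF e', of a] unfolding projective_pair_def by auto
    moreover have "\<not> projective_pair n e' a (g a)" using ga unfolding projective_pair_def by auto
    moreover have gb: "a < g a" "g a \<le> a + int n - 1" using ga ab torsion_funD(1)[OF e', of a] by auto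
    ultimately have "arc_a n a (g a) \<in> arcs n e - arcs n e'"
      using arc_a_in_arcs[OF e gb] arc_a_in_arcs[OF e' gb] by auto
    then have "arc_a n a (e a) = arc_a n a (g a)" by (rule uniq[OF arc_lost[OF e e' lt]])
    then have "\<exists>t. a = a + int n * t \<and> g a = e a + int n * t"
      using ab gb by (intro iffD1[OF arc_a_eq_iff]) auto
    then show False using ga by auto
  qed
  then show ?thesis using le lt unfolding fun_covers_def by blast
qed

text \<open>The function \<open>e\<close> with its value at \<open>a\<close>, and accordingly at all translates of \<open>a\<close>, changed to \<open>d\<close>.\<close>

definition lower :: "nat \<Rightarrow> (int \<Rightarrow> int) \<Rightarrow> int \<Rightarrow> int \<Rightarrow> int \<Rightarrow> int" where
  "lower n e a d v = (if v mod int n = a mod int n then v + (d - a) else e v)"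

lemma lower_torsion_fun:
  assumes e: "torsion_fun n e" and d: "a \<le> d" "d \<le> e a" and small: "\<And>b. a < b \<Longrightarrow> b \<le> d \<Longrightarrow> e b \<le> d"
  shows "torsion_fun n (lower n e a d)" "lower n e a d \<le> e"
proof -
  have da: "d - a \<le> int n - 1" using d torsion_funD(2)[OF e, of a] by simp
  show le: "lower n e a d \<le> e"
  proof (rule le_funI)
    fix v
    show "lower n e a d v \<le> e v"
    proof (cases "v mod int n = a mod int n")
      case True
      then obtain t where "v = a + int n * t" by (rule mod_eq_shift)
      then show ?thesis using d by (simp add: lower_def torsion_fun_shift[OF e])
    qed (simp add: lower_def)
  qed
  show "torsion_fun n (lower n e a d)"
    unfolding torsion_fun_def
  proof (intro conjI allI impI)
    fix v
    show "lower n e a d (v + int n) = lower n e a d v + int n"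
      using torsion_fun_shift[OF e, of v 1] by (simp add: lower_def)
    show "v \<le> lower n e a d v" using d torsion_funD(1)[OF e, of v] by (simp add: lower_def)
    show "lower n e a d v \<le> v + int n - 1" using le_funD[OF le, of v] torsion_funD(2)[OF e, of v] by simp
  next
    fix v b assume vb: "v < b \<and> b \<le> lower n e a d v \<and> lower n e a d v < v + int n - 1"
    show "lower n e a d b \<le> lower n e a d v"
    proof (cases "v mod int n = a mod int n")
      case True
      then obtain t where t: "v = a + int n * t" by (rule mod_eq_shift)
      have "e (b + int n * (- t)) \<le> d" using vb True t by (intro small) (auto simp: lower_def)
      then have "e b \<le> lower n e a d v" using t True torsion_fun_shift[OF e, of b "- t"] by (simp add: lower_def)
      then show ?thesis using le_funD[OF le, of b] by simp
    next
      case False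
      then show ?thesis using vb torsion_funD(3)[OF e, of v b] le_funD[OF le, of b] by (simp add: lower_def)
    qed
  qed
qed

lemma lower_self: "lower n e a d a = d" by (simp add: lower_def)

lemma lower_ge:
  assumes e': "torsion_fun n e'" and "e' \<le> e" "e' a \<le> d"
  shows "e' \<le> lower n e a d"
proof (rule le_funI)
  fix v
  show "e' v \<le> lower n e a d v"
  proof (cases "v mod int n = a mod int n")
    case True
    then obtain t where "v = a + int n * t" by (rule mod_eq_shift)
    then show ?thesis using assms(3) torsion_fun_shift[OF e', of a t] by (simp add: lower_def)
  qed (use assms(2) in \<open>simp add: lower_def le_fun_def\<close>)
qed

text \<open>Lowering at a single residue suffices to go from \<open>e\<close> to \<open>e'\<close>. A pair of \<open>e\<close> that is no pair of
  \<open>e'\<close> must then start at this residue, say at \<open>a\<close>, and end after \<open>e' a\<close>; it ends at \<open>e a\<close>, since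
  lowering \<open>e\<close> to an earlier end would give a torsion function strictly between.\<close>

lemma flip_if_fun_covers:
  assumes e: "torsion_fun n e" and e': "torsion_fun n e'" and cov: "fun_covers n e e'"
  shows "card (arcs n e - arcs n e') = 1"
proof -
  have le: "e' \<le> e" and ne: "e' \<noteq> e" using cov unfolding fun_covers_def by auto
  have between: "g = e \<or> g = e'" if "torsion_fun n g" "e' \<le> g" "g \<le> e" for g
    using cov that unfolding fun_covers_def by blast
  have "\<exists>a. e' a < e a" using le ne by (metis ext le_funD order.order_iff_strict)
  then obtain a where a: "e' a < e a" and min: "\<And>b. e' b < e b \<Longrightarrow> nat (e' a - a) \<le> nat (e' b - b)"
    using ex_has_least_nat[of "\<lambda>a. e' a < e a" _ "\<lambda>a. nat (e' a - a)"] by blast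
  define d where "d = e' a"
  have d: "a \<le> d" "d < e a" "d < a + int n - 1"
    using a torsion_funD(1)[OF e', of a] torsion_funD(2)[OF e, of a] by (auto simp: d_def)
  \<comment> \<open>A violating \<open>b\<close> would be another point where the value drops, with a smaller remaining length.\<close>
  have small: "e b \<le> d" if b: "a < b" "b \<le> d" for b
  proof (rule ccontr)
    assume "\<not> e b \<le> d"
    moreover have "e' b \<le> d" using torsion_funD(3)[OF e', of a b] b d by (simp add: d_def)
    ultimately have "e' b < e b" by simp
    from min[OF this] show False
      using b \<open>e' b \<le> d\<close> torsion_funD(1)[OF e', of b] by (simp add: d_def)
  qed
  have "lower n e a d = e \<or> lower n e a d = e'"
    using lower_torsion_fun[OF e d(1) _ small] lower_ge[OF e' le, of a d] d
    by (intro between) (auto simp: d_def)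
  then have e'_eq: "e' = lower n e a d" using lower_self[of n e a d] d by auto
  have "arcs n e - arcs n e' \<subseteq> {arc_a n a (e a)}"
  proof
    fix A assume A: "A \<in> arcs n e - arcs n e'"
    then have "\<not> (\<exists>x. A = arc_r n x)"
      using arc_r_in_arcs[OF e] arc_r_in_arcs[OF e'] le unfolding uncovered_def le_fun_def by (metis DiffD1 DiffD2 order_trans)
    then obtain p q where pq: "A = arc_a n p q" "projective_pair n e p q" using A unfolding arcs_def by auto
    note pqb = projective_pair_bounds[OF e pq(2)]
    have "\<not> projective_pair n e' p q" using A pq pqb arc_a_in_arcs[OF e', of p q] by auto
    then have "e' p < q"
      using pq(2) le unfolding projective_pair_def le_fun_def by (meson linorder_not_le order_trans)
    then have "e' p \<noteq> e p" using pq(2) unfolding projective_pair_def by auto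
    then have "p mod int n = a mod int n" unfolding e'_eq lower_def by (auto split: if_splits)
    then obtain t where t: "p = a + int n * t" by (rule mod_eq_shift)
    define q' where "q' = q - int n * t"
    have q: "q = q' + int n * t" by (simp add: q'_def)
    have pa: "projective_pair n e a q'" using pq(2) projective_pair_shift[OF e] unfolding t q by blast
    have q'd: "d < q'" using \<open>e' p < q\<close> torsion_fun_shift[OF e', of a t] unfolding t q by (simp add: d_def)
    have "q' = e a"
    proof (rule ccontr)
      assume "q' \<noteq> e a"
      then have q': "q' < e a" "q' \<noteq> a + int n - 1"
        using pa torsion_funD(2)[OF e, of a] unfolding projective_pair_def by auto
      then have "\<And>b. a < b \<Longrightarrow> b \<le> q' \<Longrightarrow> e b \<le> q'" using pa unfolding projective_pair_def by auto
      then have "lower n e a q' = e \<or> lower n e a q' = e'"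
        using lower_torsion_fun[OF e, of a q'] lower_ge[OF e' le, of a q'] d q' q'd
        by (intro between) (auto simp: d_def)
      then show False using lower_self[of n e a q'] q' q'd by (auto simp: d_def)
    qed
    then show "A \<in> {arc_a n a (e a)}" using pq(1) arc_a_shift unfolding t q by simp
  qed
  moreover have "arc_a n a (e a) \<in> arcs n e - arcs n e'" by (rule arc_lost[OF e e' a])
  ultimately have "arcs n e - arcs n e' = {arc_a n a (e a)}" by blast
  then show ?thesis by simp
qed

theorem flip_iff_fun_covers:
  assumes e: "torsion_fun n e" and e': "torsion_fun n e'"
  shows "card (arcs n e \<inter> arcs n e') = n - 1 \<longleftrightarrow> fun_covers n e e' \<or> fun_covers n e' e"
proof -
  have n: "0 < n" by (rule torsion_fun_pos[OF e])
  note c = card_arcs[OF e] card_arcs[OF e']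
  have diff: "card (arcs n e - arcs n e') = n - card (arcs n e \<inter> arcs n e')"
    "card (arcs n e' - arcs n e) = n - card (arcs n e \<inter> arcs n e')"
    using c card_Diff_subset_Int[of "arcs n e" "arcs n e'"] card_Diff_subset_Int[of "arcs n e'" "arcs n e"]
    by (auto simp: Int_commute)
  have "card (arcs n e \<inter> arcs n e') \<le> n" using c by (metis card_mono inf_le1)
  then have iff: "card (arcs n e \<inter> arcs n e') = n - 1 \<longleftrightarrow> card (arcs n e - arcs n e') = 1"
    using diff n by auto
  show ?thesis
  proof
    assume f: "card (arcs n e \<inter> arcs n e') = n - 1"
    then have one: "card (arcs n e - arcs n e') = 1" "card (arcs n e' - arcs n e) = 1" using diff n by auto
    have "e \<noteq> e'" using one by auto
    then obtain a where "e' a < e a \<or> e a < e' a" by (metis ext linorder_neqE)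
    then show "fun_covers n e e' \<or> fun_covers n e' e"
      using fun_covers_if_flip[OF e e' _ one] fun_covers_if_flip[OF e' e _ one(2,1)] by blast
  next
    assume "fun_covers n e e' \<or> fun_covers n e' e"
    then show "card (arcs n e \<inter> arcs n e') = n - 1"
      using flip_if_fun_covers[OF e e'] flip_if_fun_covers[OF e' e] iff diff by auto
  qed
qed

section \<open>Torsion classes and torsion functions\<close>

lemma torsion_classD:
  assumes "T \<in> ATam_Tors n"
  shows "T \<subseteq> reps n" "T \<noteq> {}"
    "M \<in> T \<Longrightarrow> N \<in> reps n \<Longrightarrow> isomorphic n M N \<Longrightarrow> N \<in> T"
    "M \<in> T \<Longrightarrow> N \<in> reps n \<Longrightarrow> is_quotient n M N \<Longrightarrow> N \<in> T"
    "A \<in> T \<Longrightarrow> B \<in> T \<Longrightarrow> E \<in> reps n \<Longrightarrow> short_exact n A f E g B \<Longrightarrow> E \<in> T"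
  using assms unfolding ATam_Tors_def torsion_class_def by blast+

lemma torsion_class_zero:
  assumes T: "T \<in> ATam_Tors n" and M: "M \<in> reps n" "is_zero M"
  shows "M \<in> T"
proof -
  obtain A where A: "A \<in> T" using torsion_classD(2)[OF T] by blast
  then have AR: "A \<in> reps n" using torsion_classD(1)[OF T] by blast
  have [simp]: "vdim M i = 0" for i using M(2) unfolding is_zero_def by blast
  have "is_hom n A M (\<lambda>i. 0\<^sub>m 0 (vdim A i))"
  proof (rule homI)
    fix i
    show "0\<^sub>m 0 (vdim A (i + 1)) * arr A i = arr M i * 0\<^sub>m 0 (vdim A i)"
      by (rule eq_matI) (simp_all add: reps_dims[OF AR] reps_dims[OF M(1)])
  qed (simp_all add: reps_periodic[OF AR])
  then have "is_quotient n A M"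
    by (rule is_quotientI[of _ _ _ _ "\<lambda>i. 0\<^sub>m (vdim A i) 0"]) (auto intro: eq_matI)
  then show ?thesis using torsion_classD(4)[OF T A M(1)] by blast
qed

text \<open>The two summands are quotients of \<open>E\<close>, and \<open>E\<close> is an extension of one by the other.\<close>

lemma torsion_class_biproduct:
  assumes T: "T \<in> ATam_Tors n" and b: "biproduct n E X M s1 s2 r1 r2"
    and R: "E \<in> reps n" "X \<in> reps n" "M \<in> reps n"
  shows "E \<in> T \<longleftrightarrow> X \<in> T \<and> M \<in> T"
proof
  note bp = biproductD[OF b]
  assume "E \<in> T"
  moreover have "is_quotient n E X" by (rule is_quotientI[OF bp(3) bp(5)]) (simp add: hom_dims[OF bp(1)])
  moreover have "is_quotient n E M" by (rule is_quotientI[OF bp(4) bp(6)]) (simp add: hom_dims[OF bp(2)])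
  ultimately show "X \<in> T \<and> M \<in> T" using torsion_classD(4)[OF T] R by blast
next
  assume "X \<in> T \<and> M \<in> T"
  then show "E \<in> T" using torsion_classD(5)[OF T _ _ R(1) biproduct_short_exact[OF b]] by blast
qed

lemma string_rep_shift:
  assumes ab: "a < b" "b < a + int n"
  shows "string_rep n (a + int n * t) (b + int n * t) = string_rep n a b"
proof (rule rep.equality)
  have ab': "a + int n * t < b + int n * t" "b + int n * t < a + int n * t + int n" using ab by auto
  have off: "(i - (a + int n * t)) mod int n = (i - a) mod int n" for i
    using mod_mult_self2[of "i - a" "int n" "- t"] by (simp add: algebra_simps)
  show v: "vdim (string_rep n (a + int n * t) (b + int n * t)) = vdim (string_rep n a b)"
    unfolding vdim_string[OF ab', abs_def] vdim_string[OF ab, abs_def] off by simp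
  show "arr (string_rep n (a + int n * t) (b + int n * t)) = arr (string_rep n a b)"
    unfolding arr_string[OF ab', abs_def] arr_string[OF ab, abs_def] off v by simp
qed simp

text \<open>The element \<open>a\<close> keeps the set nonempty and is the value if no string from \<open>a\<close> belongs to \<open>T\<close>.\<close>

definition reach :: "nat \<Rightarrow> rep set \<Rightarrow> int \<Rightarrow> int" where
  "reach n T a = Max (insert a {b. a < b \<and> b < a + int n \<and> string_rep n a b \<in> T})"

lemma finite_reach: "finite (insert a {b. a < b \<and> b < a + int n \<and> string_rep n a b \<in> T})"
  by (rule finite_subset[of _ "{a..a + int n}"]) auto

lemma string_in_torsion_class_iff:
  assumes T: "T \<in> ATam_Tors n" and ab: "a < b" "b < a + int n"
  shows "string_rep n a b \<in> T \<longleftrightarrow> b \<le> reach n T a"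
proof
  assume "string_rep n a b \<in> T"
  then show "b \<le> reach n T a" unfolding reach_def using ab by (intro Max_ge[OF finite_reach]) auto
next
  assume b: "b \<le> reach n T a"
  have "reach n T a \<in> insert a {b. a < b \<and> b < a + int n \<and> string_rep n a b \<in> T}"
    unfolding reach_def by (rule Max_in[OF finite_reach]) simp
  then have r: "reach n T a < a + int n" "string_rep n a (reach n T a) \<in> T" using b ab by auto
  then show "string_rep n a b \<in> T"
    using torsion_classD(4)[OF T r(2) string_in_reps[OF ab]] string_quotient[OF ab(1) b] by blast
qed

lemma reach_bounds:
  assumes "0 < n"
  shows "a \<le> reach n T a" "reach n T a \<le> a + int n - 1"
proof -
  show "a \<le> reach n T a" unfolding reach_def by (rule Max_ge[OF finite_reach]) simp
  have "reach n T a \<in> insert a {b. a < b \<and> b < a + int n \<and> string_rep n a b \<in> T}"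
    unfolding reach_def by (rule Max_in[OF finite_reach]) simp
  then show "reach n T a \<le> a + int n - 1" using assms by auto
qed

lemma reach_eqI:
  assumes n: "0 < n" and "a \<le> x" "x \<le> a + int n - 1" "\<And>b. a < b \<Longrightarrow> b < a + int n \<Longrightarrow> b \<le> reach n T a \<longleftrightarrow> b \<le> x"
  shows "reach n T a = x"
proof (rule antisym)
  show "reach n T a \<le> x"
    using assms(2) assms(4)[of "reach n T a"] reach_bounds[OF n, where a = a and T = T] by (cases "reach n T a = a") auto
  show "x \<le> reach n T a"
    using assms(3) assms(4)[of x] reach_bounds[OF n, where a = a and T = T] by (cases "x = a") (use assms(2) in auto)
qed

text \<open>Suppose that \<open>a < b \<le> c\<close> with \<open>c = reach n T a\<close> less than \<open>a + n - 1\<close>. If \<open>T\<close> contained the string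
  from \<open>b\<close> to \<open>c + 1\<close>, it would contain the string from \<open>a\<close> to \<open>c + 1\<close>, which is an extension of the
  string from \<open>a\<close> to \<open>b\<close> by it.\<close>

lemma reach_torsion_fun:
  assumes n: "0 < n" and T: "T \<in> ATam_Tors n"
  shows "torsion_fun n (reach n T)"
  unfolding torsion_fun_def
proof (intro conjI allI impI)
  fix a
  show "a \<le> reach n T a" "reach n T a \<le> a + int n - 1" by (rule reach_bounds[OF n])+
  show "reach n T (a + int n) = reach n T a + int n"
  proof (rule reach_eqI[OF n])
    fix b assume b: "a + int n < b" "b < a + int n + int n"
    then have "string_rep n (a + int n) b = string_rep n a (b - int n)"
      using string_rep_shift[of a "b - int n" n 1] by simp
    then show "b \<le> reach n T (a + int n) \<longleftrightarrow> b \<le> reach n T a + int n"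
      using string_in_torsion_class_iff[OF T, of "a + int n" b] string_in_torsion_class_iff[OF T, of a "b - int n"] b
      by auto
  qed (use reach_bounds[OF n, where a = a and T = T] in auto)
next
  fix a b assume "a < b \<and> b \<le> reach n T a \<and> reach n T a < a + int n - 1"
  then have ab: "a < b" "b \<le> reach n T a" "reach n T a < a + int n - 1" by auto
  define c where "c = reach n T a"
  show "reach n T b \<le> reach n T a"
  proof (rule ccontr)
    assume "\<not> ?thesis"
    then have bc: "c + 1 \<le> reach n T b" by (simp add: c_def)
    have s: "string_rep n b (c + 1) \<in> T" "string_rep n a b \<in> T"
      using ab bc by (auto simp: string_in_torsion_class_iff[OF T] c_def)
    have "string_rep n a (c + 1) \<in> reps n" using ab by (intro string_in_reps) (auto simp: c_def)
    then have "string_rep n a (c + 1) \<in> T"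
      using ab torsion_classD(5)[OF T s _ string_short_exact[of a b "c + 1" n]] by (auto simp: c_def)
    then show False using ab string_in_torsion_class_iff[OF T, of a "c + 1"] by (auto simp: c_def)
  qed
qed

text \<open>A representation belongs to a torsion class if and only if its string summands do.\<close>

lemma torsion_class_subset_iff:
  assumes T: "T \<in> ATam_Tors n" and S: "S \<in> ATam_Tors n" and n: "0 < n"
  shows "S \<subseteq> T \<longleftrightarrow> reach n S \<le> reach n T"
proof
  assume sub: "S \<subseteq> T"
  show "reach n S \<le> reach n T"
  proof (rule le_funI)
    fix a
    show "reach n S a \<le> reach n T a"
    proof (cases "reach n S a = a")
      case False
      then have b: "a < reach n S a" "reach n S a < a + int n"
        using reach_bounds[OF n, where a = a and T = S] by auto
      then show ?thesis
        using sub string_in_torsion_class_iff[OF S b] string_in_torsion_class_iff[OF T b] by auto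
    qed (use reach_bounds[OF n, where a = a and T = T] in auto)
  qed
next
  assume le: "reach n S \<le> reach n T"
  show "S \<subseteq> T"
  proof
    fix M assume MS: "M \<in> S"
    then have "M \<in> reps n" using torsion_classD(1)[OF S] by blast
    then show "M \<in> T" using MS
    proof (induction rule: reps_induct)
      case (zero M)
      then show ?case using torsion_class_zero[OF T] by blast
    next
      case (sum M N a b s1 s2 r1 r2)
      note R = sum(1) string_in_reps[OF sum(3,4)] sum(2)
      have "string_rep n a b \<in> S" "N \<in> S"
        using torsion_class_biproduct[OF S sum(5) R] sum(7) by auto
      moreover from this(1) have "string_rep n a b \<in> T"
        using le_funD[OF le, of a] string_in_torsion_class_iff[OF S sum(3,4)]
          string_in_torsion_class_iff[OF T sum(3,4)] by simp
      ultimately show ?case using torsion_class_biproduct[OF T sum(5) R] sum(6) by blast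
    qed
  qed
qed

lemma torsion_class_eq_iff:
  assumes T: "T \<in> ATam_Tors n" and S: "S \<in> ATam_Tors n" and n: "0 < n"
  shows "S = T \<longleftrightarrow> reach n S = reach n T"
  using torsion_class_subset_iff[OF T S n] torsion_class_subset_iff[OF S T n] by (auto intro: antisym)

text \<open>A nonzero map from \<open>M\<close> to the string from \<open>a\<close> to \<open>e a + 1\<close> is a nonzero functional on the
  cokernel of the path from \<open>a - 1\<close> to \<open>e a\<close>.  The torsion class of \<open>e\<close> is the class of
  representations without such maps, that is, with all these paths surjective.\<close>

definition path_surj :: "rep \<Rightarrow> int \<Rightarrow> nat \<Rightarrow> bool" where
  "path_surj M i k \<longleftrightarrow> (\<forall>v\<in>carrier_vec (vdim M (i + int k)). \<exists>w\<in>carrier_vec (vdim M i). path_map M i k *\<^sub>v w = v)"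

definition class_of_fun :: "nat \<Rightarrow> (int \<Rightarrow> int) \<Rightarrow> rep set" where
  "class_of_fun n e = {M \<in> reps n. \<forall>a. e a < a + int n - 1 \<longrightarrow> path_surj M (a - 1) (nat (e a + 1 - a))}"

lemma path_surj_quotient:
  assumes MN: "is_quotient n M N" "M \<in> reps n" "N \<in> reps n" and p: "path_surj M i k"
  shows "path_surj N i k"
  unfolding path_surj_def
proof
  obtain f where "is_epi n M N f" using MN(1) unfolding is_quotient_def by blast
  then have f: "is_hom n M N f" and surj: "\<And>i. (\<lambda>v. f i *\<^sub>v v) ` carrier_vec (vdim M i) = carrier_vec (vdim N i)"
    unfolding is_epi_def by auto
  note [simp] = hom_dims[OF f] reps_dims[OF MN(2)] reps_dims[OF MN(3)]
  fix v :: "complex vec" assume "v \<in> carrier_vec (vdim N (i + int k))"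
  then obtain x where x: "x \<in> carrier_vec (vdim M (i + int k))" "v = f (i + int k) *\<^sub>v x"
    using surj[of "i + int k"] by auto
  then obtain y where y: "y \<in> carrier_vec (vdim M i)" "path_map M i k *\<^sub>v y = x"
    using p unfolding path_surj_def by blast
  have "path_map N i k *\<^sub>v (f i *\<^sub>v y) = v"
    using hom_path_vec[OF f MN(2,3) y(1), of k] x y by simp
  moreover have "f i *\<^sub>v y \<in> carrier_vec (vdim N i)" by simp
  ultimately show "\<exists>w\<in>carrier_vec (vdim N i). path_map N i k *\<^sub>v w = v" by blast
qed

text \<open>Diagram chase: a vector of \<open>E\<close> is corrected by the image of a lift of its class in \<open>B\<close>, and the
  difference comes from \<open>A\<close>.\<close>

lemma path_surj_extension:
  assumes ex: "short_exact n A f E g B" and R: "A \<in> reps n" "E \<in> reps n" "B \<in> reps n"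
    and p: "path_surj A i k" "path_surj B i k"
  shows "path_surj E i k"
  unfolding path_surj_def
proof
  have f: "is_hom n A E f" and g: "is_hom n E B g"
    and surj: "\<And>i. (\<lambda>v. g i *\<^sub>v v) ` carrier_vec (vdim E i) = carrier_vec (vdim B i)"
    and ker: "\<And>i. (\<lambda>v. f i *\<^sub>v v) ` carrier_vec (vdim A i) = mat_kernel (g i)"
    using ex unfolding short_exact_def is_mono_def is_epi_def by auto
  note [simp] = hom_dims[OF f] hom_dims[OF g] reps_dims[OF R(1)] reps_dims[OF R(2)] reps_dims[OF R(3)]
  fix v :: "complex vec" assume v: "v \<in> carrier_vec (vdim E (i + int k))"
  have "g (i + int k) *\<^sub>v v \<in> carrier_vec (vdim B (i + int k))" by simp
  then obtain y where y: "y \<in> carrier_vec (vdim B i)" "path_map B i k *\<^sub>v y = g (i + int k) *\<^sub>v v"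
    using p(2) unfolding path_surj_def by blast
  then obtain x where x: "x \<in> carrier_vec (vdim E i)" "y = g i *\<^sub>v x"
    using surj[of i] by auto
  have "g (i + int k) *\<^sub>v (path_map E i k *\<^sub>v x) = g (i + int k) *\<^sub>v v"
    using hom_path_vec[OF g R(2,3) x(1), of k] x y by simp
  then have "g (i + int k) *\<^sub>v (v - path_map E i k *\<^sub>v x) = 0\<^sub>v (vdim B (i + int k))"
    using v by (subst mult_minus_distrib_mat_vec[of _ "vdim B (i + int k)" "vdim E (i + int k)"]) auto
  then have "v - path_map E i k *\<^sub>v x \<in> mat_kernel (g (i + int k))"
    using v by (intro mat_kernelI[of _ "vdim B (i + int k)" "vdim E (i + int k)"]) auto
  then have "v - path_map E i k *\<^sub>v x \<in> (\<lambda>z. f (i + int k) *\<^sub>v z) ` carrier_vec (vdim A (i + int k))"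
    unfolding ker .
  then obtain z where z: "z \<in> carrier_vec (vdim A (i + int k))" "f (i + int k) *\<^sub>v z = v - path_map E i k *\<^sub>v x"
    by (metis imageE)
  then obtain w where w: "w \<in> carrier_vec (vdim A i)" "path_map A i k *\<^sub>v w = z"
    using p(1) unfolding path_surj_def by blast
  have "path_map E i k *\<^sub>v (f i *\<^sub>v w) = v - path_map E i k *\<^sub>v x"
    using hom_path_vec[OF f R(1,2) w(1), of k] w z by simp
  then have "path_map E i k *\<^sub>v (x + f i *\<^sub>v w) = path_map E i k *\<^sub>v x + (v - path_map E i k *\<^sub>v x)"
    using x(1) by (simp add: vec_add_dim)
  also have "\<dots> = v" using v by (intro eq_vecI) auto
  finally have "path_map E i k *\<^sub>v (x + f i *\<^sub>v w) = v" .
  moreover have "x + f i *\<^sub>v w \<in> carrier_vec (vdim E i)" using x(1) by simp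
  ultimately show "\<exists>w\<in>carrier_vec (vdim E i). path_map E i k *\<^sub>v w = v" by blast
qed

lemma zero_rep_in_reps: "zero_rep \<in> reps n"
proof (rule repsI)
  have "path_map zero_rep i k = 0\<^sub>m 0 0" for i k
    by (induction k) (auto simp: zero_rep_def intro: eq_matI)
  then show "path_map zero_rep i (n - 1) = 0\<^sub>m (vdim zero_rep (i + int (n - 1))) (vdim zero_rep i)" for i
    by (simp add: zero_rep_def)
qed (simp_all add: zero_rep_def)

lemma class_of_fun_torsion_class: "class_of_fun n e \<in> ATam_Tors n"
  unfolding ATam_Tors_def mem_Collect_eq torsion_class_def
proof (intro conjI ballI impI)
  show "class_of_fun n e \<subseteq> reps n" unfolding class_of_fun_def by auto
  have "path_surj zero_rep i k" for i k
  proof -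
    have [simp]: "vdim zero_rep i = 0" for i by (simp add: zero_rep_def)
    show ?thesis
      unfolding path_surj_def
      by (auto simp: reps_dims[OF zero_rep_in_reps[of 0]] intro!: bexI[of _ "0\<^sub>v 0"] eq_vecI)
  qed
  then have "zero_rep \<in> class_of_fun n e" unfolding class_of_fun_def by (simp add: zero_rep_in_reps)
  then show "class_of_fun n e \<noteq> {}" by blast
  show quot: "N \<in> class_of_fun n e" if "M \<in> class_of_fun n e" "N \<in> reps n" "is_quotient n M N" for M N
    using that path_surj_quotient[OF that(3)] unfolding class_of_fun_def by auto
  show "N \<in> class_of_fun n e" if M: "M \<in> class_of_fun n e" "N \<in> reps n" "isomorphic n M N" for M N
  proof -
    obtain f g where "is_hom n M N f" "is_hom n N M g"
      "\<forall>i. g i * f i = 1\<^sub>m (vdim M i) \<and> f i * g i = 1\<^sub>m (vdim N i)" by (rule isomorphicE[OF M(3)])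
    then have "is_quotient n M N" by (intro is_quotientI[of n M N f g]) (auto simp: hom_dims)
    then show ?thesis using quot M by blast
  qed
  show "E \<in> class_of_fun n e" if A: "A \<in> class_of_fun n e" "B \<in> class_of_fun n e" "E \<in> reps n"
    and ex: "\<exists>f g. short_exact n A f E g B" for A B E
  proof -
    obtain f g where "short_exact n A f E g B" using ex by blast
    then show ?thesis using A path_surj_extension[of n A f E g B] unfolding class_of_fun_def by auto
  qed
qed

lemma path_surj_string:
  assumes ab: "a < b" "b < a + int n"
  shows "path_surj (string_rep n a b) i k \<longleftrightarrow>
    vdim (string_rep n a b) (i + int k) = 0 \<or> (i - a) mod int n + int k < b - a"
proof -
  let ?S = "string_rep n a b"
  have n: "0 < n" using ab by simp
  show ?thesis
  proof (cases "(i - a) mod int n + int k < b - a")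
    case True
    then have one: "vdim ?S i = 1" "vdim ?S (i + int k) = 1"
      using offset_add[OF n, of i a k] ab by (auto simp: vdim_string[OF ab])
    then have "path_map ?S i k = 1\<^sub>m 1" using True by (simp add: path_map_string[OF ab] const_mat_one)
    then have "path_surj ?S i k" unfolding path_surj_def one by auto
    then show ?thesis using True by simp
  next
    case False
    then have P: "path_map ?S i k = 0\<^sub>m (vdim ?S (i + int k)) (vdim ?S i)"
      by (simp add: path_map_string[OF ab] const_mat_zero)
    have zero: "path_map ?S i k *\<^sub>v w = 0\<^sub>v (vdim ?S (i + int k))" if "w \<in> carrier_vec (vdim ?S i)" for w
      unfolding P using that by (intro eq_vecI) (auto simp: scalar_prod_def)
    show ?thesis
    proof (cases "vdim ?S (i + int k) = 0")
      case True
      have "path_map ?S i k *\<^sub>v 0\<^sub>v (vdim ?S i) = v" if "v \<in> carrier_vec 0" for v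
        using that zero[of "0\<^sub>v (vdim ?S i)"] True by (intro eq_vecI) auto
      then show ?thesis using True unfolding path_surj_def by (metis zero_carrier_vec)
    next
      case nz: False
      then have one: "vdim ?S (i + int k) = 1" by (simp add: vdim_string[OF ab] split: if_splits)
      have "\<not> path_surj ?S i k"
      proof
        assume "path_surj ?S i k"
        then obtain w where "w \<in> carrier_vec (vdim ?S i)" "path_map ?S i k *\<^sub>v w = unit_vec 1 0"
          unfolding path_surj_def one by (meson unit_vec_carrier)
        then have "0\<^sub>v 1 = (unit_vec 1 0 :: complex vec)" using zero[of w] one by simp
        then have "(0\<^sub>v 1 :: complex vec) $ 0 = (unit_vec 1 0 :: complex vec) $ 0" by simp
        then show False by simp
      qed
      then show ?thesis using nz False by simp
    qed
  qed
qed

text \<open>The path from \<open>a - 1\<close> to \<open>e a\<close> fails to be surjective on the string from \<open>p\<close> to \<open>q\<close> exactly if a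
  translate of the string starts between \<open>a\<close> and \<open>e a\<close> and ends after \<open>e a\<close>. If \<open>e p < q\<close>, this
  happens for \<open>a = p\<close>; if \<open>q \<le> e p\<close>, the last condition on torsion functions excludes it.\<close>

lemma string_in_class_of_fun_iff:
  assumes e: "torsion_fun n e" and pq: "p < q" "q < p + int n"
  shows "string_rep n p q \<in> class_of_fun n e \<longleftrightarrow> q \<le> e p"
proof
  have n: "0 < n" using pq by simp
  {
    assume S: "string_rep n p q \<in> class_of_fun n e"
    show "q \<le> e p"
    proof (rule ccontr)
      assume "\<not> q \<le> e p"
      then have c: "e p < q" "p \<le> e p" using torsion_funD(1)[OF e] by auto
      then have "path_surj (string_rep n p q) (p - 1) (nat (e p + 1 - p))"
        using S pq unfolding class_of_fun_def by auto
      moreover have "(p - 1 + int (nat (e p + 1 - p)) - p) mod int n = e p - p"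
        using c pq by (intro offset_eqI[of _ _ _ _ 0]) auto
      moreover have "(p - 1 - p) mod int n = int n - 1"
        using n by (intro offset_eqI[of _ _ _ _ "-1"]) auto
      ultimately show False using c pq by (auto simp: path_surj_string[OF pq] vdim_string[OF pq])
    qed
  }
  assume qe: "q \<le> e p"
  have "path_surj (string_rep n p q) (a - 1) (nat (e a + 1 - a))" if a: "e a < a + int n - 1" for a
  proof -
    define c where "c = e a"
    have ac: "a \<le> c" using torsion_funD(1)[OF e] by (simp add: c_def)
    obtain x t where x: "0 \<le> x" "x < int n" "c = p + x + int n * t" "(c - p) mod int n = x"
      by (rule offset_exists[OF n])
    have stop: "a - 1 + int (nat (c + 1 - a)) = c" using ac by simp
    show ?thesis
    proof (cases "x < q - p")
      case False
      then have "vdim (string_rep n p q) (a - 1 + int (nat (c + 1 - a))) = 0"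
        unfolding stop using x by (simp add: vdim_string[OF pq])
      then show ?thesis by (simp add: path_surj_string[OF pq] c_def)
    next
      case True
      define p' where "p' = p + int n * t"
      have ep': "e p' = e p + int n * t" unfolding p'_def by (rule torsion_fun_shift[OF e])
      have "p' < a"
      proof (rule ccontr)
        assume "\<not> p' < a"
        then have "e p' \<le> c" using torsion_funD(3)[OF e, of a p'] a x ac
          by (cases "p' = a") (auto simp: c_def p'_def)
        then show False using ep' qe True x by simp
      qed
      then have "(a - 1 - p) mod int n = a - 1 - p'"
        using x ac by (intro offset_eqI[of _ _ _ _ t]) (auto simp: p'_def)
      then show ?thesis using True x ac by (simp add: path_surj_string[OF pq] c_def[symmetric] p'_def)
    qed
  qed
  then show "string_rep n p q \<in> class_of_fun n e" unfolding class_of_fun_def by (simp add: string_in_reps[OF pq])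
qed

lemma reach_class_of_fun:
  assumes e: "torsion_fun n e"
  shows "reach n (class_of_fun n e) = e"
proof
  fix a
  have n: "0 < n" by (rule torsion_fun_pos[OF e])
  show "reach n (class_of_fun n e) a = e a"
  proof (rule reach_eqI[OF n torsion_funD(1,2)[OF e]])
    fix b assume b: "a < b" "b < a + int n"
    show "b \<le> reach n (class_of_fun n e) a \<longleftrightarrow> b \<le> e a"
      using string_in_torsion_class_iff[OF class_of_fun_torsion_class b, of e] string_in_class_of_fun_iff[OF e b]
      by simp
  qed
qed

lemma covers_iff_fun_covers:
  assumes n: "0 < n" and T: "T \<in> ATam_Tors n" and S: "S \<in> ATam_Tors n"
  shows "covers n T S \<longleftrightarrow> fun_covers n (reach n T) (reach n S)"
proof -
  have psub: "A \<subset> B \<longleftrightarrow> reach n A \<le> reach n B \<and> reach n A \<noteq> reach n B"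
    if "A \<in> ATam_Tors n" "B \<in> ATam_Tors n" for A B
    using torsion_class_subset_iff[OF that(2,1) n] torsion_class_eq_iff[OF that(2,1) n] by auto
  have "(\<exists>U\<in>ATam_Tors n. S \<subset> U \<and> U \<subset> T) \<longleftrightarrow>
    (\<exists>g. torsion_fun n g \<and> reach n S \<le> g \<and> g \<le> reach n T \<and> g \<noteq> reach n T \<and> g \<noteq> reach n S)"
  proof
    assume "\<exists>U\<in>ATam_Tors n. S \<subset> U \<and> U \<subset> T"
    then obtain U where U: "U \<in> ATam_Tors n" "S \<subset> U" "U \<subset> T" by blast
    then show "\<exists>g. torsion_fun n g \<and> reach n S \<le> g \<and> g \<le> reach n T \<and> g \<noteq> reach n T \<and> g \<noteq> reach n S"
      using psub[OF S U(1)] psub[OF U(1) T] reach_torsion_fun[OF n U(1)]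
      by (intro exI[of _ "reach n U"] conjI) (simp_all add: eq_commute)
  next
    assume "\<exists>g. torsion_fun n g \<and> reach n S \<le> g \<and> g \<le> reach n T \<and> g \<noteq> reach n T \<and> g \<noteq> reach n S"
    then obtain g where g: "torsion_fun n g" "reach n S \<le> g" "g \<le> reach n T" "g \<noteq> reach n T" "g \<noteq> reach n S" by blast
    note U = class_of_fun_torsion_class[of n g] and r = reach_class_of_fun[OF g(1)]
    have "S \<subset> class_of_fun n g" using g(2,5) psub[OF S U, unfolded r] by simp
    moreover have "class_of_fun n g \<subset> T" using g(3,4) psub[OF U T, unfolded r] by simp
    ultimately show "\<exists>U\<in>ATam_Tors n. S \<subset> U \<and> U \<subset> T" using U by (intro bexI conjI)
  qed
  then show ?thesis unfolding covers_def fun_covers_def using T S psub[OF S T] by auto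
qed

section \<open>Ext-projective strings\<close>

text \<open>A section of an extension of the string from \<open>a\<close> to \<open>b\<close> by \<open>X\<close> is a lift of the generator
  that the path from \<open>a\<close> to \<open>b\<close> annihilates.  The path sends an arbitrary lift to a vector of \<open>X\<close> at
  \<open>b\<close>, which is annihilated by the path on to \<open>a + n - 1\<close>; the lift can be corrected exactly when this
  vector comes from \<open>X\<close> at \<open>a\<close>.\<close>

definition lift_condition :: "nat \<Rightarrow> int \<Rightarrow> int \<Rightarrow> rep \<Rightarrow> bool" where
  "lift_condition n a b X \<longleftrightarrow> (\<forall>z\<in>carrier_vec (vdim X b).
     path_map X b (nat (a + int n - 1 - b)) *\<^sub>v z = 0\<^sub>v (vdim X (a + int n - 1)) \<longrightarrow>
     (\<exists>h\<in>carrier_vec (vdim X a). path_map X a (nat (b - a)) *\<^sub>v h = z))"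

definition vec_col :: "complex vec \<Rightarrow> complex mat" where
  "vec_col v = mat (dim_vec v) 1 (\<lambda>(r, _). v $ r)"

lemma vec_col_dims [simp]: "dim_row (vec_col v) = dim_vec v" "dim_col (vec_col v) = 1"
  by (simp_all add: vec_col_def)

lemma mult_vec_col: "dim_col A = dim_vec v \<Longrightarrow> A * vec_col v = vec_col (A *\<^sub>v v)"
  by (rule eq_matI) (simp_all add: vec_col_def scalar_prod_def)

lemma vec_col_inj: "vec_col v = vec_col w \<Longrightarrow> v = w"
proof (rule eq_vecI)
  assume eq: "vec_col v = vec_col w"
  have "dim_row (vec_col v) = dim_row (vec_col w)" by (simp only: eq)
  then show d: "dim_vec v = dim_vec w" by simp
  fix i assume "i < dim_vec w"
  moreover have "vec_col v $$ (i, 0) = vec_col w $$ (i, 0)" by (simp only: eq)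
  ultimately show "v $ i = w $ i" using d by (simp add: vec_col_def)
qed

lemma vec_col_surj: "dim_col A = 1 \<Longrightarrow> A = vec_col (col A 0)"
  by (rule eq_matI) (auto simp: vec_col_def)

lemma vec_col_zero: "vec_col (0\<^sub>v r) = 0\<^sub>m r 1"
  by (rule eq_matI) (auto simp: vec_col_def)

lemma reps_at_shift:
  assumes X: "X \<in> reps n" and i: "i = k + int n * t"
  shows "vdim X (i + j) = vdim X (k + j)" "arr X (i + j) = arr X (k + j)"
    "path_map X (i + j) m = path_map X (k + j) m"
proof -
  have i: "i + j = (k + j) + int n * t" using i by simp
  show "vdim X (i + j) = vdim X (k + j)"
    unfolding i by (rule periodic_shift) (rule reps_periodic(1)[OF X])
  show "arr X (i + j) = arr X (k + j)"
    unfolding i by (rule periodic_shift) (rule reps_periodic(2)[OF X])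
  show "path_map X (i + j) m = path_map X (k + j) m"
    unfolding i by (rule periodic_shift[of "\<lambda>i. path_map X i m"]) (rule path_map_periodic[OF X])
qed

lemma path_string_one:
  assumes ab: "a < b" "b < a + int n" and k: "int k < b - a"
  shows "path_map (string_rep n a b) a k = 1\<^sub>m 1"
proof -
  have "(a + int k - a) mod int n = int k" using k ab by simp
  then show ?thesis using k ab by (simp add: path_map_string[OF ab] vdim_string[OF ab] const_mat_one)
qed

context
  fixes n :: nat and a b :: int and X :: rep
  assumes ab: "a < b" "b < a + int n" and X: "X \<in> reps n"
begin

text \<open>The images of the generator give the component in \<open>X\<close> of a lift; correcting the lift by a vector
  \<open>w\<close> of \<open>X\<close> at \<open>a\<close> turns the twist into a coboundary.\<close>

lemma Ext1_vanishes_if_lift_condition: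
  assumes lift: "lift_condition n a b X"
  shows "Ext1_vanishes n (string_rep n a b) X"
  unfolding Ext1_vanishes_iff_coboundary[OF X string_in_reps[OF ab]]
proof (intro allI impI)
  let ?S = "string_rep n a b"
  have n: "0 < n" using ab by simp
  note S = string_in_reps[OF ab]
  fix Y assume Y: "twist n X ?S Y"
  have Yc: "Y i \<in> carrier_mat (vdim X (i + 1)) (vdim ?S i)" for i using Y unfolding twist_def by auto
  \<comment> \<open>\<open>C k\<close> is the component in \<open>X\<close> of the image of the generator after \<open>k\<close> steps in the twisted sum.\<close>
  define C where "C k = path_twist X ?S Y a k" for k
  have vSa: "vdim ?S a = 1" using ab by (simp add: vdim_string[OF ab])
  note [simp] = reps_dims[OF X] reps_dims[OF S] carrier_matD[OF Yc]
  have [simp]: "dim_row (C k) = vdim X (a + int k)" "dim_col (C k) = 1" for k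
    using path_twist_dims[OF X S Yc, of a k] vSa by (auto simp: C_def)
  define l where "l = nat (b - a)"
  have l: "int l = b - a" "0 < l" "l < n" using ab by (auto simp: l_def)
  have C_Suc: "C (Suc k) = arr X (a + int k) * C k + Y (a + int k)" if "k < l" for k
    using path_string_one[OF ab, of k] that l ab by (simp add: C_def one_right_dim vdim_string[OF ab])
  have C_later: "C (l + m) = path_map X b m * C l" for m
  proof (induction m)
    case 0
    then show ?case using l by (simp add: one_left_dim)
  next
    case (Suc m)
    have "path_map ?S a (l + m) = 0\<^sub>m (vdim ?S (a + int (l + m))) 1"
      using l by (simp add: path_map_string[OF ab] const_mat_zero vSa)
    then have "C (l + Suc m) = arr X (a + int (l + m)) * C (l + m)"
      by (simp add: C_def zero_right_dim add_zero_dim carrier_matD[OF path_twist_dims[OF X S Yc]] vSa add_ac)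
    also have "a + int (l + m) = b + int m" using l by simp
    finally show ?case unfolding Suc using l by (simp add: mult_assoc_dim)
  qed
  have top: "C (n - 1) = 0\<^sub>m (vdim X (a + int n - 1)) 1"
  proof -
    have "a + int (n - 1) = a + int n - 1" using n by (simp add: of_nat_diff)
    then show ?thesis using twistD(4)[OF Y, of a] vSa unfolding C_def by metis
  qed
  define m where "m = nat (a + int n - 1 - b)"
  have lm: "l + m = n - 1" using ab l by (simp add: m_def)
  have bm: "b + int m = a + int n - 1" using ab by (simp add: m_def)
  have abl: "a + int l = b" using l by simp
  define z where "z = col (C l) 0"
  have z: "C l = vec_col z" "z \<in> carrier_vec (vdim X b)"
    unfolding z_def using l by (auto intro!: vec_col_surj carrier_vecI)
  have "vec_col (path_map X b m *\<^sub>v z) = C (l + m)"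
    unfolding C_later z(1) using z(2) by (subst mult_vec_col) auto
  also have "\<dots> = vec_col (0\<^sub>v (vdim X (a + int n - 1)))" unfolding lm top vec_col_zero ..
  finally have "path_map X b m *\<^sub>v z = 0\<^sub>v (vdim X (a + int n - 1))" by (rule vec_col_inj)
  then obtain w where w: "w \<in> carrier_vec (vdim X a)" "path_map X a l *\<^sub>v w = z"
    using lift z(2) unfolding lift_condition_def m_def l_def by blast
  define H where "H = vec_col w"
  have [simp]: "dim_row H = vdim X a" "dim_col H = 1" using w by (auto simp: H_def)
  have PH: "path_map X a l * H = C l" unfolding H_def z(1) using w by (simp add: mult_vec_col)
  \<comment> \<open>The coboundary equation determines \<open>h\<close> at \<open>a + k\<close> recursively from its value \<open>H\<close> at \<open>a\<close>; the choice of
    \<open>w\<close> makes the result vanish at the end of the string.\<close>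
  define D where "D k = path_map X a k * H - C k" for k
  have [simp]: "dim_row (D k) = vdim X (a + int k)" "dim_col (D k) = 1" for k by (auto simp: D_def)
  have D_step: "Y (a + int k) = arr X (a + int k) * D k - D (Suc k)" if "k < l" for k
  proof -
    have v: "vdim ?S (a + int k) = 1" using that l ab by (simp add: vdim_string[OF ab])
    have "arr X (a + int k) * D k - D (Suc k) = (arr X (a + int k) * (path_map X a k * H) - arr X (a + int k) * C k) -
       (arr X (a + int k) * (path_map X a k * H) - (arr X (a + int k) * C k + Y (a + int k)))"
      by (simp add: D_def C_Suc[OF that] diff_distrib_left_dim mult_assoc_dim)
    also have "\<dots> = Y (a + int k)" using v by (intro eq_matI) (simp_all add: add_ac del: index_mult_mat(1))
    finally show ?thesis ..
  qed
  have D_last: "D l = 0\<^sub>m (vdim X b) 1" unfolding D_def PH using l by (intro eq_matI) auto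
  define h where "h i = (if (i - a) mod int n < b - a then D (nat ((i - a) mod int n)) else 0\<^sub>m (vdim X i) 0)" for i
  have hper: "h (i + int n) = h i" for i
  proof -
    have "(i + int n - a) mod int n = (i - a) mod int n" by (metis add_diff_eq diff_add_eq mod_add_self2)
    then show ?thesis by (simp add: h_def reps_periodic[OF X])
  qed
  have hc: "h i \<in> carrier_mat (vdim X i) (vdim ?S i)" for i
  proof -
    obtain x t where x: "0 \<le> x" "x < int n" "i = a + x + int n * t" "(i - a) mod int n = x"
      by (rule offset_exists[OF n])
    note at = reps_at_shift(1)[OF X x(3)]
    have "vdim X i = vdim X (a + x)" using at[of 0] by simp
    then show ?thesis using x by (auto simp: h_def vdim_string[OF ab])
  qed
  note [simp] = carrier_matD[OF hc]
  have "Y i = arr X i * h i - h (i + 1) * arr ?S i" for i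
  proof -
    obtain x t where x: "0 \<le> x" "x < int n" "i = a + x + int n * t" "(i - a) mod int n = x"
      by (rule offset_exists[OF n])
    note at = reps_at_shift(2)[OF X x(3)] reps_at_shift(1)[OF X x(3)]
    define k where "k = nat x"
    have k: "x = int k" using x by (simp add: k_def)
    have vX: "vdim X (i + 1) = vdim X (a + int k + 1)" "vdim X i = vdim X (a + int k)"
      using at(2)[of 1] at(2)[of 0] k by auto
    have aX: "arr X i = arr X (a + int k)" using at(1)[of 0] k by simp
    have yi: "Y i = Y (a + int k)" unfolding x(3) k by (rule periodic_shift) (rule twistD(1)[OF Y])
    have off1: "(i + 1 - a) mod int n = (if x + 1 = int n then 0 else x + 1)"
      using offset_succ[OF n, of i a] x by simp
    consider "x + 1 < b - a" | "x + 1 = b - a" | "b - a \<le> x" by linarith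
    then show ?thesis
    proof cases
      case 1
      then have "h (i + 1) = D (Suc k)" "h i = D k" "arr ?S i = 1\<^sub>m 1"
        using off1 x k ab by (auto simp: h_def arr_string[OF ab] vdim_string[OF ab] const_mat_one nat_add_distrib)
      then show ?thesis using D_step[of k] 1 l k by (simp add: yi aX one_right_dim)
    next
      case 2
      then have kl: "Suc k = l" using l k by simp
      have "vdim ?S (i + 1) = 0" using 2 off1 x ab by (auto simp: vdim_string[OF ab])
      then have "h (i + 1) * arr ?S i = 0\<^sub>m (vdim X (i + 1)) 1"
        using 2 x by (intro eq_matI) (auto simp: scalar_prod_def vdim_string[OF ab])
      moreover have "h i = D k" using 2 x k by (simp add: h_def)
      moreover have "Y (a + int k) = arr X (a + int k) * D k - 0\<^sub>m (vdim X b) 1"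
        using D_step[of k] D_last kl by simp
      moreover have "vdim X (i + 1) = vdim X b" using vX kl abl by (metis of_nat_Suc add.assoc add.commute)
      ultimately show ?thesis by (simp add: yi aX)
    next
      case 3
      then show ?thesis using x by (intro eq_mat_empty) (simp_all add: vdim_string[OF ab] vX)
    qed
  qed
  then show "coboundary n X ?S Y" unfolding coboundary_def using hper hc by blast
qed

text \<open>A vector \<open>z\<close> that dies on the way from \<open>b\<close> to \<open>a + n - 1\<close> can be used to glue the end of the
  string to \<open>X\<close>. If the resulting extension splits, the splitting provides the preimage of \<open>z\<close>.\<close>

lemma lift_condition_if_Ext1_vanishes:
  assumes van: "Ext1_vanishes n (string_rep n a b) X"
  shows "lift_condition n a b X"
  unfolding lift_condition_def
proof (intro ballI impI)
  let ?S = "string_rep n a b"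
  have n: "0 < n" using ab by simp
  note S = string_in_reps[OF ab]
  note [simp] = reps_dims[OF X] reps_dims[OF S]
  define l where "l = nat (b - a)"
  have l: "int l = b - a" "0 < l" "l < n" using ab by (auto simp: l_def)
  define m where "m = nat (a + int n - 1 - b)"
  have lm: "l + m = n - 1" using ab l by (simp add: m_def)
  have bm: "b + int m = a + int n - 1" using ab by (simp add: m_def)
  have abl: "a + int l = b" using l by simp
  fix z :: "complex vec" assume z: "z \<in> carrier_vec (vdim X b)"
    and Pz: "path_map X b (nat (a + int n - 1 - b)) *\<^sub>v z = 0\<^sub>v (vdim X (a + int n - 1))"
  define Z where "Z = vec_col z"
  have [simp]: "dim_row Z = vdim X b" "dim_col Z = 1" using z by (auto simp: Z_def)
  have PZ: "path_map X b m * Z = 0\<^sub>m (vdim X (b + int m)) 1"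
    unfolding Z_def using z Pz bm by (simp add: mult_vec_col m_def[symmetric] vec_col_zero)
  \<comment> \<open>The twist that sends the basis vector at \<open>b - 1\<close> to \<open>z\<close>. A path of length \<open>n - 1\<close> that passes this
    place continues in \<open>X\<close> for at least \<open>m\<close> further steps, which annihilate \<open>z\<close>.\<close>
  define Y where "Y i = (if (i - a) mod int n = b - a - 1 then Z else 0\<^sub>m (vdim X (i + 1)) (vdim ?S i))" for i
  have Yper: "Y (i + int n) = Y i" for i
  proof -
    have "(i + int n - a) mod int n = (i - a) mod int n" by (metis add_diff_eq diff_add_eq mod_add_self2)
    moreover have "vdim X (i + int n + 1) = vdim X (i + 1)"
      using reps_periodic(1)[OF X, of "i + 1"] by (simp add: algebra_simps)
    ultimately show ?thesis by (simp add: Y_def reps_periodic[OF S])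
  qed
  have Yc: "Y i \<in> carrier_mat (vdim X (i + 1)) (vdim ?S i)" for i
  proof -
    obtain x t where x: "0 \<le> x" "x < int n" "i = a + x + int n * t" "(i - a) mod int n = x"
      by (rule offset_exists[OF n])
    note at = reps_at_shift(1)[OF X x(3)]
    show ?thesis
    proof (cases "x = b - a - 1")
      case True
      then have "a + x + 1 = b" by simp
      then have "vdim X (i + 1) = vdim X b" using at[of 1] by metis
      then show ?thesis using True x(4) by (simp add: Y_def vdim_string[OF ab] carrier_matI)
    next
      case False
      then show ?thesis using x(4) by (simp add: Y_def)
    qed
  qed
  note [simp] = carrier_matD[OF Yc] carrier_matD[OF path_twist_dims[OF X S Yc]]
  have "path_twist X ?S Y i (n - 1) = 0\<^sub>m (vdim X (i + int (n - 1))) (vdim ?S i)" for i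
  proof (cases "vdim ?S i = 0")
    case True
    then show ?thesis by (intro eq_mat_empty) simp_all
  next
    case False
    obtain x t where x: "0 \<le> x" "x < int n" "i = a + x + int n * t" "(i - a) mod int n = x"
      by (rule offset_exists[OF n])
    note at = reps_at_shift(2)[OF X x(3)] reps_at_shift(1)[OF X x(3)]
    have xl: "x < b - a" and v1: "vdim ?S i = 1" using False x by (auto simp: vdim_string[OF ab] split: if_splits)
    define k0 where "k0 = nat (b - a - 1 - x)"
    have k0: "int k0 = b - a - 1 - x" using xl by (simp add: k0_def)
    have Ynot: "Y (i + int k) * path_map ?S i k = 0\<^sub>m (vdim X (i + int k + 1)) 1" if "k \<noteq> k0" "k < n" for k
    proof (cases "x + int k < b - a")
      case True
      then have "(i + int k - a) mod int n = x + int k" using offset_add[OF n, of i a k] x ab by simp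
      then have "Y (i + int k) = 0\<^sub>m (vdim X (i + int k + 1)) (vdim ?S (i + int k))"
        using that k0 by (auto simp: Y_def)
      then show ?thesis by (simp add: zero_left_dim v1)
    next
      case False
      then have "path_map ?S i k = 0\<^sub>m (vdim ?S (i + int k)) 1"
        using x v1 by (simp add: path_map_string[OF ab] const_mat_zero)
      then show ?thesis by (simp add: zero_right_dim)
    qed
    have early: "path_twist X ?S Y i k = 0\<^sub>m (vdim X (i + int k)) 1" if "k \<le> k0" for k
      using that
    proof (induction k)
      case (Suc k)
      have "k < n" using Suc(2) k0 l x by linarith
      then show ?case using Suc Ynot[of k] by (simp add: zero_right_dim add_zero_dim add_ac)
    qed (simp add: v1)
    have ib: "vdim X (i + int (Suc k0) + j) = vdim X (b + j)" "arr X (i + int (Suc k0) + j) = arr X (b + j)" for j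
    proof -
      have 1: "i + int (Suc k0) + j = i + (int (Suc k0) + j)" by simp
      have 2: "a + x + (int (Suc k0) + j) = b + j" using k0 by simp
      show "vdim X (i + int (Suc k0) + j) = vdim X (b + j)"
        unfolding 1 using at(2)[of "int (Suc k0) + j"] unfolding 2 .
      show "arr X (i + int (Suc k0) + j) = arr X (b + j)"
        unfolding 1 using at(1)[of "int (Suc k0) + j"] unfolding 2 .
    qed
    have late: "path_twist X ?S Y i (Suc k0 + j) = path_map X b j * Z" if "Suc k0 + j \<le> n" for j
      using that
    proof (induction j)
      case 0
      have "path_map ?S i k0 = 1\<^sub>m 1" "vdim ?S (i + int k0) = 1"
        using k0 x v1 xl ab offset_add[OF n, of i a k0]
        by (auto simp: path_map_string[OF ab] const_mat_one vdim_string[OF ab])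
      moreover have "(i + int k0 - a) mod int n = b - a - 1"
        using offset_add[OF n, of i a k0] x k0 ab by simp
      then have "Y (i + int k0) = Z" by (simp add: Y_def)
      moreover have "vdim X (i + int k0 + 1) = vdim X b" using ib(1)[of 0] by (simp add: add_ac)
      ultimately show ?case using early[of k0]
        by (simp add: zero_right_dim zero_add_dim one_left_dim one_right_dim)
    next
      case (Suc j)
      have IH: "path_twist X ?S Y i (Suc (k0 + j)) = path_map X b j * Z" using Suc by simp
      have e: "i + int (Suc (k0 + j)) = i + int (Suc k0) + int j" by simp
      have "path_twist X ?S Y i (Suc k0 + Suc j) = arr X (i + int (Suc (k0 + j))) * path_twist X ?S Y i (Suc (k0 + j)) +
         Y (i + int (Suc (k0 + j))) * path_map ?S i (Suc (k0 + j))"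
        unfolding add_Suc add_Suc_right by (rule path_twist.simps(2))
      also have "arr X (i + int (Suc (k0 + j))) = arr X (b + int j)" unfolding e by (rule ib(2))
      also note IH
      also have "Y (i + int (Suc (k0 + j))) * path_map ?S i (Suc (k0 + j)) = 0\<^sub>m (vdim X (i + int (Suc (k0 + j)) + 1)) 1"
        using Suc(2) by (intro Ynot) auto
      also have "vdim X (i + int (Suc (k0 + j)) + 1) = vdim X (b + int j + 1)"
        using ib(1)[of "int j + 1"] e by (simp add: add_ac)
      finally show ?case by (simp add: mult_assoc_dim add_zero_dim)
    qed
    define j where "j = n - 1 - Suc k0"
    have sk: "Suc k0 \<le> n - 1" using k0 l x by linarith
    then have jn: "Suc k0 + j = n - 1" by (simp add: j_def)
    have "m \<le> j" using jn lm k0 l x by linarith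
    then have "path_map X b j = path_map X (b + int m) (j - m) * path_map X b m"
      using path_map_add[OF X, of b m "j - m"] by simp
    then have "path_map X b j * Z = path_map X (b + int m) (j - m) * (path_map X b m * Z)"
      by (simp add: mult_assoc_dim)
    also have "\<dots> = 0\<^sub>m (vdim X (b + int j)) 1"
      unfolding PZ using \<open>m \<le> j\<close> by (simp add: zero_right_dim of_nat_diff)
    also have "vdim X (b + int j) = vdim X (i + int (n - 1))"
      using ib(1)[of "int j"] jn by (metis add.assoc of_nat_add)
    finally have "path_map X b j * Z = 0\<^sub>m (vdim X (i + int (n - 1))) 1" .
    moreover have "path_twist X ?S Y i (n - 1) = path_map X b j * Z" using late[of j] unfolding jn by simp
    ultimately show ?thesis unfolding v1 by simp
  qed
  then have "twist n X ?S Y" unfolding twist_def using Yper Yc by blast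
  then have "coboundary n X ?S Y" using van unfolding Ext1_vanishes_iff_coboundary[OF X S] by blast
  then obtain h where hc: "\<And>i. h i \<in> carrier_mat (vdim X i) (vdim ?S i)"
    and hY: "\<And>i. Y i = arr X i * h i - h (i + 1) * arr ?S i" unfolding coboundary_def by blast
  note [simp] = carrier_matD[OF hc]
  have va: "vdim ?S (a + int k) = 1" if "k < l" for k using that l ab by (simp add: vdim_string[OF ab])
  have [simp]: "vdim ?S a = 1" using va[of 0] l by simp
  \<comment> \<open>Before \<open>b - 1\<close> the twist is zero, so \<open>h\<close> is carried along the arrows of \<open>X\<close>.\<close>
  have step: "h (a + int k) = path_map X a k * h a" if "k < l" for k
    using that
  proof (induction k)
    case 0
    then show ?case by (simp add: one_left_dim)
  next
    case (Suc k)
    have "(a + int k - a) mod int n = int k" using Suc l by simp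
    then have "Y (a + int k) = 0\<^sub>m (vdim X (a + int k + 1)) 1" "arr ?S (a + int k) = 1\<^sub>m 1"
      using Suc l va[of k] va[of "Suc k"] by (auto simp: Y_def arr_string[OF ab] const_mat_one add_ac)
    then have eq: "0\<^sub>m (vdim X (a + int k + 1)) 1 = arr X (a + int k) * h (a + int k) - h (a + int k + 1)"
      using hY[of "a + int k"] va[of "Suc k"] Suc by (simp add: one_right_dim add_ac)
    have "h (a + int k + 1) = arr X (a + int k) * h (a + int k)"
    proof (rule eq_matI)
      fix r c assume "r < dim_row (arr X (a + int k) * h (a + int k))" "c < dim_col (arr X (a + int k) * h (a + int k))"
      then have rc: "r < vdim X (a + int k + 1)" "c < 1" using va[of k] Suc by auto
      have "(arr X (a + int k) * h (a + int k) - h (a + int k + 1)) $$ (r, c) = 0"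
        unfolding eq[symmetric] using rc by simp
      then show "h (a + int k + 1) $$ (r, c) = (arr X (a + int k) * h (a + int k)) $$ (r, c)"
        using rc va[of "Suc k"] va[of k] Suc by (simp add: add_ac del: index_mult_mat(1))
    qed (use va[of "Suc k"] va[of k] Suc in \<open>simp_all add: add_ac\<close>)
    then show ?case using Suc by (simp add: mult_assoc_dim add_ac)
  qed
  obtain k where k: "l = Suc k" using l by (cases l) auto
  have "(a + int k - a) mod int n = b - a - 1" using k l by simp
  then have YZ: "Y (a + int k) = Z" by (simp add: Y_def)
  have "(b - a) mod int n = b - a" using ab by simp
  then have "vdim ?S (a + int k + 1) = 0" using k abl ab by (simp add: vdim_string[OF ab] add_ac)
  then have "h (a + int k + 1) * arr ?S (a + int k) = 0\<^sub>m (vdim X b) 1"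
    using va[of k] k abl by (intro eq_matI) (auto simp: scalar_prod_def add_ac)
  then have "Z = arr X (a + int k) * (path_map X a k * h a) - 0\<^sub>m (vdim X b) 1"
    using hY[of "a + int k"] step[of k] k by (simp add: YZ)
  also have "\<dots> = arr X (a + int k) * (path_map X a k * h a)"
  proof -
    have "a + int k + 1 = b" using k abl by simp
    then have "vdim X b = vdim X (a + int k + 1)" by simp
    then show ?thesis by (intro eq_matI) (simp_all del: index_mult_mat(1))
  qed
  also have "\<dots> = path_map X a l * h a" by (simp add: k mult_assoc_dim)
  finally have "Z = path_map X a l * h a" .
  moreover have "h a = vec_col (col (h a) 0)" using va[of 0] l by (intro vec_col_surj) simp
  ultimately have "vec_col z = vec_col (path_map X a l *\<^sub>v col (h a) 0)"
    by (metis Z_def mult_vec_col reps_dims(4)[OF X] dim_col carrier_matD(1)[OF hc])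
  then have "path_map X a l *\<^sub>v col (h a) 0 = z" by (rule vec_col_inj[symmetric])
  moreover have "col (h a) 0 \<in> carrier_vec (vdim X a)" by (rule carrier_vecI) simp
  ultimately show "\<exists>h\<in>carrier_vec (vdim X a). path_map X a (nat (b - a)) *\<^sub>v h = z"
    unfolding l_def by blast
qed

end

lemma lift_condition_zero:
  assumes X: "X \<in> reps n" "is_zero X"
  shows "lift_condition n a b X"
proof -
  have [simp]: "vdim X i = 0" for i using X(2) unfolding is_zero_def by blast
  have "path_map X a k *\<^sub>v 0\<^sub>v 0 = z" if "z \<in> carrier_vec 0" for z k
    using that by (intro eq_vecI) (auto simp: reps_dims[OF X(1)])
  then show ?thesis unfolding lift_condition_def by (auto intro!: bexI[of _ "0\<^sub>v 0"])
qed

lemma lift_condition_biproduct: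
  assumes ab: "a < b" "b < a + int n" and b: "biproduct n E X M s1 s2 r1 r2"
    and R: "E \<in> reps n" "X \<in> reps n" "M \<in> reps n"
    and lift: "lift_condition n a b X" "lift_condition n a b M"
  shows "lift_condition n a b E"
  unfolding lift_condition_def
proof (intro ballI impI)
  note bp = biproductD[OF b]
  note [simp] = biproduct_dims[OF b]
    reps_dims[OF R(1)] reps_dims[OF R(2)] reps_dims[OF R(3)]
  let ?m = "nat (a + int n - 1 - b)" and ?l = "nat (b - a)"
  have bm: "b + int ?m = a + int n - 1" and al: "a + int ?l = b" using ab by auto
  fix z assume z: "z \<in> carrier_vec (vdim E b)" and Pz: "path_map E b ?m *\<^sub>v z = 0\<^sub>v (vdim E (a + int n - 1))"
  have "path_map X b ?m *\<^sub>v (r1 b *\<^sub>v z) = r1 (b + int ?m) *\<^sub>v 0\<^sub>v (vdim E (a + int n - 1))"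
    unfolding hom_path_vec[OF bp(3) R(1,2) z] Pz ..
  also have "\<dots> = 0\<^sub>v (vdim X (a + int n - 1))" unfolding bm by (intro eq_vecI) (auto simp: scalar_prod_def)
  finally obtain h1 where h1: "h1 \<in> carrier_vec (vdim X a)" "path_map X a ?l *\<^sub>v h1 = r1 b *\<^sub>v z"
    using lift(1) unfolding lift_condition_def by (metis mult_mat_vec_carrier_dim hom_dims(1)[OF bp(3)])
  have "path_map M b ?m *\<^sub>v (r2 b *\<^sub>v z) = r2 (b + int ?m) *\<^sub>v 0\<^sub>v (vdim E (a + int n - 1))"
    unfolding hom_path_vec[OF bp(4) R(1,3) z] Pz ..
  also have "\<dots> = 0\<^sub>v (vdim M (a + int n - 1))" unfolding bm by (intro eq_vecI) (auto simp: scalar_prod_def)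
  finally obtain h2 where h2: "h2 \<in> carrier_vec (vdim M a)" "path_map M a ?l *\<^sub>v h2 = r2 b *\<^sub>v z"
    using lift(2) unfolding lift_condition_def by (metis mult_mat_vec_carrier_dim hom_dims(1)[OF bp(4)])
  have "path_map E a ?l *\<^sub>v (s1 a *\<^sub>v h1 + s2 a *\<^sub>v h2) =
      path_map E a ?l *\<^sub>v (s1 a *\<^sub>v h1) + path_map E a ?l *\<^sub>v (s2 a *\<^sub>v h2)"
    by (rule vec_add_dim) simp_all
  also have "\<dots> = s1 b *\<^sub>v (r1 b *\<^sub>v z) + s2 b *\<^sub>v (r2 b *\<^sub>v z)"
    unfolding hom_path_vec[OF bp(1) R(2,1) h1(1)] hom_path_vec[OF bp(2) R(3,1) h2(1)] h1(2) h2(2) al ..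
  also have "\<dots> = (s1 b * r1 b + s2 b * r2 b) *\<^sub>v z"
    using z by (simp add: mat_add_vec_dim mult_vec_dim)
  also have "\<dots> = z" unfolding bp(7) using z by simp
  finally have "path_map E a ?l *\<^sub>v (s1 a *\<^sub>v h1 + s2 a *\<^sub>v h2) = z" .
  moreover have "s1 a *\<^sub>v h1 + s2 a *\<^sub>v h2 \<in> carrier_vec (vdim E a)" by simp
  ultimately show "\<exists>h\<in>carrier_vec (vdim E a). path_map E a ?l *\<^sub>v h = z" by blast
qed

text \<open>A nonzero vector at \<open>b\<close> that dies by \<open>a + n - 1\<close> means that a translate of the string starts at
  \<open>p' \<le> b\<close> and ends after \<open>b\<close>, but not after \<open>a + n - 1\<close>. As \<open>(a, b)\<close> is a projective pair,
  \<open>p' \<le> a\<close>, and so the vector comes from \<open>a\<close>.\<close>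

lemma lift_condition_string_if_pair:
  assumes e: "torsion_fun n e" and pair: "projective_pair n e a b" and pq: "p < q" "q < p + int n" "q \<le> e p"
  shows "lift_condition n a b (string_rep n p q)"
  unfolding lift_condition_def
proof (intro ballI impI)
  let ?S = "string_rep n p q"
  note pq' = pq(1,2) and S = string_in_reps[OF pq(1,2)]
  have n: "0 < n" using pq by simp
  have ab: "a < b" "b \<le> a + int n - 1" using projective_pair_bounds[OF e pair] by auto
  let ?m = "nat (a + int n - 1 - b)" and ?l = "nat (b - a)"
  fix z :: "complex vec" assume z: "z \<in> carrier_vec (vdim ?S b)" and Pz: "path_map ?S b ?m *\<^sub>v z = 0\<^sub>v (vdim ?S (a + int n - 1))"
  obtain x t where x: "0 \<le> x" "x < int n" "b = p + x + int n * t" "(b - p) mod int n = x"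
    by (rule offset_exists[OF n])
  have bm: "b + int ?m = a + int n - 1" using ab by simp
  have al: "a + int ?l = b" using ab by simp
  show "\<exists>h\<in>carrier_vec (vdim ?S a). path_map ?S a ?l *\<^sub>v h = z"
  proof (cases "z = 0\<^sub>v (vdim ?S b)")
    case True
    have "path_map ?S a ?l *\<^sub>v 0\<^sub>v (vdim ?S a) = z"
      unfolding True using al by (intro eq_vecI) (auto simp: reps_dims[OF S] scalar_prod_def)
    then show ?thesis by (metis zero_carrier_vec)
  next
    case False
    have v1: "vdim ?S b = 1"
    proof (rule ccontr)
      assume "vdim ?S b \<noteq> 1"
      then have "vdim ?S b = 0" by (simp add: vdim_string[OF pq'] split: if_splits)
      then show False using False z by (auto intro!: eq_vecI)
    qed
    then have xq: "x < q - p" using x by (simp add: vdim_string[OF pq'] split: if_splits)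
    have big: "\<not> x + int ?m < q - p"
    proof
      assume m: "x + int ?m < q - p"
      then have "(b + int ?m - p) mod int n = x + int ?m" using offset_add[OF n, of b p ?m] x pq by simp
      then have "vdim ?S (b + int ?m) = 1" using m by (simp add: vdim_string[OF pq'])
      then have "path_map ?S b ?m = 1\<^sub>m 1" using m x v1 by (simp add: path_map_string[OF pq'] const_mat_one)
      then have "z = 0\<^sub>v (vdim ?S (a + int n - 1))" using Pz z v1 by simp
      then show False using False \<open>vdim ?S (b + int ?m) = 1\<close> v1 unfolding bm by simp
    qed
    define p' where "p' = p + int n * t"
    have ep': "e p' = e p + int n * t" unfolding p'_def by (rule torsion_fun_shift[OF e])
    have bp': "b = p' + x" using x by (simp add: p'_def)
    \<comment> \<open>The string ends between \<open>b\<close> and \<open>a + n - 1\<close>, so the pair prevents it from starting after \<open>a\<close>.\<close>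
    have pa: "p' \<le> a"
    proof (rule ccontr)
      assume "\<not> p' \<le> a"
      moreover have "b \<noteq> a + int n - 1" using big xq by auto
      ultimately have "e p' \<le> b" using pair bp' x(1) unfolding projective_pair_def by auto
      then show False using ep' pq(3) xq bp' p'_def by simp
    qed
    have offa: "(a - p) mod int n = a - p'"
      using pa bp' ab x by (intro offset_eqI[of _ _ _ _ t]) (auto simp: p'_def)
    have va: "vdim ?S a = 1" using offa bp' ab xq by (simp add: vdim_string[OF pq'])
    have "path_map ?S a ?l = 1\<^sub>m 1"
      using offa bp' ab xq va v1 al by (simp add: path_map_string[OF pq'] const_mat_one)
    then have "path_map ?S a ?l *\<^sub>v z = z" using z v1 by simp
    then show ?thesis using z v1 va by metis
  qed
qed

text \<open>The last basis vector of this string sits at \<open>b\<close> and dies in the next step, but it does not come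
  from \<open>a\<close>, which lies outside the string.\<close>

lemma no_lift_condition_string:
  assumes ab: "a < b" "b < a + int n" and c: "a < c" "c \<le> b" and nb: "b \<noteq> a + int n - 1"
  shows "\<not> lift_condition n a b (string_rep n c (b + 1))"
proof
  let ?S = "string_rep n c (b + 1)"
  have pq: "c < b + 1" "b + 1 < c + int n" using ab c nb by auto
  have n: "0 < n" using ab by simp
  note S = string_in_reps[OF pq]
  define m where "m = nat (a + int n - 1 - b)"
  let ?l = "nat (b - a)"
  assume lift: "lift_condition n a b ?S"
  have bm: "b + int m = a + int n - 1" "1 \<le> int m" and al: "a + int ?l = b" using ab nb by (auto simp: m_def)
  have offb: "(b - c) mod int n = b - c" using c pq by simp
  have v1: "vdim ?S b = 1" using offb by (simp add: vdim_string[OF pq])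
  have "path_map ?S b m = 0\<^sub>m (vdim ?S (a + int n - 1)) 1"
    using offb bm v1 by (simp add: path_map_string[OF pq] const_mat_zero)
  then have "path_map ?S b m *\<^sub>v unit_vec 1 0 = 0\<^sub>v (vdim ?S (a + int n - 1))"
    by (intro eq_vecI) (auto simp: scalar_prod_def)
  then obtain h where h: "h \<in> carrier_vec (vdim ?S a)" "path_map ?S a ?l *\<^sub>v h = unit_vec 1 0"
    using lift v1 unfolding lift_condition_def m_def[symmetric] by (metis unit_vec_carrier)
  have "(a - c) mod int n = a - c + int n"
    using ab c by (intro offset_eqI[of _ _ _ _ "-1"]) auto
  then have "path_map ?S a ?l = 0\<^sub>m 1 (vdim ?S a)"
    using al ab c v1 n pq by (simp add: path_map_string[OF pq] const_mat_zero)
  then have "path_map ?S a ?l *\<^sub>v h = 0\<^sub>v 1" using h(1) by (intro eq_vecI) (auto simp: scalar_prod_def)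
  then have "(unit_vec 1 0 :: complex vec) = 0\<^sub>v 1" using h(2) by simp
  then have "(unit_vec 1 0 :: complex vec) $ 0 = 0\<^sub>v 1 $ 0" by simp
  then show False by simp
qed

theorem ext_projective_string_iff:
  assumes T: "T \<in> ATam_Tors n" and ab: "a < b" "b < a + int n"
  shows "ext_projective n T (string_rep n a b) \<longleftrightarrow> projective_pair n (reach n T) a b"
proof
  have n: "0 < n" using ab by simp
  note e = reach_torsion_fun[OF n T]
  {
    assume "ext_projective n T (string_rep n a b)"
    then have s: "string_rep n a b \<in> T" and van: "\<And>X. X \<in> T \<Longrightarrow> Ext1_vanishes n (string_rep n a b) X"
      unfolding ext_projective_def by auto
    have "reach n T c \<le> b" if c: "a < c" "c \<le> b" "b \<noteq> a + int n - 1" for c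
    proof (rule ccontr)
      assume "\<not> reach n T c \<le> b"
      then have "string_rep n c (b + 1) \<in> T"
        using c ab by (subst string_in_torsion_class_iff[OF T]) auto
      then have "lift_condition n a b (string_rep n c (b + 1))"
        using van torsion_classD(1)[OF T] by (intro lift_condition_if_Ext1_vanishes[OF ab]) auto
      then show False using no_lift_condition_string[OF ab c] by blast
    qed
    then show "projective_pair n (reach n T) a b"
      using s ab unfolding projective_pair_def string_in_torsion_class_iff[OF T ab] by blast
  }
  assume pair: "projective_pair n (reach n T) a b"
  then have s: "string_rep n a b \<in> T"
    unfolding string_in_torsion_class_iff[OF T ab] projective_pair_def by blast
  have "lift_condition n a b X" if XT: "X \<in> T" for X
  proof -
    have "X \<in> reps n" using XT torsion_classD(1)[OF T] by blast
    then show ?thesis using XT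
    proof (induction rule: reps_induct)
      case (zero M)
      then show ?case using lift_condition_zero by blast
    next
      case (sum M N p q s1 s2 r1 r2)
      note R = sum(1) string_in_reps[OF sum(3,4)] sum(2)
      have S: "string_rep n p q \<in> T" "N \<in> T" using torsion_class_biproduct[OF T sum(5) R] sum(7) by auto
      then have "lift_condition n a b (string_rep n p q)"
        using string_in_torsion_class_iff[OF T sum(3,4)]
        by (intro lift_condition_string_if_pair[OF e pair sum(3,4)]) simp
      then show ?case using lift_condition_biproduct[OF ab sum(5) R] sum(6) S by blast
    qed
  qed
  then show "ext_projective n T (string_rep n a b)"
    unfolding ext_projective_def using s Ext1_vanishes_if_lift_condition[OF ab] torsion_classD(1)[OF T] by blast
qed

section \<open>The support tau-tilting module\<close>

lemma biproduct_zero_summand: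
  assumes b: "biproduct n E X M s1 s2 r1 r2" and R: "E \<in> reps n" "X \<in> reps n" "M \<in> reps n" and z: "is_zero M"
  shows "isomorphic n E X"
proof (rule isomorphicI)
  note bp = biproductD[OF b]
  show "is_hom n E X r1" "is_hom n X E s1" by (rule bp)+
  show "r1 i * s1 i = 1\<^sub>m (vdim X i)" for i by (rule bp)
  have "s2 i * r2 i = 0\<^sub>m (vdim E i) (vdim E i)" for i
    using z hom_dims[OF bp(2), of i] hom_dims[OF bp(4), of i]
    by (intro eq_matI) (auto simp: scalar_prod_def is_zero_def)
  then show "s1 i * r1 i = 1\<^sub>m (vdim E i)" for i
    using bp(7)[of i] hom_dims[OF bp(1), of i] hom_dims[OF bp(3), of i] by (simp add: add_zero_dim)
qed

text \<open>The idempotent \<open>s * r\<close> of the summand \<open>X\<close> commutes with the paths from \<open>a\<close>. These carry the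
  generator to a basis of every other space, so the idempotent vanishes if it vanishes at \<open>a\<close>.\<close>

lemma string_summand_zero:
  assumes ab: "a < b" "b < a + int n" and X: "X \<in> reps n"
    and s: "is_hom n X (string_rep n a b) s" and r: "is_hom n (string_rep n a b) X r"
    and rs: "\<And>i. r i * s i = 1\<^sub>m (vdim X i)" and gen: "s a * r a = 0\<^sub>m 1 1"
  shows "is_zero X"
  unfolding is_zero_def
proof
  fix i
  let ?S = "string_rep n a b"
  have n: "0 < n" using ab by simp
  note S = string_in_reps[OF ab]
  note [simp] = hom_dims[OF s] hom_dims[OF r] reps_dims[OF S] reps_dims[OF X]
  have "s i * r i = 0\<^sub>m (vdim ?S i) (vdim ?S i)"
  proof (cases "vdim ?S i = 0")
    case True
    then show ?thesis by (intro eq_mat_empty) simp_all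
  next
    case False
    obtain x t where x: "0 \<le> x" "x < int n" "i = a + x + int n * t" "(i - a) mod int n = x"
      by (rule offset_exists[OF n])
    have xb: "x < b - a" using False x by (auto simp: vdim_string[OF ab] split: if_splits)
    have v: "vdim ?S (a + x) = 1" "vdim ?S a = 1" using xb x ab by (auto simp: vdim_string[OF ab])
    have P: "path_map ?S a (nat x) = 1\<^sub>m 1" using path_string_one[OF ab, of "nat x"] xb x by auto
    have "s (a + x) * (r (a + x) * path_map ?S a (nat x)) = path_map ?S a (nat x) * (s a * r a)"
      using hom_path[OF r S X, of a "nat x"] hom_path[OF s X S, of a "nat x"] x(1)
      by (simp add: mult_assoc_dim[symmetric])
    then have "s (a + x) * r (a + x) = 0\<^sub>m 1 1"
      unfolding P gen using v by (simp add: one_right_dim)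
    moreover have "s i = s (a + x)" "r i = r (a + x)" "vdim ?S i = 1"
      unfolding x(3) using False
      by (auto intro!: periodic_shift[of s] periodic_shift[of r] simp: hom_periodic[OF s] hom_periodic[OF r])
        (use False x in \<open>auto simp: vdim_string[OF ab] split: if_splits\<close>)
    ultimately show ?thesis by simp
  qed
  then have "r i * (s i * r i) * s i = 0\<^sub>m (vdim X i) (vdim X i)"
    by (simp add: zero_right_dim zero_left_dim)
  moreover have "r i * (s i * r i) * s i = (r i * s i) * (r i * s i)" by (simp add: mult_assoc_dim)
  ultimately have "1\<^sub>m (vdim X i) = (0\<^sub>m (vdim X i) (vdim X i) :: complex mat)"
    by (simp add: rs one_left_dim)
  then show "vdim X i = 0" by (rule one_mat_zero_dim)
qed

lemma string_indecomposable:
  assumes ab: "a < b" "b < a + int n"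
  shows "indecomposable n (string_rep n a b)"
  unfolding indecomposable_def
proof (intro conjI ballI impI)
  let ?S = "string_rep n a b"
  show S: "?S \<in> reps n" by (rule string_in_reps[OF ab])
  have va: "vdim ?S a = 1" using ab by (simp add: vdim_string[OF ab])
  then show "\<not> is_zero ?S" unfolding is_zero_def by (metis zero_neq_one)
  fix X Y assume X: "X \<in> reps n" and Y: "Y \<in> reps n" and iso: "isomorphic n ?S (direct_sum X Y)"
  then obtain s1 s2 r1 r2 where "biproduct n ?S X Y s1 s2 r1 r2"
    unfolding isomorphic_direct_sum_iff[OF S X Y] by blast
  note bp = biproductD[OF this]
  note [simp] = hom_dims[OF bp(1)] hom_dims[OF bp(2)] hom_dims[OF bp(3)] hom_dims[OF bp(4)] va
  \<comment> \<open>The projection to \<open>X\<close> acts on the one-dimensional space at \<open>a\<close> as an idempotent scalar.\<close>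
  define \<epsilon> where "\<epsilon> = (s1 a * r1 a) $$ (0, 0)"
  have e: "s1 a * r1 a = const_mat 1 1 \<epsilon>"
    by (rule eq_matI) (simp_all add: \<epsilon>_def const_mat_def del: index_mult_mat(1))
  have "s1 a * r1 a * (s1 a * r1 a) = s1 a * r1 a"
    by (simp add: mult_assoc_dim mult_eq_left[OF bp(5)] one_left_dim)
  then have "\<epsilon> * \<epsilon> = \<epsilon>" unfolding e by (simp add: const_mat_mult const_mat_eq_iff)
  then have "\<epsilon> = 0 \<or> \<epsilon> = 1" by simp
  then show "is_zero X \<or> is_zero Y"
  proof
    assume "\<epsilon> = 0"
    then have "s1 a * r1 a = 0\<^sub>m 1 1" using e by (simp add: const_mat_zero)
    then show ?thesis using string_summand_zero[OF ab X bp(1,3) bp(5)] by blast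
  next
    assume 1: "\<epsilon> = 1"
    have "s2 a * r2 a = 0\<^sub>m 1 1"
    proof (rule eq_matI)
      fix i j assume ij: "i < dim_row (0\<^sub>m 1 1 :: complex mat)" "j < dim_col (0\<^sub>m 1 1 :: complex mat)"
      have "(s1 a * r1 a + s2 a * r2 a) $$ (0, 0) = 1" unfolding bp(7) by simp
      then have "\<epsilon> + (s2 a * r2 a) $$ (0, 0) = 1" unfolding \<epsilon>_def by (simp del: index_mult_mat(1))
      then show "(s2 a * r2 a) $$ (i, j) = 0\<^sub>m 1 1 $$ (i, j)" using 1 ij by simp
    qed simp_all
    then show ?thesis using string_summand_zero[OF ab Y bp(2,4) bp(6)] by blast
  qed
qed

lemma indecomposable_is_string:
  assumes M: "indecomposable n M"
  shows "\<exists>a b. 0 \<le> a \<and> a < int n \<and> a < b \<and> b < a + int n \<and> isomorphic n M (string_rep n a b)"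
proof -
  have MR: "M \<in> reps n" and nz: "\<not> is_zero M" using M unfolding indecomposable_def by auto
  obtain a b N s1 s2 r1 r2 where ab: "a < b" "b < a + int n" and N: "N \<in> reps n"
    and bp: "biproduct n M (string_rep n a b) N s1 s2 r1 r2"
    using decompose_string[OF MR nz] by blast
  note S = string_in_reps[OF ab]
  have n: "0 < n" using ab by simp
  have "isomorphic n M (direct_sum (string_rep n a b) N)"
    unfolding isomorphic_direct_sum_iff[OF MR S N] using bp by blast
  moreover have "\<not> is_zero (string_rep n a b)" using string_indecomposable[OF ab] unfolding indecomposable_def by blast
  ultimately have "is_zero N" using M S N unfolding indecomposable_def by blast
  then have iso: "isomorphic n M (string_rep n a b)" by (rule biproduct_zero_summand[OF bp MR S N])
  define t where "t = a div int n"
  have "string_rep n a b = string_rep n (a + int n * (- t)) (b + int n * (- t))" by (rule string_rep_shift[OF ab, symmetric])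
  moreover have at: "a + int n * (- t) = a mod int n" by (simp add: t_def minus_mult_div_eq_mod)
  ultimately have "isomorphic n M (string_rep n (a mod int n) (b + int n * (- t)))" using iso by simp
  moreover have "a mod int n < b + int n * (- t)" "b + int n * (- t) < a mod int n + int n" unfolding at[symmetric] using ab by auto
  ultimately show ?thesis using n by (intro exI[of _ "a mod int n"] exI[of _ "b + int n * (- t)"]) auto
qed

definition retract :: "nat \<Rightarrow> rep \<Rightarrow> rep \<Rightarrow> bool" where
  "retract n M S \<longleftrightarrow> (\<exists>s r. is_hom n M S s \<and> is_hom n S M r \<and> (\<forall>i. r i * s i = 1\<^sub>m (vdim M i)))"

lemma retract_trans:
  assumes "retract n M N" "retract n N P" "M \<in> reps n" "N \<in> reps n" "P \<in> reps n"
  shows "retract n M P"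
proof -
  obtain s r where sr: "is_hom n M N s" "is_hom n N M r" and e: "\<forall>i. r i * s i = 1\<^sub>m (vdim M i)"
    using assms(1) unfolding retract_def by blast
  obtain s' r' where sr': "is_hom n N P s'" "is_hom n P N r'" and e': "\<forall>i. r' i * s' i = 1\<^sub>m (vdim N i)"
    using assms(2) unfolding retract_def by blast
  note [simp] = hom_dims[OF sr(1)] hom_dims[OF sr(2)] hom_dims[OF sr'(1)] hom_dims[OF sr'(2)]
  have "r i * r' i * (s' i * s i) = 1\<^sub>m (vdim M i)" for i
    using e e' by (simp add: mult_assoc_dim mult_eq_left[OF e'[rule_format]] one_left_dim)
  then show ?thesis
    unfolding retract_def using hom_comp[OF sr(1) sr'(1) assms(3-5)] hom_comp[OF sr'(2) sr(2) assms(5,4,3)] by blast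
qed

lemma retract_isomorphic: "isomorphic n M N \<Longrightarrow> retract n M N"
  unfolding retract_def isomorphic_def is_iso_def by blast

lemma retract_direct_sum:
  assumes "X \<in> reps n" "M \<in> reps n"
  shows "retract n X (direct_sum X M)" "retract n M (direct_sum X M)"
  unfolding retract_def using biproductD[OF biproduct_direct_sum[OF assms]] by blast+

lemma direct_sum_list_in_reps: "set Ms \<subseteq> reps n \<Longrightarrow> direct_sum_list Ms \<in> reps n"
  unfolding direct_sum_list_def by (induction Ms) (auto simp: zero_rep_in_reps direct_sum_in_reps)

lemma retract_direct_sum_list:
  "set Ms \<subseteq> reps n \<Longrightarrow> M \<in> set Ms \<Longrightarrow> retract n M (direct_sum_list Ms)"
proof (induction Ms)
  case (Cons X Ms)
  have R: "X \<in> reps n" "direct_sum_list Ms \<in> reps n" "M \<in> reps n"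
    using Cons direct_sum_list_in_reps by auto
  have sum: "direct_sum_list (X # Ms) = direct_sum X (direct_sum_list Ms)" by (simp add: direct_sum_list_def)
  show ?case
  proof (cases "M = X")
    case True
    then show ?thesis unfolding sum using retract_direct_sum[OF R(1,2)] by blast
  next
    case False
    then have "retract n M (direct_sum_list Ms)" using Cons by auto
    then show ?thesis
      unfolding sum using retract_trans[OF _ retract_direct_sum(2)[OF R(1,2)] R(3,2) direct_sum_in_reps[OF R(1,2)]] by blast
  qed
qed simp

lemma ext_projective_biproduct:
  assumes T: "T \<in> ATam_Tors n" and b: "biproduct n E X M s1 s2 r1 r2"
    and R: "E \<in> reps n" "X \<in> reps n" "M \<in> reps n"
  shows "ext_projective n T E \<longleftrightarrow> ext_projective n T X \<and> ext_projective n T M"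
proof -
  note bp = biproductD[OF b]
  have TR: "N \<in> T \<Longrightarrow> N \<in> reps n" for N using torsion_classD(1)[OF T] by blast
  have "Ext1_vanishes n E N \<longleftrightarrow> Ext1_vanishes n X N \<and> Ext1_vanishes n M N" if "N \<in> T" for N
    using Ext1_vanishes_retract[OF _ bp(1,3) bp(5) TR[OF that] R(1,2)]
      Ext1_vanishes_retract[OF _ bp(2,4) bp(6) TR[OF that] R(1,3)]
      Ext1_vanishes_biproduct[OF b _ _ TR[OF that] R(2,3,1)] by blast
  then show ?thesis unfolding ext_projective_def torsion_class_biproduct[OF T b R] by blast
qed

lemma ext_projective_zero:
  assumes T: "T \<in> ATam_Tors n" and Z: "Z \<in> reps n" "is_zero Z"
  shows "ext_projective n T Z"
  unfolding ext_projective_def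
proof (intro conjI ballI)
  show "Z \<in> T" by (rule torsion_class_zero[OF T Z])
  fix N assume "N \<in> T"
  then have N: "N \<in> reps n" using torsion_classD(1)[OF T] by blast
  have [simp]: "vdim Z i = 0" for i using Z(2) unfolding is_zero_def by blast
  show "Ext1_vanishes n Z N"
    unfolding Ext1_vanishes_iff_coboundary[OF N Z(1)]
  proof (intro allI impI)
    fix Y assume Y: "twist n N Z Y"
    have "Y i = arr N i * 0\<^sub>m (vdim N i) 0 - 0\<^sub>m (vdim N (i + 1)) 0 * arr Z i" for i
      by (intro eq_mat_empty) (simp_all add: twistD[OF Y] reps_dims[OF N] reps_dims[OF Z(1)])
    then show "coboundary n N Z Y"
      unfolding coboundary_def by (intro exI[of _ "\<lambda>i. 0\<^sub>m (vdim N i) 0"]) (simp add: reps_periodic[OF N])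
  qed
qed

lemma ext_projective_direct_sum_list:
  assumes T: "T \<in> ATam_Tors n"
  shows "set Ms \<subseteq> reps n \<Longrightarrow> \<forall>M\<in>set Ms. ext_projective n T M \<Longrightarrow> ext_projective n T (direct_sum_list Ms)"
proof (induction Ms)
  case Nil
  then show ?case
    using ext_projective_zero[OF T zero_rep_in_reps] by (simp add: direct_sum_list_def is_zero_def zero_rep_def)
next
  case (Cons X Ms)
  then have R: "X \<in> reps n" "direct_sum_list Ms \<in> reps n" using direct_sum_list_in_reps by auto
  then show ?case
    using ext_projective_biproduct[OF T biproduct_direct_sum[OF R] direct_sum_in_reps[OF R] R] Cons
    by (simp add: direct_sum_list_def)
qed

text \<open>The spaces of a string are at most one-dimensional, so \<open>thin_retract_complement\<close> applies.\<close>

lemma string_summand_iff_retract: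
  assumes ab: "a < b" "b < a + int n" and S: "S \<in> reps n"
  shows "is_summand n (string_rep n a b) S \<longleftrightarrow> retract n (string_rep n a b) S"
proof
  note R = string_in_reps[OF ab]
  {
    assume "is_summand n (string_rep n a b) S"
    then obtain N where N: "N \<in> reps n" "isomorphic n S (direct_sum (string_rep n a b) N)" unfolding is_summand_def by blast
    have "retract n (direct_sum (string_rep n a b) N) S" by (rule retract_isomorphic[OF isomorphic_sym[OF N(2)]])
    then show "retract n (string_rep n a b) S"
      using retract_trans[OF retract_direct_sum(1)[OF R N(1)] _ R direct_sum_in_reps[OF R N(1)] S] by blast
  }
  assume "retract n (string_rep n a b) S"
  then obtain s r where sr: "is_hom n (string_rep n a b) S s" "is_hom n S (string_rep n a b) r"
    and e: "\<And>i. r i * s i = 1\<^sub>m (vdim (string_rep n a b) i)" unfolding retract_def by blast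
  have "vdim (string_rep n a b) i \<le> 1" for i by (simp add: vdim_string[OF ab])
  from thin_retract_complement[OF S R this sr e]
  obtain N j q where "N \<in> reps n" "biproduct n S (string_rep n a b) N s j r q" by blast
  then show "is_summand n (string_rep n a b) S"
    unfolding is_summand_def using isomorphic_direct_sum_iff[OF S R] by blast
qed

text \<open>A representation joins the list only if it is not isomorphic to a member of the list so far.\<close>

lemma list_of_isomorphism_classes:
  assumes "finite F" "F \<subseteq> reps n"
  shows "\<exists>Ms. set Ms \<subseteq> F \<and> sorted_wrt (\<lambda>M N. \<not> isomorphic n M N) Ms \<and> (\<forall>M\<in>F. \<exists>N\<in>set Ms. isomorphic n M N)"
  using assms
proof (induction F rule: finite_induct)
  case (insert M F)
  then obtain Ms where Ms: "set Ms \<subseteq> F" "sorted_wrt (\<lambda>M N. \<not> isomorphic n M N) Ms"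
    "\<forall>M\<in>F. \<exists>N\<in>set Ms. isomorphic n M N" by auto
  show ?case
  proof (cases "\<exists>N\<in>set Ms. isomorphic n M N")
    case True
    then show ?thesis using Ms by (intro exI[of _ Ms]) auto
  next
    case False
    then show ?thesis using Ms insert isomorphic_refl[of M n] by (intro exI[of _ "M # Ms"]) auto
  qed
qed auto

text \<open>Indecomposables are isomorphic to strings, and up to translation there are finitely many strings;
  one Ext-projective indecomposable is chosen for each string that is isomorphic to one.\<close>

lemma stau_tilting_exists: "\<exists>S. is_stau_tilting n T S"
proof -
  define P where "P M \<longleftrightarrow> indecomposable n M \<and> ext_projective n T M" for M
  have PR: "P M \<Longrightarrow> M \<in> reps n" for M unfolding P_def indecomposable_def by blast
  define J where "J = {(a, b). 0 \<le> a \<and> a < int n \<and> a < b \<and> b < a + int n \<and> (\<exists>M. P M \<and> isomorphic n M (string_rep n a b))}"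
  have "J \<subseteq> {0..int n} \<times> {0..2 * int n}" unfolding J_def by auto
  then have fin: "finite J" by (rule finite_subset) simp
  define m where "m = (\<lambda>(a, b). SOME M. P M \<and> isomorphic n M (string_rep n a b))"
  have m: "P (m (a, b)) \<and> isomorphic n (m (a, b)) (string_rep n a b)" if "(a, b) \<in> J" for a b
    using that someI_ex[of "\<lambda>M. P M \<and> isomorphic n M (string_rep n a b)"] unfolding J_def m_def by simp
  have "m ` J \<subseteq> reps n" using m PR by auto
  then obtain Ms where Ms: "set Ms \<subseteq> m ` J" "sorted_wrt (\<lambda>M N. \<not> isomorphic n M N) Ms"
    "\<forall>M\<in>m ` J. \<exists>N\<in>set Ms. isomorphic n M N" using list_of_isomorphism_classes[of "m ` J" n] fin by blast
  have "\<exists>N\<in>set Ms. isomorphic n M N" if M: "P M" for M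
  proof -
    obtain a b where ab: "0 \<le> a" "a < int n" "a < b" "b < a + int n" "isomorphic n M (string_rep n a b)"
      using indecomposable_is_string[of n M] M unfolding P_def by blast
    then have J: "(a, b) \<in> J" using M unfolding J_def by auto
    then obtain N where N: "N \<in> set Ms" "isomorphic n (m (a, b)) N" using Ms(3) by blast
    have R: "m (a, b) \<in> reps n" "N \<in> reps n" "M \<in> reps n" "string_rep n a b \<in> reps n"
      using m[OF J] PR M N(1) Ms(1) m string_in_reps[OF ab(3,4)] by auto
    have "isomorphic n M (m (a, b))"
      using isomorphic_trans[OF ab(5) isomorphic_sym R(3,4,1)] m[OF J] by blast
    then have "isomorphic n M N" using isomorphic_trans[OF _ N(2) R(3,1,2)] by blast
    then show ?thesis using N(1) by blast
  qed
  moreover have "P M" if "M \<in> set Ms" for M using that Ms(1) m by auto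
  ultimately have "is_stau_tilting n T (direct_sum_list Ms)"
    unfolding is_stau_tilting_def P_def using Ms(2) by (intro exI[of _ Ms]) auto
  then show ?thesis by blast
qed

text \<open>Ext-projectivity passes to direct sums and to summands. Conversely, an Ext-projective string is
  isomorphic to a listed module, hence a retract of the sum of the list.\<close>

lemma string_stau_tilting_summand_iff:
  assumes T: "T \<in> ATam_Tors n" and ab: "a < b" "b < a + int n"
  shows "(\<exists>S. is_stau_tilting n T S \<and> is_summand n (string_rep n a b) S) \<longleftrightarrow> ext_projective n T (string_rep n a b)"
proof
  note R = string_in_reps[OF ab]
  have list: "\<exists>Ms. S = direct_sum_list Ms \<and> set Ms \<subseteq> reps n \<and> (\<forall>M\<in>set Ms. ext_projective n T M) \<and>
     (\<forall>M. indecomposable n M \<and> ext_projective n T M \<longrightarrow> (\<exists>N\<in>set Ms. isomorphic n M N))"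
    if "is_stau_tilting n T S" for S
    using that unfolding is_stau_tilting_def indecomposable_def by blast
  {
    assume "\<exists>S. is_stau_tilting n T S \<and> is_summand n (string_rep n a b) S"
    then obtain S where S: "is_stau_tilting n T S" "is_summand n (string_rep n a b) S" by blast
    obtain Ms where Ms: "S = direct_sum_list Ms" "set Ms \<subseteq> reps n" "\<forall>M\<in>set Ms. ext_projective n T M"
      using list[OF S(1)] by blast
    have SR: "S \<in> reps n" and SP: "ext_projective n T S"
      using Ms direct_sum_list_in_reps ext_projective_direct_sum_list[OF T] by auto
    obtain N where N: "N \<in> reps n" "isomorphic n S (direct_sum (string_rep n a b) N)"
      using S(2) unfolding is_summand_def by blast
    then obtain s1 s2 r1 r2 where "biproduct n S (string_rep n a b) N s1 s2 r1 r2"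
      unfolding isomorphic_direct_sum_iff[OF SR R N(1)] by blast
    from ext_projective_biproduct[OF T this SR R N(1)] SP
    show "ext_projective n T (string_rep n a b)" by blast
  }
  assume P: "ext_projective n T (string_rep n a b)"
  obtain S where S: "is_stau_tilting n T S" using stau_tilting_exists by blast
  obtain Ms where Ms: "S = direct_sum_list Ms" "set Ms \<subseteq> reps n"
    "\<forall>M. indecomposable n M \<and> ext_projective n T M \<longrightarrow> (\<exists>N\<in>set Ms. isomorphic n M N)" using list[OF S] by blast
  have SR: "S \<in> reps n" using Ms direct_sum_list_in_reps by auto
  obtain N where N: "N \<in> set Ms" "isomorphic n (string_rep n a b) N"
    using Ms(3) P string_indecomposable[OF ab] by blast
  have NR: "N \<in> reps n" using N Ms by auto
  have "retract n N S" unfolding Ms(1) by (rule retract_direct_sum_list[OF Ms(2) N(1)])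
  then have "retract n (string_rep n a b) S"
    using retract_trans[OF retract_isomorphic[OF N(2)] _ R NR SR] by blast
  then show "\<exists>S. is_stau_tilting n T S \<and> is_summand n (string_rep n a b) S"
    unfolding string_summand_iff_retract[OF ab SR, symmetric] using S by blast
qed

lemma subquotient_simple_vdim:
  assumes n: "2 \<le> n" and M: "M \<in> reps n" and sub: "is_subquotient n M (string_rep n a (a + 1))"
  shows "vdim M a \<noteq> 0"
proof
  assume M0: "vdim M a = 0"
  obtain U f g where U: "U \<in> reps n" "is_mono n U M f" "is_epi n U (string_rep n a (a + 1)) g"
    using sub unfolding is_subquotient_def is_quotient_def by blast
  have f: "is_hom n U M f" and inj: "inj_on (\<lambda>v. f a *\<^sub>v v) (carrier_vec (vdim U a))"
    using U(2) unfolding is_mono_def by auto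
  have g: "is_hom n U (string_rep n a (a + 1)) g"
    and surj: "(\<lambda>v. g a *\<^sub>v v) ` carrier_vec (vdim U a) = carrier_vec (vdim (string_rep n a (a + 1)) a)"
    using U(3) unfolding is_epi_def by auto
  have v1: "vdim (string_rep n a (a + 1)) a = 1" using n by (subst vdim_string) auto
  have one: "v = w" if "v \<in> carrier_vec (vdim U a)" "w \<in> carrier_vec (vdim U a)" for v w :: "complex vec"
  proof (rule inj_onD[OF inj _ that])
    show "f a *\<^sub>v v = f a *\<^sub>v w" by (rule eq_vecI) (simp_all add: hom_dims[OF f] M0)
  qed
  have "unit_vec 1 0 \<in> (\<lambda>v. g a *\<^sub>v v) ` carrier_vec (vdim U a)" "0\<^sub>v 1 \<in> (\<lambda>v. g a *\<^sub>v v) ` carrier_vec (vdim U a)"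
    unfolding surj v1 by auto
  then obtain v w where vw: "v \<in> carrier_vec (vdim U a)" "w \<in> carrier_vec (vdim U a)"
    "g a *\<^sub>v v = unit_vec 1 0" "g a *\<^sub>v w = 0\<^sub>v 1" by auto
  then have "(unit_vec 1 0 :: complex vec) = 0\<^sub>v 1" using one[OF vw(1,2)] by simp
  then have "(unit_vec 1 0 :: complex vec) $ 0 = 0\<^sub>v 1 $ 0" by simp
  then show False by simp
qed

text \<open>The simple at \<open>a\<close> is a quotient of the tail from \<open>a\<close> of any string through \<open>a\<close>. Conversely, a
  representation with this subquotient is nonzero at \<open>a\<close>, and so is one of its string summands.\<close>

lemma simple_not_subquotient_iff:
  assumes T: "T \<in> ATam_Tors n" and n: "2 \<le> n"
  shows "(\<forall>M\<in>T. \<not> is_subquotient n M (string_rep n a (a + 1))) \<longleftrightarrow> uncovered (reach n T) a"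
proof
  have n0: "0 < n" using n by simp
  note e = reach_torsion_fun[OF n0 T]
  {
    assume no: "\<forall>M\<in>T. \<not> is_subquotient n M (string_rep n a (a + 1))"
    show "uncovered (reach n T) a"
      unfolding uncovered_def
    proof (intro allI impI, rule ccontr)
      fix c assume c: "c \<le> a" "\<not> reach n T c \<le> a"
      define d where "d = reach n T c"
      have d: "a < d" "d < c + int n" using c torsion_funD(2)[OF e, of c] by (auto simp: d_def)
      have "string_rep n c d \<in> T" using c d by (subst string_in_torsion_class_iff[OF T]) (auto simp: d_def)
      moreover have "is_subquotient n (string_rep n c d) (string_rep n a (a + 1))"
        unfolding is_subquotient_def
      proof (intro bexI conjI)
        show "string_rep n a d \<in> reps n" using c d by (intro string_in_reps) auto
        show "\<exists>f. is_mono n (string_rep n a d) (string_rep n c d) f" using string_mono[OF c(1) d] by blast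
        show "is_quotient n (string_rep n a d) (string_rep n a (a + 1))" by (rule string_quotient) (use c d in auto)
      qed
      ultimately show False using no by blast
    qed
  }
  assume unc: "uncovered (reach n T) a"
  have "vdim M a = 0" if MT: "M \<in> T" for M
  proof -
    have "M \<in> reps n" using MT torsion_classD(1)[OF T] by blast
    then show ?thesis using MT
    proof (induction rule: reps_induct)
      case (zero M)
      then show ?case unfolding is_zero_def by blast
    next
      case (sum M N p q s1 s2 r1 r2)
      note R = sum(1) string_in_reps[OF sum(3,4)] sum(2) and bp = biproductD[OF sum(5)]
      have S: "string_rep n p q \<in> T" "N \<in> T" using torsion_class_biproduct[OF T sum(5) R] sum(7) by auto
      then have qp: "q \<le> reach n T p" using string_in_torsion_class_iff[OF T sum(3,4)] by simp
      have "vdim (string_rep n p q) a = 0"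
      proof (rule ccontr)
        assume nz: "vdim (string_rep n p q) a \<noteq> 0"
        obtain x t where x: "0 \<le> x" "x < int n" "a = p + x + int n * t" "(a - p) mod int n = x"
          by (rule offset_exists[OF n0])
        have "x < q - p" using nz x by (auto simp: vdim_string[OF sum(3,4)] split: if_splits)
        then have "p + int n * t \<le> a" "a < reach n T (p + int n * t)"
          using x qp by (auto simp: torsion_fun_shift[OF e])
        then show False using unc unfolding uncovered_def by (meson not_le)
      qed
      moreover have "vdim N a = 0" using sum(6) S by blast
      ultimately have "s1 a * r1 a + s2 a * r2 a = 0\<^sub>m (vdim M a) (vdim M a)"
        using hom_dims[OF bp(1), of a] hom_dims[OF bp(2), of a] hom_dims[OF bp(3), of a] hom_dims[OF bp(4), of a]
        by (intro eq_matI) (auto simp: scalar_prod_def)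
      then show ?case unfolding bp(7) by (rule one_mat_zero_dim)
    qed
  qed
  then show "\<forall>M\<in>T. \<not> is_subquotient n M (string_rep n a (a + 1))"
    using subquotient_simple_vdim[OF n] torsion_classD(1)[OF T] by blast
qed

theorem triangulation_eq_arcs:
  assumes T: "T \<in> ATam_Tors n" and n: "2 \<le> n"
  shows "triangulation n T = arcs n (reach n T)"
proof -
  have n0: "0 < n" using n by simp
  have "a < b \<and> b < a + int n \<and> (\<exists>S. is_stau_tilting n T S \<and> is_summand n (string_rep n a b) S) \<longleftrightarrow>
    projective_pair n (reach n T) a b" for a b
  proof (cases "a < b \<and> b < a + int n")
    case True
    then show ?thesis
      using string_stau_tilting_summand_iff[OF T, of a b] ext_projective_string_iff[OF T, of a b] by simp
  next
    case False
    then show ?thesis using projective_pair_bounds[OF reach_torsion_fun[OF n0 T], of a b] by auto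
  qed
  then show ?thesis
    unfolding triangulation_def arcs_def simple_not_subquotient_iff[OF T n] by simp
qed

theorem corollary7p14:
  fixes n :: nat and T1 T2 :: "rep set"
  assumes "n \<ge> 2"
    and "T1 \<in> ATam_Tors n" and "T2 \<in> ATam_Tors n"
  shows "flip_related n (triangulation n T1) (triangulation n T2) \<longleftrightarrow>
         covers n T1 T2 \<or> covers n T2 T1"
proof -
  have n: "0 < n" using assms(1) by simp
  show ?thesis
    unfolding flip_related_def triangulation_eq_arcs[OF assms(2,1)] triangulation_eq_arcs[OF assms(3,1)]
      covers_iff_fun_covers[OF n assms(2,3)] covers_iff_fun_covers[OF n assms(3,2)]
    by (rule flip_iff_fun_covers[OF reach_torsion_fun[OF n assms(2)] reach_torsion_fun[OF n assms(3)]])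
qed

end
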